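(* Let $W$ be a graphon such that $W$ and $x\mapsto W(x,x)$ are Riemann integrable and $\int_{[0,1]^2}W(x,y)\,dx\,dy>0$. Let $\beta\in(0,1/\|W\|_{\mathrm{op}})$, and let $\theta_N\in(0,1)$ satisfy $N^{2/3}\theta_N\gtrsim1$ and $\theta_N\to0$. Let $G_N\sim G(N,\theta_N,W)$ and let $\vec\sigma\sim\mathbb P_\beta$ given $G_N$. Define $$\tilde\beta_N:=-\frac{2N^2\theta_N^2}{\sum_{1\le i,j\le N}A_{G_N}(i,j)}H_N(\vec\sigma).$$ Then, as $N\to\infty$, $$\frac{1}{\sqrt{\theta_N}}(\tilde\beta_N-\beta)\xrightarrow{D}\mathcal N\left(0,\frac{2}{\int_{[0,1]^2}W(x,y)\,dx\,dy}\right),$$ where the convergence is with respect to the joint randomness of $G_N$ and $\vec\sigma$.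
   Context: A graphon is a symmetric measurable function $W:[0,1]^2\to[0,1]$; $\|W\|_{\mathrm{op}}$ is the operator norm of $T_W:L^2[0,1]\to L^2[0,1]$, $(T_Wf)(x)=\int_0^1W(x,y)f(y)\,dy$. $G_N\sim G(N,\theta_N,W)$ is the random graph (self-loops allowed) on $\{1,\dots,N\}$ with symmetric adjacency matrix $A_{G_N}$ whose entries $A_{G_N}(i,j)$, $1\le i\le j\le N$, are independent Bernoulli with parameters $\theta_NW(\frac iN,\frac jN)$. For $\vec\sigma\in\{-1,1\}^N$, $H_N(\vec\sigma)=-\frac{1}{2N\theta_N}\sum_{1\le i,j\le N}A_{G_N}(i,j)\sigma_i\sigma_j$. Given $G_N$, the Ising model is $\mathbb P_\beta(\vec\sigma)=\frac{1}{2^NZ_N(\beta)}e^{-\beta H_N(\vec\sigma)}$ with $Z_N(\beta)=2^{-N}\sum_{\vec\sigma\in\{-1,1\}^N}e^{-\beta H_N(\vec\sigma)}$. $a_N\gtrsim b_N$ means $a_N\ge Cb_N$ for some constant $C>0$ and all large $N$. $\xrightarrow{D}$ denotes convergence in distribution. *)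

theory Defs
  imports "HOL-Probability.Probability"
begin

section \<open>Graphons\<close>

abbreviation unit_square :: "(real \<times> real) set" where
  "unit_square \<equiv> {0..1} \<times> {0..1}"

text \<open>
  A graphon is a total function on the plane of which only the values on the unit square
  matter. Measurability is Lebesgue measurability.
\<close>

definition graphon :: "(real \<Rightarrow> real \<Rightarrow> real) \<Rightarrow> bool" where
  "graphon W \<longleftrightarrow>
     (\<forall>x\<in>{0..1}. \<forall>y\<in>{0..1}. W x y = W y x) \<and>
     (\<forall>x\<in>{0..1}. \<forall>y\<in>{0..1}. W x y \<in> {0..1}) \<and>
     case_prod W \<in> borel_measurable (lebesgue_on unit_square)"

text \<open>
  Proper Riemann integrability over a box: Riemann sums converge as the mesh of the tagged
  division tends to 0. This is the library's definition of the Henstock--Kurzweil integral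
  with the gauge restricted to balls of constant radius.
\<close>

definition riemann_integrable_on :: "('n::euclidean_space \<Rightarrow> real) \<Rightarrow> 'n set \<Rightarrow> bool"
    (infixr \<open>riemann'_integrable'_on\<close> 46) where
  "f riemann_integrable_on S \<longleftrightarrow>
     (\<exists>I. \<forall>e>0. \<exists>d>0. \<forall>p. p tagged_division_of S \<and> (\<lambda>x. ball x d) fine p \<longrightarrow>
        \<bar>(\<Sum>(x, K)\<in>p. measure lborel K * f x) - I\<bar> < e)"

definition graphon_integral :: "(real \<Rightarrow> real \<Rightarrow> real) \<Rightarrow> real" where
  "graphon_integral W = (LINT p|lebesgue_on unit_square. W (fst p) (snd p))"

text \<open>
  Elements of \<open>L\<^sup>2[0,1]\<close> are represented by functions rather than by almost-everywhere
  classes; the supremum defining the operator norm is insensitive to this.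
\<close>

definition L2_space :: "(real \<Rightarrow> real) set" where
  "L2_space = {f \<in> borel_measurable (lebesgue_on {0..1}).
                 integrable (lebesgue_on {0..1}) (\<lambda>x. (f x)\<^sup>2)}"

definition L2_norm :: "(real \<Rightarrow> real) \<Rightarrow> real" where
  "L2_norm f = sqrt (LINT x|lebesgue_on {0..1}. (f x)\<^sup>2)"

definition graphon_operator ::
    "(real \<Rightarrow> real \<Rightarrow> real) \<Rightarrow> (real \<Rightarrow> real) \<Rightarrow> (real \<Rightarrow> real)" where
  "graphon_operator W f x = (LINT y|lebesgue_on {0..1}. W x y * f y)"

definition graphon_op_norm :: "(real \<Rightarrow> real \<Rightarrow> real) \<Rightarrow> real" where
  "graphon_op_norm W =
     (SUP f\<in>{f \<in> L2_space. L2_norm f \<le> 1}. L2_norm (graphon_operator W f))"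

section \<open>The random graph\<close>

text \<open>
  A graph is given by its edge indicators on the pairs \<open>(i, j)\<close> with \<open>i \<le> j\<close>; the
  adjacency matrix is the symmetric extension. Diagonal entries are self-loops.
\<close>

type_synonym edge_indicators = "nat \<times> nat \<Rightarrow> bool"

definition random_graph ::
    "nat \<Rightarrow> real \<Rightarrow> (real \<Rightarrow> real \<Rightarrow> real) \<Rightarrow> edge_indicators pmf" where
  "random_graph N \<theta> W =
     Pi_pmf {(i, j). 1 \<le> i \<and> i \<le> j \<and> j \<le> N} False
       (\<lambda>(i, j). bernoulli_pmf (\<theta> * W (real i / real N) (real j / real N)))"

definition adj :: "edge_indicators \<Rightarrow> nat \<Rightarrow> nat \<Rightarrow> real" where
  "adj G i j = of_bool (G (min i j, max i j))"

section \<open>The Ising model\<close>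

definition spins :: "nat \<Rightarrow> (nat \<Rightarrow> real) set" where
  "spins N = {1..N} \<rightarrow>\<^sub>E {-1, 1}"

definition hamiltonian :: "nat \<Rightarrow> real \<Rightarrow> edge_indicators \<Rightarrow> (nat \<Rightarrow> real) \<Rightarrow> real" where
  "hamiltonian N \<theta> G \<sigma> =
     - (1 / (2 * real N * \<theta>)) * (\<Sum>i=1..N. \<Sum>j=1..N. adj G i j * \<sigma> i * \<sigma> j)"

definition partition_function :: "nat \<Rightarrow> real \<Rightarrow> real \<Rightarrow> edge_indicators \<Rightarrow> real" where
  "partition_function N \<theta> \<beta> G =
     (1 / 2 ^ N) * (\<Sum>\<sigma>\<in>spins N. exp (- \<beta> * hamiltonian N \<theta> G \<sigma>))"

definition ising_weight ::
    "nat \<Rightarrow> real \<Rightarrow> real \<Rightarrow> edge_indicators \<Rightarrow> (nat \<Rightarrow> real) \<Rightarrow> real" where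
  "ising_weight N \<theta> \<beta> G \<sigma> =
     (if \<sigma> \<in> spins N
      then 1 / (2 ^ N * partition_function N \<theta> \<beta> G) * exp (- \<beta> * hamiltonian N \<theta> G \<sigma>)
      else 0)"

definition ising :: "nat \<Rightarrow> real \<Rightarrow> real \<Rightarrow> edge_indicators \<Rightarrow> (nat \<Rightarrow> real) pmf" where
  "ising N \<theta> \<beta> G = embed_pmf (ising_weight N \<theta> \<beta> G)"

lemma finite_spins [simp]: "finite (spins N)"
  by (auto simp: spins_def intro!: finite_PiE)

lemma spins_nonempty [simp]: "spins N \<noteq> {}"
  by (auto simp: spins_def PiE_eq_empty_iff)

lemma partition_function_pos: "partition_function N \<theta> \<beta> G > 0"
  unfolding partition_function_def by (intro mult_pos_pos sum_pos) auto

lemma pmf_ising: "pmf (ising N \<theta> \<beta> G) \<sigma> = ising_weight N \<theta> \<beta> G \<sigma>"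
  unfolding ising_def
proof (rule pmf_embed_pmf)
  show nonneg: "0 \<le> ising_weight N \<theta> \<beta> G \<sigma>" for \<sigma>
    using partition_function_pos[of N \<theta> \<beta> G] by (simp add: ising_weight_def)
  have "(\<integral>\<^sup>+ \<sigma>. ennreal (ising_weight N \<theta> \<beta> G \<sigma>) \<partial>count_space UNIV) =
        (\<Sum>\<sigma>\<in>spins N. ennreal (ising_weight N \<theta> \<beta> G \<sigma>))"
    by (rule nn_integral_count_space') (auto simp: ising_weight_def)
  also have "\<dots> = ennreal (\<Sum>\<sigma>\<in>spins N. ising_weight N \<theta> \<beta> G \<sigma>)"
    using nonneg by (simp add: sum_ennreal)
  also have "(\<Sum>\<sigma>\<in>spins N. ising_weight N \<theta> \<beta> G \<sigma>) =
      1 / (2 ^ N * partition_function N \<theta> \<beta> G) *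
        (\<Sum>\<sigma>\<in>spins N. exp (- \<beta> * hamiltonian N \<theta> G \<sigma>))"
    unfolding sum_distrib_left by (rule sum.cong) (auto simp: ising_weight_def)
  also have "\<dots> = 1"
  proof -
    have "(\<Sum>\<sigma>\<in>spins N. exp (- \<beta> * hamiltonian N \<theta> G \<sigma>)) =
          2 ^ N * partition_function N \<theta> \<beta> G"
      by (simp add: partition_function_def)
    with partition_function_pos[of N \<theta> \<beta> G] show ?thesis by simp
  qed
  finally show "(\<integral>\<^sup>+ \<sigma>. ennreal (ising_weight N \<theta> \<beta> G \<sigma>) \<partial>count_space UNIV) = 1"
    by simp
qed

text \<open>The joint law of the random graph and of the spins drawn given the graph.\<close>

definition graph_ising ::
    "nat \<Rightarrow> real \<Rightarrow> (real \<Rightarrow> real \<Rightarrow> real) \<Rightarrow> real \<Rightarrow>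
      (edge_indicators \<times> (nat \<Rightarrow> real)) pmf" where
  "graph_ising N \<theta> W \<beta> =
     do {
       G \<leftarrow> random_graph N \<theta> W;
       \<sigma> \<leftarrow> ising N \<theta> \<beta> G;
       return_pmf (G, \<sigma>)
     }"

text \<open>
  On the edgeless graph the denominator vanishes and the value is 0 by the convention
  \<open>x / 0 = 0\<close>.
\<close>

definition beta_estimator :: "nat \<Rightarrow> real \<Rightarrow> edge_indicators \<Rightarrow> (nat \<Rightarrow> real) \<Rightarrow> real" where
  "beta_estimator N \<theta> G \<sigma> =
     - (2 * (real N)\<^sup>2 * \<theta>\<^sup>2 / (\<Sum>i=1..N. \<Sum>j=1..N. adj G i j)) * hamiltonian N \<theta> G \<sigma>"

section \<open>Asymptotics and the limit law\<close>

definition asymp_gtrsim :: "(nat \<Rightarrow> real) \<Rightarrow> (nat \<Rightarrow> real) \<Rightarrow> bool" where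
  "asymp_gtrsim a b \<longleftrightarrow> (\<exists>C>0. \<forall>\<^sub>F N in sequentially. a N \<ge> C * b N)"

text \<open>The second parameter of \<^const>\<open>normal_density\<close> is the standard deviation.\<close>

definition normal_distribution :: "real \<Rightarrow> real \<Rightarrow> real measure" where
  "normal_distribution \<mu> v = density lborel (\<lambda>x. ennreal (normal_density \<mu> (sqrt v) x))"

end

theory Submission imports Defs begin

text \<open>
  Fix the graph \<open>G\<close> and write \<open>E\<close> for the sum of all entries of its adjacency matrix, \<open>D\<close> for the number
  of loops and \<open>m\<close> for the number of edges joining distinct vertices, so that \<open>E = D + 2 m\<close>. The estimator
  is linear in the Hamiltonian. Hence the characteristic function at \<open>s\<close> of the rescaled estimation error,
  given \<open>G\<close>, is a phase times a ratio \<open>Z(\<beta> + i \<eta>) / Z(\<beta>)\<close> of partition functions, where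
  \<open>\<eta> = 2 N\<^sup>2 \<theta>\<^bsup>3/2\<^esup> s / E\<close> is of order \<open>\<surd>\<theta>\<close>. The claim follows once this random number tends in
  probability to \<open>exp (- s\<^sup>2 / w)\<close>, where \<open>w\<close> is the integral of the graphon: as the number is bounded
  by 1, its mean over the graph converges too, and Levy's continuity theorem applies.

  For \<open>i < j\<close> the factor \<open>exp (u A\<^sub>i\<^sub>j \<sigma>\<^sub>i \<sigma>\<^sub>j)\<close> of the Gibbs weight, with \<open>u = \<beta> / (N \<theta>)\<close>, equals
  \<open>cosh (u A\<^sub>i\<^sub>j) (1 + tanh u A\<^sub>i\<^sub>j \<sigma>\<^sub>i \<sigma>\<^sub>j)\<close>. This gives \<open>Z(\<beta>) = exp (u D / 2) cosh(u)\<^sup>m Y(tanh u)\<close>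
  (lemma \<open>sum_spins_exp_form\<close>), and the three factors are treated separately.

  The power of \<open>cosh\<close> produces the Gaussian. Its quadratic part \<open>m u\<^sup>2 / 2\<close> contributes the phase that
  centres the estimator and the term \<open>- s\<^sup>2 / w\<close> (lemma \<open>interaction_exponent_cancellation\<close>). The quartic part
  changes by at most a constant times \<open>m u\<^sup>4 \<surd>\<theta>\<close>, which is of order \<open>\<surd>\<theta> / (N\<^sup>2 \<theta>\<^sup>3)\<close>; this is the place where
  \<open>N\<^bsup>2/3\<^esup> \<theta>\<close> has to stay away from 0. The loops contribute \<open>\<surd>\<theta> D / (N \<theta>)\<close>, which is negligible.

  The last factor \<open>Y\<close> is a polynomial with nonnegative coefficients and constant term 1, since it counts
  the subgraphs of \<open>G\<close> with even degrees. Therefore \<open>Y \<ge> 1\<close> on the positive axis, and the increment of \<open>Y\<close>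
  between \<open>tanh u\<close> and its complex perturbation is at most the length of the step times
  \<open>Y(R) / (R - x)\<close>, for any \<open>x < R\<close> with both points in the disc of radius \<open>x\<close> (lemma
  \<open>subgraph_sum_diff_bound\<close>). As the step is of the order \<open>\<surd>\<theta> u\<close>, it suffices that
  \<open>Y(\<gamma> / (N \<theta>))\<close> is bounded in mean for one \<open>\<gamma> > \<beta>\<close>.

  Averaging over the graph turns this mean into at most an exponential moment of the quadratic form with
  matrix \<open>M = \<gamma> W(i/N, j/N) / N\<close> in independent signs. Integrating out one sign after the other, in the
  manner of Gaussian elimination, bounds it by \<open>exp (|M|\<^sup>2 / (4 (1 - \<rho>)))\<close> when the form of \<open>M\<close> is at most
  \<open>\<rho> < 1\<close> times the squared norm (lemma \<open>rademacher_quadratic_exp_bound\<close>). Such a \<open>\<rho>\<close> exists because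
  Riemann integrability makes the grid values of \<open>W\<close> close to its cell averages, whose form is
  controlled by the operator norm (lemma \<open>graphon_grid_form_bound\<close>).
\<close>

section \<open>Exponential moments of a quadratic form in independent signs\<close>

lemma tanh_real_le_self:
  assumes "0 \<le> (x :: real)"
  shows "tanh x \<le> x"
proof -
  have "\<exists>y. ((\<lambda>x. x - tanh x) has_real_derivative y) (at v) \<and> y \<ge> 0" if "0 \<le> v" "v \<le> x" for v :: real
    by (rule exI[of _ "(tanh v)\<^sup>2"]) (auto intro!: derivative_eq_intros)
  from DERIV_nonneg_imp_nondecreasing[OF assms this] show ?thesis by simp
qed

text \<open>
  A random sign is subgaussian with variance 1. The difference of the logarithms has derivative
  \<open>x - tanh x\<close>, which is nonnegative for \<open>x \<ge> 0\<close>.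
\<close>
lemma cosh_le_exp_half_square: "cosh (x::real) \<le> exp (x\<^sup>2 / 2)"
proof -
  have pos: "cosh x \<le> exp (x\<^sup>2 / 2)" if "x \<ge> 0" for x :: real
  proof -
    have "\<exists>y. ((\<lambda>x. x\<^sup>2/2 - ln (cosh x)) has_real_derivative y) (at u) \<and> y \<ge> 0" if "0 \<le> u" "u \<le> x" for u :: real
    proof (intro exI conjI)
      show "((\<lambda>x. x\<^sup>2/2 - ln (cosh x)) has_real_derivative (u - tanh u)) (at u)"
        by (auto intro!: derivative_eq_intros simp: tanh_def field_simps)
      show "u - tanh u \<ge> 0" using tanh_real_le_self[OF \<open>0 \<le> u\<close>] by simp
    qed
    from DERIV_nonneg_imp_nondecreasing[OF \<open>x \<ge> 0\<close> this] have "ln (cosh x) \<le> x\<^sup>2/2" by simp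
    then show ?thesis by (metis cosh_real_pos exp_le_cancel_iff exp_ln)
  qed
  show ?thesis using pos[of x] pos[of "-x"] by (cases "x \<ge> 0") auto
qed

lemma sum_PiE_insert:
  assumes "finite S" "k \<notin> S"
  shows "(\<Sum>\<sigma>\<in>insert k S \<rightarrow>\<^sub>E B. f \<sigma>) = (\<Sum>\<tau>\<in>S \<rightarrow>\<^sub>E B. \<Sum>s\<in>B. f (\<tau>(k := s)))"
proof -
  have "(\<Sum>\<sigma>\<in>insert k S \<rightarrow>\<^sub>E B. f \<sigma>) = (\<Sum>(s, \<tau>)\<in>B \<times> (S \<rightarrow>\<^sub>E B). f (\<tau>(k := s)))"
    unfolding PiE_insert_eq
    by (subst sum.reindex[OF inj_combinator[OF assms(2)]]) (auto simp: case_prod_unfold)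
  also have "\<dots> = (\<Sum>s\<in>B. \<Sum>\<tau>\<in>S \<rightarrow>\<^sub>E B. f (\<tau>(k := s)))"
    by (rule sum.cartesian_product[symmetric])
  finally show ?thesis by (subst (asm) sum.swap)
qed

lemma sum_sum_insert:
  fixes M :: "'a \<Rightarrow> 'a \<Rightarrow> real"
  assumes "finite S" "k \<notin> S" and sym: "\<And>i j. M i j = M j i"
  shows "(\<Sum>i\<in>insert k S. \<Sum>j\<in>insert k S. M i j) =
         M k k + 2 * (\<Sum>j\<in>S. M k j) + (\<Sum>i\<in>S. \<Sum>j\<in>S. M i j)"
proof -
  have "(\<Sum>i\<in>S. M i k) = (\<Sum>j\<in>S. M k j)" by (intro sum.cong refl sym)
  then show ?thesis using assms by (simp add: sum.distrib)
qed

text \<open>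
  The exponent \<open>tr M / 2 + |M|\<^sup>2 / (4 (1 - \<rho>))\<close> does not increase when one sign is integrated out. Here
  \<open>d\<close> is the diagonal entry of the sign that is removed, \<open>v\<close> the squared norm of the rest \<open>b\<close> of its row,
  \<open>q\<close> the value at \<open>b\<close> of the quadratic form of the remaining block, and \<open>T\<close> and \<open>F\<close> the trace and the
  squared Frobenius norm of that block. The constant \<open>1 / (4 (1 - \<rho>))\<close> is the smallest one for which
  this holds with \<open>q = \<rho> v\<close> to first order in \<open>v\<close>.
\<close>
lemma elimination_potential:
  fixes d v q F T \<rho> :: real
  assumes "q \<le> \<rho> * v - v\<^sup>2" and "\<rho> < 1"
  shows "d / 2 + ((T + v) / 2 + (F + 2 * q + v\<^sup>2) / (4 * (1 - \<rho>))) \<le>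
         (d + T) / 2 + (d\<^sup>2 + 2 * v + F) / (4 * (1 - \<rho>))"
proof -
  have "v * (2 * (1 - \<rho>)) + (F + 2 * q + v\<^sup>2) = F + v\<^sup>2 + 2 * v + 2 * (q - \<rho> * v)"
    by (simp add: algebra_simps)
  also have "\<dots> \<le> d\<^sup>2 + 2 * v + F"
  proof -
    have "2 * (q - \<rho> * v) \<le> 2 * (- v\<^sup>2)" using assms(1) by simp
    then show ?thesis using zero_le_power2[of v] zero_le_power2[of d] by linarith
  qed
  finally have "(v * (2 * (1 - \<rho>)) + (F + 2 * q + v\<^sup>2)) / (4 * (1 - \<rho>)) \<le>
      (d\<^sup>2 + 2 * v + F) / (4 * (1 - \<rho>))"
    using \<open>\<rho> < 1\<close> by (intro divide_right_mono) auto
  moreover have "(v * (2 * (1 - \<rho>)) + (F + 2 * q + v\<^sup>2)) / (4 * (1 - \<rho>)) =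
      v / 2 + (F + 2 * q + v\<^sup>2) / (4 * (1 - \<rho>))"
  proof -
    have "(v * (2 * c) + X) / (4 * c) = v / 2 + X / (4 * c)" if "c > 0" for c X :: real
      using that by (simp add: field_simps)
    from this[of "1 - \<rho>"] show ?thesis using \<open>\<rho> < 1\<close> by simp
  qed
  ultimately show ?thesis unfolding add_divide_distrib[of d T] add_divide_distrib[of T v] by simp
qed

text \<open>
  For a Gaussian vector the corresponding moment is \<open>det (I - M)\<^bsup>-1/2\<^esup>\<close>, of which the right-hand side is
  a bound. Averaging over the sign at \<open>k\<close> gives \<open>exp (M\<^sub>k\<^sub>k / 2) cosh l\<close> with \<open>l\<close> linear in the other signs,
  and \<open>cosh l \<le> exp (l\<^sup>2 / 2)\<close> is again the exponential of a quadratic form, now with matrix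
  \<open>M' = M + b b\<^sup>T\<close> for the row \<open>b\<close> of \<open>M\<close> at \<open>k\<close>. This is a step of Gaussian elimination for
  \<open>I - M\<close>, with the pivot replaced by 1. The bound \<open>\<rho>\<close> on the form is inherited by \<open>M'\<close> as long as the
  diagonal is nonnegative, and the exponent on the right is monotone by \<open>elimination_potential\<close>.
\<close>
lemma rademacher_quadratic_exp_bound:
  fixes M :: "'a \<Rightarrow> 'a \<Rightarrow> real" and \<rho> :: real
  assumes "finite S" and "0 \<le> \<rho>" and "\<rho> < 1"
    and "\<And>i j. M i j = M j i"
    and "\<And>i. M i i \<ge> 0"
    and "\<And>x. (\<Sum>i\<in>S. \<Sum>j\<in>S. M i j * x i * x j) \<le> \<rho> * (\<Sum>i\<in>S. (x i)\<^sup>2)"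
  shows "(\<Sum>\<sigma>\<in>S \<rightarrow>\<^sub>E {-1, 1}. exp ((\<Sum>i\<in>S. \<Sum>j\<in>S. M i j * \<sigma> i * \<sigma> j) / 2)) \<le>
     2 ^ card S * exp ((\<Sum>i\<in>S. M i i) / 2 + (\<Sum>i\<in>S. \<Sum>j\<in>S. (M i j)\<^sup>2) / (4 * (1 - \<rho>)))"
  using assms(1,4-6)
proof (induction S arbitrary: M rule: finite_induct)
  case empty
  then show ?case by simp
next
  case (insert k S)
  note sym = \<open>\<And>i j. M i j = M j i\<close> and diag = \<open>\<And>i. M i i \<ge> 0\<close>
  define d where "d = M k k"
  define l where "l x = (\<Sum>j\<in>S. M k j * x j)" for x
  define q where "q x = (\<Sum>i\<in>S. \<Sum>j\<in>S. M i j * x i * x j)" for x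
  define v where "v = (\<Sum>j\<in>S. (M k j)\<^sup>2)"
  define F where "F = (\<Sum>i\<in>S. \<Sum>j\<in>S. (M i j)\<^sup>2)"
  define M' where "M' i j = M i j + M k i * M k j" for i j
  have split: "(\<Sum>i\<in>insert k S. \<Sum>j\<in>insert k S. M i j * (\<tau>(k := s)) i * (\<tau>(k := s)) j) =
      d * s\<^sup>2 + 2 * s * l \<tau> + q \<tau>" for \<tau> s
  proof -
    have "(\<Sum>j\<in>S. M k j * (\<tau>(k := s)) k * (\<tau>(k := s)) j) = s * l \<tau>"
      unfolding l_def sum_distrib_left using insert.hyps by (intro sum.cong) auto
    moreover have "(\<Sum>i\<in>S. \<Sum>j\<in>S. M i j * (\<tau>(k := s)) i * (\<tau>(k := s)) j) = q \<tau>"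
      unfolding q_def using insert.hyps by (intro sum.cong refl) auto
    ultimately show ?thesis
      by (subst sum_sum_insert) (use insert.hyps sym in \<open>auto simp: d_def power2_eq_square mult_ac\<close>)
  qed
  have q': "(\<Sum>i\<in>S. \<Sum>j\<in>S. M' i j * x i * x j) = q x + (l x)\<^sup>2" for x
    by (simp add: M'_def q_def l_def power2_eq_square sum_product algebra_simps sum.distrib)
  \<comment> \<open>feeding the quadratic form the vector with entry \<open>a\<close> at \<open>k\<close>\<close>
  have form: "d * a\<^sup>2 + 2 * a * l x + q x \<le> \<rho> * (a\<^sup>2 + (\<Sum>i\<in>S. (x i)\<^sup>2))" for a x
  proof -
    have "(\<Sum>i\<in>S. ((x(k := a)) i)\<^sup>2) = (\<Sum>i\<in>S. (x i)\<^sup>2)"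
      using insert.hyps by (intro sum.cong) auto
    with insert.prems(3)[of "x(k := a)"] insert.hyps show ?thesis unfolding split by simp
  qed
  \<comment> \<open>the choice \<open>a = l x\<close> bounds the form of \<open>M'\<close> by \<open>\<rho>\<close>, with some room to spare\<close>
  have form': "q x + (l x)\<^sup>2 \<le> \<rho> * (\<Sum>i\<in>S. (x i)\<^sup>2) - (l x)\<^sup>2 * (1 + d - \<rho>)" for x
    using form[of "l x" x] by (simp add: algebra_simps power2_eq_square)
  have nn: "1 + d - \<rho> \<ge> 0" using diag[of k] \<open>\<rho> < 1\<close> by (simp add: d_def)
  have IH: "(\<Sum>\<sigma>\<in>S \<rightarrow>\<^sub>E {-1, 1}. exp ((\<Sum>i\<in>S. \<Sum>j\<in>S. M' i j * \<sigma> i * \<sigma> j) / 2))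
      \<le> 2 ^ card S * exp ((\<Sum>i\<in>S. M' i i) / 2 + (\<Sum>i\<in>S. \<Sum>j\<in>S. (M' i j)\<^sup>2) / (4 * (1 - \<rho>)))"
  proof (rule insert.IH)
    show "M' i j = M' j i" for i j using sym[of i j] by (simp add: M'_def)
    show "M' i i \<ge> 0" for i using diag[of i] by (simp add: M'_def)
    show "(\<Sum>i\<in>S. \<Sum>j\<in>S. M' i j * x i * x j) \<le> \<rho> * (\<Sum>i\<in>S. (x i)\<^sup>2)" for x
      unfolding q' using form'[of x] mult_nonneg_nonneg[OF zero_le_power2[of "l x"] nn] by linarith
  qed
  have v0: "v \<ge> 0" by (simp add: v_def sum_nonneg)
  have lM: "l (M k) = v" by (simp add: l_def v_def power2_eq_square)
  have trace: "(\<Sum>i\<in>S. M' i i) = (\<Sum>i\<in>S. M i i) + v"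
    by (simp add: M'_def v_def sum.distrib power2_eq_square)
  have frob: "(\<Sum>i\<in>S. \<Sum>j\<in>S. (M' i j)\<^sup>2) = F + 2 * q (M k) + v\<^sup>2"
    by (simp add: M'_def F_def q_def v_def power2_eq_square sum_product algebra_simps sum.distrib sum_distrib_left)
  \<comment> \<open>the room left in \<open>form'\<close>, at the removed row itself\<close>
  have qv: "q (M k) \<le> \<rho> * v - v\<^sup>2"
  proof -
    have "q (M k) + v\<^sup>2 \<le> \<rho> * v - v\<^sup>2 * (1 + d - \<rho>)" using form'[of "M k"] by (simp add: lM v_def)
    with mult_nonneg_nonneg[OF zero_le_power2[of v] nn] show ?thesis by linarith
  qed
  have potential: "d / 2 + ((\<Sum>i\<in>S. M' i i) / 2 + (\<Sum>i\<in>S. \<Sum>j\<in>S. (M' i j)\<^sup>2) / (4 * (1 - \<rho>)))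
      \<le> (\<Sum>i\<in>insert k S. M i i) / 2 + (\<Sum>i\<in>insert k S. \<Sum>j\<in>insert k S. (M i j)\<^sup>2) / (4 * (1 - \<rho>))"
  proof -
    have "(\<Sum>i\<in>insert k S. M i i) = d + (\<Sum>i\<in>S. M i i)"
      using insert.hyps by (simp add: d_def)
    moreover have "(\<Sum>i\<in>insert k S. \<Sum>j\<in>insert k S. (M i j)\<^sup>2) = d\<^sup>2 + 2 * v + F"
      by (subst sum_sum_insert) (use insert.hyps sym in \<open>auto simp: d_def v_def F_def\<close>)
    ultimately show ?thesis
      unfolding trace frob by (simp only:) (rule elimination_potential[OF qv \<open>\<rho> < 1\<close>])
  qed
  have "(\<Sum>\<sigma>\<in>insert k S \<rightarrow>\<^sub>E {-1, 1}.
          exp ((\<Sum>i\<in>insert k S. \<Sum>j\<in>insert k S. M i j * \<sigma> i * \<sigma> j) / 2)) =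
      (\<Sum>\<tau>\<in>S \<rightarrow>\<^sub>E {-1, 1}. \<Sum>s\<in>{-1, 1}. exp ((d * s\<^sup>2 + 2 * s * l \<tau> + q \<tau>) / 2))"
    unfolding split[symmetric] by (rule sum_PiE_insert) fact+
  also have "\<dots> = (\<Sum>\<tau>\<in>S \<rightarrow>\<^sub>E {-1, 1}. 2 * exp (d / 2) * (exp (q \<tau> / 2) * cosh (l \<tau>)))"
  proof (intro sum.cong refl)
    fix \<tau>
    have "exp ((d + 2 * l \<tau> + q \<tau>) / 2) = exp (d / 2) * (exp (q \<tau> / 2) * exp (l \<tau>))"
      unfolding exp_add[symmetric] by (simp add: field_simps)
    moreover have "exp ((d - 2 * l \<tau> + q \<tau>) / 2) = exp (d / 2) * (exp (q \<tau> / 2) * exp (- l \<tau>))"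
      unfolding exp_add[symmetric] by (simp add: field_simps)
    ultimately show "(\<Sum>s\<in>{-1, 1}. exp ((d * s\<^sup>2 + 2 * s * l \<tau> + q \<tau>) / 2)) =
        2 * exp (d / 2) * (exp (q \<tau> / 2) * cosh (l \<tau>))"
      by (simp add: cosh_def algebra_simps)
  qed
  also have "\<dots> \<le> (\<Sum>\<tau>\<in>S \<rightarrow>\<^sub>E {-1, 1}. 2 * exp (d / 2) * (exp (q \<tau> / 2) * exp ((l \<tau>)\<^sup>2 / 2)))"
    by (intro sum_mono mult_left_mono cosh_le_exp_half_square) auto
  also have "\<dots> = 2 * exp (d / 2) *
      (\<Sum>\<tau>\<in>S \<rightarrow>\<^sub>E {-1, 1}. exp ((\<Sum>i\<in>S. \<Sum>j\<in>S. M' i j * \<tau> i * \<tau> j) / 2))"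
    unfolding q' by (simp add: sum_distrib_left exp_add add_divide_distrib)
  also have "\<dots> \<le> 2 * exp (d / 2) *
      (2 ^ card S * exp ((\<Sum>i\<in>S. M' i i) / 2 + (\<Sum>i\<in>S. \<Sum>j\<in>S. (M' i j)\<^sup>2) / (4 * (1 - \<rho>))))"
    by (intro mult_left_mono IH) auto
  also have "\<dots> = 2 ^ card (insert k S) * exp (d / 2 +
      ((\<Sum>i\<in>S. M' i i) / 2 + (\<Sum>i\<in>S. \<Sum>j\<in>S. (M' i j)\<^sup>2) / (4 * (1 - \<rho>))))"
    using insert.hyps by (simp add: exp_add)
  also have "\<dots> \<le> 2 ^ card (insert k S) * exp ((\<Sum>i\<in>insert k S. M i i) / 2 +
      (\<Sum>i\<in>insert k S. \<Sum>j\<in>insert k S. (M i j)\<^sup>2) / (4 * (1 - \<rho>)))"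
    using potential by (intro mult_left_mono) auto
  finally show ?case .
qed

section \<open>Grid values of a graphon\<close>

text \<open>
  The cells are closed, so that they are boxes in the sense of tagged divisions; neighbouring cells share
  a null set.
\<close>
definition grid_cell :: "nat \<Rightarrow> nat \<Rightarrow> nat \<Rightarrow> (real \<times> real) set" where
  "grid_cell N i j = cbox ((real i - 1) / N, (real j - 1) / N) (real i / N, real j / N)"

text \<open>
  The tag of a cell is its upper right corner: the model samples the graphon at the points
  \<open>(i/N, j/N)\<close>.
\<close>
definition grid_division :: "nat \<Rightarrow> ((real \<times> real) \<times> (real \<times> real) set) set" where
  "grid_division N = (\<lambda>(i, j). ((real i / N, real j / N), grid_cell N i j)) ` ({1..N} \<times> {1..N})"

lemma grid_cell_Times:
  "grid_cell N i j = {(real i - 1) / N .. real i / N} \<times> {(real j - 1) / N .. real j / N}"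
  by (simp add: grid_cell_def cbox_Pair_eq)

lemma content_grid_cell:
  assumes "N \<ge> 1"
  shows "measure lborel (grid_cell N i j) = 1 / (real N)\<^sup>2"
  using assms unfolding grid_cell_def
  by (simp add: content_Pair divide_simps power2_eq_square algebra_simps)

lemma grid_point_cover:
  assumes "N \<ge> 1" "0 \<le> x" "x \<le> 1"
  obtains i where "i \<in> {1..N}" "x \<in> {(real i - 1) / N .. real i / N}"
proof
  define i where "i = max 1 (nat \<lceil>x * N\<rceil>)"
  have "x * N \<le> N" using assms by (simp add: mult_left_le_one_le)
  then have "\<lceil>x * N\<rceil> \<le> int N" by (simp add: ceiling_le_iff)
  then show "i \<in> {1..N}" using assms by (auto simp: i_def)
  have "real i \<ge> x * N" by (simp add: i_def) linarith
  moreover have "real i - 1 \<le> x * N" using assms by (auto simp: i_def max_def)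
  ultimately show "x \<in> {(real i - 1) / N .. real i / N}"
    using assms by (auto simp: field_simps)
qed

lemma grid_cell_subset:
  assumes "i \<in> {1..N}" "j \<in> {1..N}"
  shows "grid_cell N i j \<subseteq> cbox (0, 0) (1, 1)"
proof
  fix p assume "p \<in> grid_cell N i j"
  moreover have "0 \<le> (real i - 1) / N" "real i / N \<le> 1" "0 \<le> (real j - 1) / N" "real j / N \<le> 1"
    using assms by auto
  ultimately show "p \<in> cbox (0, 0) (1, 1)"
    by (cases p) (force simp: grid_cell_Times cbox_Pair_eq)
qed

lemma grid_division_tagged:
  assumes N: "N \<ge> 1"
  shows "grid_division N tagged_division_of cbox (0, 0) (1, 1)"
  unfolding tagged_division_of_def tagged_partial_division_of_def
proof (intro conjI allI impI)
  show "finite (grid_division N)" by (simp add: grid_division_def)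
next
  fix x K assume "(x, K) \<in> grid_division N"
  then obtain i j where ij: "i \<in> {1..N}" "j \<in> {1..N}" and x: "x = (real i / N, real j / N)"
    and K: "K = grid_cell N i j" by (auto simp: grid_division_def)
  show "x \<in> K" using N by (auto simp: x K grid_cell_Times field_simps)
  show "\<exists>a b. K = cbox a b" unfolding K grid_cell_def by blast
  show "K \<subseteq> cbox (0, 0) (1, 1)" unfolding K using grid_cell_subset[OF ij] .
next
  fix x1 K1 x2 K2
  assume "(x1, K1) \<in> grid_division N \<and> (x2, K2) \<in> grid_division N \<and> (x1, K1) \<noteq> (x2, K2)"
  then obtain i j i' j' where K: "K1 = grid_cell N i j" "K2 = grid_cell N i' j'" and ne: "i \<noteq> i' \<or> j \<noteq> j'"
    by (auto simp: grid_division_def)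
  have "{(real i - 1) / N <..< real i / N} \<inter> {(real k - 1) / N <..< real k / N} = {}" if "i < k" for i k
  proof -
    have "real i / N \<le> (real k - 1) / N" using that by (intro divide_right_mono) auto
    then show ?thesis by auto
  qed
  then have disj: "{(real i - 1) / N <..< real i / N} \<inter> {(real k - 1) / N <..< real k / N} = {}" if "i \<noteq> k" for i k
    using that by (metis inf_commute nat_neq_iff)
  show "interior K1 \<inter> interior K2 = {}"
    using ne
  proof
    assume "i \<noteq> i'"
    from disj[OF this] show ?thesis
      unfolding K grid_cell_Times interior_Times interior_atLeastAtMost_real Times_Int_Times by simp
  next
    assume "j \<noteq> j'"
    from disj[OF this] show ?thesis
      unfolding K grid_cell_Times interior_Times interior_atLeastAtMost_real Times_Int_Times by simp
  qed
next
  show "\<Union>{K. \<exists>x. (x, K) \<in> grid_division N} = cbox (0, 0) (1, 1)"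
  proof (intro equalityI subsetI)
    fix p assume "p \<in> \<Union>{K. \<exists>x. (x, K) \<in> grid_division N}"
    then obtain i j where ij: "i \<in> {1..N}" "j \<in> {1..N}" and K: "p \<in> grid_cell N i j"
      by (auto simp: grid_division_def)
    then show "p \<in> cbox (0, 0) (1, 1)" using grid_cell_subset by blast
  next
    fix p :: "real \<times> real" assume p: "p \<in> cbox (0, 0) (1, 1)"
    obtain x y where xy: "p = (x, y)" by force
    with p have "0 \<le> x" "x \<le> 1" "0 \<le> y" "y \<le> 1" by (auto simp: cbox_Pair_eq)
    obtain i where "i \<in> {1..N}" "x \<in> {(real i - 1) / N .. real i / N}"
      using grid_point_cover[OF N \<open>0 \<le> x\<close> \<open>x \<le> 1\<close>] .
    moreover obtain j where "j \<in> {1..N}" "y \<in> {(real j - 1) / N .. real j / N}"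
      using grid_point_cover[OF N \<open>0 \<le> y\<close> \<open>y \<le> 1\<close>] .
    ultimately show "p \<in> \<Union>{K. \<exists>x. (x, K) \<in> grid_division N}"
      unfolding xy grid_division_def by (force simp: grid_cell_Times)
  qed
qed

lemma grid_division_fine:
  assumes N: "N \<ge> 1" and d: "2 / N < d"
  shows "(\<lambda>x. ball x d) fine grid_division N"
proof (rule fineI)
  fix x K assume "(x, K) \<in> grid_division N"
  then obtain i j where x: "x = (real i / N, real j / N)" and K: "K = grid_cell N i j"
    by (auto simp: grid_division_def)
  show "K \<subseteq> ball x d"
  proof
    fix p assume "p \<in> K"
    then obtain u v where p: "p = (u, v)" and uv: "(real i - 1) / N \<le> u" "u \<le> real i / N"
      "(real j - 1) / N \<le> v" "v \<le> real j / N"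
      by (auto simp: K grid_cell_Times)
    have "dist x p \<le> dist (real i / N) u + dist (real j / N) v"
      unfolding x p dist_Pair_Pair using sqrt_sum_squares_le_sum_abs[of "dist (real i / N) u" "dist (real j / N) v"] by simp
    also have "\<dots> \<le> 1 / N + 1 / N"
      using uv by (intro add_mono) (auto simp: dist_real_def diff_divide_distrib)
    also have "\<dots> < d" using d by simp
    finally show "p \<in> ball x d" by simp
  qed
qed

lemma sum_grid_division:
  fixes F :: "real \<times> real \<Rightarrow> (real \<times> real) set \<Rightarrow> real"
  assumes "N \<ge> 1"
  shows "(\<Sum>(x, K)\<in>grid_division N. F x K) =
    (\<Sum>i=1..N. \<Sum>j=1..N. F (real i / N, real j / N) (grid_cell N i j))"
proof -
  have "inj_on (\<lambda>(i, j). ((real i / N, real j / N), grid_cell N i j)) ({1..N} \<times> {1..N})"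
    using assms by (auto simp: inj_on_def)
  then show ?thesis
    unfolding grid_division_def
    by (subst sum.reindex) (auto simp: sum.cartesian_product case_prod_unfold)
qed

text \<open>
  Riemann integrability is Henstock--Kurzweil integrability in which balls of one radius serve as the
  gauge. The second part keeps that gauge explicit, in the form that the Henstock lemma asks for.
\<close>
lemma riemann_integrable_imp_has_integral:
  assumes "f riemann_integrable_on cbox a b"
  shows "f integrable_on cbox a b"
    and "e > 0 \<Longrightarrow> \<exists>d>0. \<forall>p. p tagged_division_of cbox a b \<and> (\<lambda>x. ball x d) fine p \<longrightarrow>
        norm ((\<Sum>(x, K)\<in>p. measure lborel K *\<^sub>R f x) - integral (cbox a b) f) < e"
proof -
  obtain I where I: "\<And>e. e > 0 \<Longrightarrow> \<exists>d>0. \<forall>p. p tagged_division_of cbox a b \<and> (\<lambda>x. ball x d) fine p \<longrightarrow>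
        \<bar>(\<Sum>(x, K)\<in>p. measure lborel K * f x) - I\<bar> < e"
    using assms unfolding riemann_integrable_on_def by metis
  have "(f has_integral I) (cbox a b)"
    unfolding has_integral
  proof (intro allI impI)
    fix e :: real assume "e > 0"
    from I[OF this] obtain d where "d > 0" "\<forall>p. p tagged_division_of cbox a b \<and> (\<lambda>x. ball x d) fine p \<longrightarrow>
        \<bar>(\<Sum>(x, K)\<in>p. measure lborel K * f x) - I\<bar> < e" by blast
    then show "\<exists>\<gamma>. gauge \<gamma> \<and> (\<forall>\<D>. \<D> tagged_division_of cbox a b \<and> \<gamma> fine \<D> \<longrightarrow>
        norm ((\<Sum>(x, k)\<in>\<D>. measure lborel k *\<^sub>R f x) - I) < e)"
      by (intro exI[of _ "\<lambda>x. ball x d"]) (auto simp: gauge_ball)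
  qed
  then have "f integrable_on cbox a b" "integral (cbox a b) f = I" by auto
  then show "f integrable_on cbox a b" and "e > 0 \<Longrightarrow> \<exists>d>0. \<forall>p. p tagged_division_of cbox a b \<and> (\<lambda>x. ball x d) fine p \<longrightarrow>
        norm ((\<Sum>(x, K)\<in>p. measure lborel K *\<^sub>R f x) - integral (cbox a b) f) < e"
    using I[of e] by auto
qed

text \<open>
  The Henstock lemma controls the sum of the absolute errors of a Riemann sum over the cells, not only
  the total error. Since the gauge has constant radius, all sufficiently fine grids are admissible.
\<close>
lemma riemann_integrable_cell_averages:
  fixes f :: "real \<times> real \<Rightarrow> real"
  assumes "f riemann_integrable_on cbox (0, 0) (1, 1)"
  shows "(\<lambda>N. \<Sum>i=1..N. \<Sum>j=1..N.
            \<bar>f (real i / N, real j / N) / (real N)\<^sup>2 - integral (grid_cell N i j) f\<bar>) \<longlonglongrightarrow> 0"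
proof (rule LIMSEQ_I)
  fix e :: real assume "e > 0"
  obtain d where "d > 0" and d: "\<And>p. p tagged_division_of cbox (0, 0) (1, 1) \<Longrightarrow> (\<lambda>x. ball x d) fine p \<Longrightarrow>
      norm ((\<Sum>(x, K)\<in>p. measure lborel K *\<^sub>R f x) - integral (cbox (0, 0) (1, 1)) f) < e / 4"
    using riemann_integrable_imp_has_integral(2)[OF assms, of "e / 4"] \<open>e > 0\<close> by auto
  obtain n0 :: nat where n0: "2 / d < n0" using reals_Archimedean2 by blast
  show "\<exists>n0. \<forall>N\<ge>n0. norm ((\<Sum>i=1..N. \<Sum>j=1..N.
            \<bar>f (real i / N, real j / N) / (real N)\<^sup>2 - integral (grid_cell N i j) f\<bar>) - 0) < e"
  proof (intro exI[of _ "max 1 n0"] allI impI)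
    fix N assume N: "max 1 n0 \<le> N"
    then have N1: "N \<ge> 1" by simp
    have "2 / N < d"
    proof -
      have "2 / d < real N" using n0 N by (simp add: order_less_le_trans)
      then show ?thesis using \<open>d > 0\<close> N1 by (simp add: field_simps)
    qed
    then have fine: "(\<lambda>x. ball x d) fine grid_division N" using grid_division_fine N1 by blast
    have "(\<Sum>i=1..N. \<Sum>j=1..N.
            \<bar>f (real i / N, real j / N) / (real N)\<^sup>2 - integral (grid_cell N i j) f\<bar>) =
        (\<Sum>(x, K)\<in>grid_division N. norm (measure lborel K *\<^sub>R f x - integral K f))"
      by (subst sum_grid_division[OF N1]) (simp add: content_grid_cell[OF N1])
    also have "\<dots> \<le> 2 * real DIM(real) * (e / 4)"
      using \<open>e > 0\<close> \<open>d > 0\<close> grid_division_tagged[OF N1]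
      by (intro Henstock_lemma_part2[OF riemann_integrable_imp_has_integral(1)[OF assms] _ _ d _ fine])
         (auto simp: gauge_ball tagged_division_of_def)
    also have "\<dots> < e" using \<open>e > 0\<close> by simp
    finally show "norm ((\<Sum>i=1..N. \<Sum>j=1..N.
            \<bar>f (real i / N, real j / N) / (real N)\<^sup>2 - integral (grid_cell N i j) f\<bar>) - 0) < e"
      by (simp add: sum_nonneg)
  qed
qed

text \<open>
  A graphon is only Lebesgue measurable, and its sections may fail to be measurable for a null set of
  \<open>x\<close>, on which the operator takes the default value 0. Fubini's theorem is therefore applied to a Borel
  function that agrees with \<open>W\<close> almost everywhere.
\<close>
lemma graphon_fubini:
  fixes f g :: "real \<Rightarrow> real"
  assumes W: "graphon W"
    and f: "f \<in> borel_measurable borel" "\<And>x. \<bar>f x\<bar> \<le> B"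
    and g: "g \<in> borel_measurable borel" "\<And>x. \<bar>g x\<bar> \<le> B"
  shows "graphon_operator W f \<in> borel_measurable (lebesgue_on {0..1})"
    and "(LINT x|lebesgue_on {0..1}. g x * graphon_operator W f x) =
         (LINT p|lebesgue_on unit_square. W (fst p) (snd p) * g (fst p) * f (snd p))"
proof -
  note [measurable] = f(1) g(1)
  have sq [measurable]: "unit_square \<in> sets (borel :: (real \<times> real) measure)"
    by (intro borel_closed closed_Times) auto
  have sql [measurable]: "unit_square \<in> sets lebesgue" using sq by simp
  define V where "V p = indicator unit_square p *\<^sub>R W (fst p) (snd p)" for p
  have "V \<in> borel_measurable lebesgue"
  proof -
    have "case_prod W \<in> borel_measurable (lebesgue_on unit_square)" using W by (simp add: graphon_def)
    then show ?thesis
      by (subst (asm) borel_measurable_restrict_space_iff) (auto simp: V_def[abs_def] case_prod_unfold)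
  qed
  then obtain V0 where V0: "V0 \<in> borel_measurable lborel" "AE p in lborel. V p = V0 p"
    using completion_ex_borel_measurable_real[of V lborel] by blast
  \<comment> \<open>clipping keeps the Borel version bounded and supported in the square\<close>
  define U where "U p = indicator unit_square p * max 0 (min 1 (V0 p))" for p
  have U [measurable]: "U \<in> borel_measurable (borel :: (real \<times> real) measure)"
    using V0(1) sq unfolding U_def[abs_def] by measurable
  have V_range: "V p = indicator unit_square p * max 0 (min 1 (V p))" for p
    using W by (auto simp: V_def graphon_def indicator_def)
  have VU: "AE p in lborel. V p = U p"
    using V0(2) by eventually_elim (subst V_range, simp add: U_def)
  have U_bound: "\<bar>U p\<bar> \<le> indicator unit_square p" for p by (auto simp: U_def indicator_def)
  define K where "K x y = U (x, y) * g x * f y" for x y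
  have K_meas [measurable]: "case_prod K \<in> borel_measurable (borel :: (real \<times> real) measure)"
    unfolding K_def[abs_def] case_prod_unfold prod.collapse
    by (intro borel_measurable_times U measurable_compose[OF _ f(1)] measurable_compose[OF _ g(1)])
       (auto simp: borel_prod[symmetric])
  have B0: "B \<ge> 0" using f(2)[of 0] by simp
  have K_int: "integrable (lborel \<Otimes>\<^sub>M lborel) (case_prod K)"
    unfolding lborel_prod
  proof (rule Bochner_Integration.integrable_bound)
    show "integrable lborel (\<lambda>p. indicator unit_square p * (B * B))"
    proof (rule integrable_mult_left, rule integrable_real_indicator)
      show "unit_square \<in> sets lborel" using sq by simp
      have "unit_square = cbox (0, 0) (1, 1 :: real)" by (simp add: cbox_Pair_eq)
      then show "emeasure lborel unit_square < \<infinity>" using emeasure_lborel_cbox_finite by metis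
    qed
    have "\<bar>U p * g (fst p) * f (snd p)\<bar> \<le> indicator unit_square p * (B * B)" for p
      unfolding abs_mult mult.assoc using B0 by (intro mult_mono U_bound f g) auto
    then show "AE p in lborel. norm (case_prod K p) \<le> norm (indicator unit_square p * (B * B))"
      using B0 by (auto simp: K_def case_prod_unfold)
  qed (use K_meas in simp)
  have AE2: "AE x in lborel. AE y in lborel. V (x, y) = U (x, y)"
    by (rule lborel_pair.AE_pair[of "\<lambda>p. V p = U p", unfolded lborel_prod, OF VU])
  define S where "S x = (LINT y|lborel. U (x, y) * f y)" for x
  have S_meas [measurable]: "S \<in> borel_measurable borel"
  proof -
    have "(\<lambda>(x, y). U (x, y) * f y) \<in> borel_measurable (borel :: (real \<times> real) measure)"
      unfolding case_prod_unfold prod.collapse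
      by (intro borel_measurable_times U measurable_compose[OF _ f(1)]) (auto simp: borel_prod[symmetric])
    then have "(\<lambda>(x, y). U (x, y) * f y) \<in> borel_measurable (borel \<Otimes>\<^sub>M lborel)"
      by (simp add: borel_prod cong: measurable_cong_sets)
    then show ?thesis unfolding S_def by (rule lborel.borel_measurable_lebesgue_integral)
  qed
  have TS: "AE x in lebesgue. indicator {0..1} x * graphon_operator W f x = S x"
    using AE_completion[OF AE2]
  proof eventually_elim
    case (elim x)
    have meas: "(\<lambda>y. U (x, y) * f y) \<in> borel_measurable borel" by measurable
    show ?case
    proof (cases "x \<in> {0..1}")
      case True
      have ae: "AE y in lebesgue. U (x, y) * f y = indicator {0..1} y *\<^sub>R (W x y * f y)"
        using AE_completion[OF elim]
        by eventually_elim (use True in \<open>auto simp: V_def indicator_def split: if_splits\<close>)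
      have mU: "(\<lambda>y. U (x, y) * f y) \<in> borel_measurable lebesgue"
        using meas by (intro measurable_completion) simp
      have "graphon_operator W f x = (LINT y|lebesgue. indicator {0..1} y *\<^sub>R (W x y * f y))"
        unfolding graphon_operator_def by (subst integral_restrict_space) auto
      also have "\<dots> = (LINT y|lebesgue. U (x, y) * f y)"
        using ae by (intro integral_cong_AE borel_measurable_AE[OF mU ae] mU) auto
      also have "\<dots> = S x"
        unfolding S_def using meas by (intro integral_completion) simp
      finally show ?thesis using True by simp
    next
      case False
      then have "U (x, y) = 0" for y by (auto simp: U_def)
      then show ?thesis using False by (simp add: S_def)
    qed
  qed
  have S_leb: "S \<in> borel_measurable lebesgue" using S_meas by (intro measurable_completion) simp
  have "(\<lambda>x. indicator {0..1} x * graphon_operator W f x) \<in> borel_measurable lebesgue"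
    by (rule borel_measurable_AE[OF S_leb]) (use TS in eventually_elim, simp)
  then show "graphon_operator W f \<in> borel_measurable (lebesgue_on {0..1})"
    by (subst borel_measurable_restrict_space_iff) auto
  have gS: "(\<lambda>x. g x * S x) \<in> borel_measurable lebesgue"
    by (intro measurable_completion) simp
  have gae: "AE x in lebesgue. g x * S x = indicator {0..1} x *\<^sub>R (g x * graphon_operator W f x)"
    using TS by eventually_elim (auto simp: algebra_simps)
  have "(LINT x|lebesgue_on {0..1}. g x * graphon_operator W f x) =
      (LINT x|lebesgue. indicator {0..1} x *\<^sub>R (g x * graphon_operator W f x))"
    by (subst integral_restrict_space) auto
  also have "\<dots> = (LINT x|lebesgue. g x * S x)"
    using gae by (intro integral_cong_AE borel_measurable_AE[OF gS gae] gS) auto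
  also have "\<dots> = (LINT x|lborel. g x * S x)"
    by (intro integral_completion) simp
  also have "\<dots> = (LINT x|lborel. LINT y|lborel. K x y)"
  proof -
    have "g x * S x = (LINT y|lborel. g x * (U (x, y) * f y))" for x
      unfolding S_def by (rule integral_mult_right_zero[symmetric])
    then show ?thesis by (simp add: K_def mult_ac)
  qed
  also have "\<dots> = (LINT p|lborel. case_prod K p)"
    using lborel_pair.integral_fst[OF K_int] by (simp add: lborel_prod)
  also have "\<dots> = (LINT p|lebesgue. case_prod K p)"
    by (intro integral_completion[symmetric]) (use K_meas in simp)
  also have "\<dots> = (LINT p|lebesgue. indicator unit_square p *\<^sub>R (W (fst p) (snd p) * g (fst p) * f (snd p)))"
  proof -
    have mK: "case_prod K \<in> borel_measurable lebesgue"
      using K_meas by (intro measurable_completion) simp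
    have ae: "AE p in lebesgue. case_prod K p = indicator unit_square p *\<^sub>R (W (fst p) (snd p) * g (fst p) * f (snd p))"
      using AE_completion[OF VU] by eventually_elim (auto simp: K_def V_def case_prod_unfold)
    show ?thesis using ae by (intro integral_cong_AE borel_measurable_AE[OF mK ae] mK) auto
  qed
  also have "\<dots> = (LINT p|lebesgue_on unit_square. W (fst p) (snd p) * g (fst p) * f (snd p))"
    using sql by (subst integral_restrict_space) auto
  finally show "(LINT x|lebesgue_on {0..1}. g x * graphon_operator W f x) =
         (LINT p|lebesgue_on unit_square. W (fst p) (snd p) * g (fst p) * f (snd p))" .
qed

lemma unit_square_eq_cbox: "unit_square = cbox (0, 0) (1, 1)"
  by (simp add: cbox_Pair_eq)

lemma graphon_integrable:
  assumes "graphon W"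
  shows "integrable (lebesgue_on unit_square) (case_prod W)"
proof -
  interpret finite_measure "lebesgue_on unit_square"
    unfolding unit_square_eq_cbox by (rule finite_measure_lebesgue_on) simp
  show ?thesis
    using assms
    by (intro integrable_const_bound[where B = 1] AE_I2) (auto simp: graphon_def)
qed

text \<open>
  The supremum that defines the operator norm is taken over a bounded set, since \<open>0 \<le> W \<le> 1\<close> gives
  \<open>|T f (x)| \<le> \<integral> |f| \<le> \<integral> (1 + f\<^sup>2) / 2 \<le> 1\<close> for \<open>f\<close> in the unit ball.
\<close>
lemma L2_norm_le_graphon_op_norm:
  assumes W: "graphon W" and f: "f \<in> L2_space" "L2_norm f \<le> 1"
  shows "L2_norm (graphon_operator W f) \<le> graphon_op_norm W"
  unfolding graphon_op_norm_def
proof (rule cSUP_upper)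
  interpret finite_measure "lebesgue_on {0..1 :: real}"
    by (rule finite_measure_lebesgue_on) simp
  have meas1: "measure (lebesgue_on {0..1 :: real}) {0..1} = 1" by (simp add: measure_restrict_space)
  show "bdd_above ((\<lambda>f. L2_norm (graphon_operator W f)) ` {f \<in> L2_space. L2_norm f \<le> 1})"
  proof (rule bdd_aboveI2)
    fix h assume "h \<in> {f \<in> L2_space. L2_norm f \<le> 1}"
    then have int: "integrable (lebesgue_on {0..1}) (\<lambda>x. (h x)\<^sup>2)"
      and le1: "(LINT x|lebesgue_on {0..1}. (h x)\<^sup>2) \<le> 1"
      by (auto simp: L2_space_def L2_norm_def)
    have int': "integrable (lebesgue_on {0..1}) (\<lambda>x. (1 + (h x)\<^sup>2) / 2)"
      using int by (intro integrable_divide_zero Bochner_Integration.integrable_add) auto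
    have bound: "\<bar>graphon_operator W h x\<bar> \<le> 1" if "x \<in> {0..1}" for x
    proof (cases "integrable (lebesgue_on {0..1}) (\<lambda>y. W x y * h y)")
      case True
      have "\<bar>graphon_operator W h x\<bar> \<le> (LINT y|lebesgue_on {0..1}. \<bar>W x y * h y\<bar>)"
        unfolding graphon_operator_def by (rule integral_abs_bound)
      also have "\<dots> \<le> (LINT y|lebesgue_on {0..1}. (1 + (h y)\<^sup>2) / 2)"
      proof (rule integral_mono)
        fix y assume "y \<in> space (lebesgue_on {0..1 :: real})"
        then have "\<bar>W x y\<bar> \<le> 1" using W that by (auto simp: graphon_def)
        then have "\<bar>W x y * h y\<bar> \<le> \<bar>h y\<bar>" by (simp add: abs_mult mult_left_le_one_le)
        also have "\<dots> \<le> (1 + (h y)\<^sup>2) / 2"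
          using zero_le_power2[of "\<bar>h y\<bar> - 1"] by (simp add: power2_diff)
        finally show "\<bar>W x y * h y\<bar> \<le> (1 + (h y)\<^sup>2) / 2" .
      qed (use True int' in auto)
      also have "\<dots> = (1 + (LINT y|lebesgue_on {0..1}. (h y)\<^sup>2)) / 2"
        using int meas1 by (simp add: Bochner_Integration.integral_add)
      finally show ?thesis using le1 by simp
    qed (simp add: graphon_operator_def not_integrable_integral_eq)
    have "(LINT x|lebesgue_on {0..1}. (graphon_operator W h x)\<^sup>2) \<le> 1"
    proof (cases "integrable (lebesgue_on {0..1}) (\<lambda>x. (graphon_operator W h x)\<^sup>2)")
      case True
      then have "(LINT x|lebesgue_on {0..1}. (graphon_operator W h x)\<^sup>2) \<le> (LINT x|lebesgue_on {0..1 :: real}. 1)"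
        using bound by (intro integral_mono) (auto simp: abs_square_le_1)
      then show ?thesis using meas1 by simp
    qed (simp add: not_integrable_integral_eq)
    then show "L2_norm (graphon_operator W h) \<le> 1" by (simp add: L2_norm_def)
  qed
qed (use f in simp)

text \<open>
  At the points shared by neighbouring cells both values are added up; this affects a null set only.
  In return the product of two step functions is exactly a combination of the indicators of the cells.
\<close>
definition grid_step :: "nat \<Rightarrow> (nat \<Rightarrow> real) \<Rightarrow> real \<Rightarrow> real" where
  "grid_step N x t = (\<Sum>i=1..N. x i * indicator {(real i - 1) / N .. real i / N} t)"

lemma grid_step_measurable [measurable]: "grid_step N x \<in> borel_measurable borel"
  unfolding grid_step_def[abs_def] by measurable

lemma grid_step_bounded: "\<bar>grid_step N x t\<bar> \<le> (\<Sum>i=1..N. \<bar>x i\<bar>)"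
  unfolding grid_step_def
  by (intro order_trans[OF sum_abs] sum_mono) (auto simp: indicator_def)

lemma grid_step_square_integral:
  assumes N: "N \<ge> 1"
  shows "grid_step N x \<in> L2_space"
    and "(LINT t|lebesgue_on {0..1}. (grid_step N x t)\<^sup>2) = (\<Sum>i=1..N. (x i)\<^sup>2) / N"
proof -
  interpret finite_measure "lebesgue_on {0..1 :: real}"
    by (rule finite_measure_lebesgue_on) simp
  define J where "J i = {(real i - 1) / N .. real i / N}" for i
  have J_meas: "measure (lebesgue_on {0..1}) (J i \<inter> J j) = (if i = j then 1 / N else 0)"
    if "i \<in> {1..N}" "j \<in> {1..N}" for i j
  proof -
    have "J i \<subseteq> {0..1}" using that N by (auto simp: J_def field_simps)
    then have "measure (lebesgue_on {0..1}) (J i \<inter> J j) = measure lebesgue (J i \<inter> J j)"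
      by (intro measure_restrict_space) auto
    moreover have "J i \<inter> J j = {max ((real i - 1) / N) ((real j - 1) / N) .. min (real i / N) (real j / N)}"
      by (auto simp: J_def)
    moreover have "real i / N \<le> (real j - 1) / N" if "i < j" for i j
      using that by (intro divide_right_mono) auto
    from this[of i j] this[of j i]
    have "measure lebesgue {max ((real i - 1) / N) ((real j - 1) / N) .. min (real i / N) (real j / N)} =
        (if i = j then 1 / N else 0)"
      by (cases i j rule: linorder_cases) (auto simp: max_def min_def diff_divide_distrib)
    ultimately show ?thesis by simp
  qed
  have Jint: "integrable (lebesgue_on {0..1}) (\<lambda>t. indicator (J i \<inter> J j) t :: real)" for i j
  proof (rule integrable_const_bound[where B = 1])
    have "J i \<inter> J j \<in> sets lebesgue" by (simp add: J_def)
    then show "indicat_real (J i \<inter> J j) \<in> borel_measurable (lebesgue_on {0..1})"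
      by (intro measurable_restrict_space1 borel_measurable_indicator)
  qed simp
  have sq: "(grid_step N x t)\<^sup>2 = (\<Sum>i=1..N. \<Sum>j=1..N. x i * x j * indicator (J i \<inter> J j) t)" for t
    unfolding grid_step_def power2_eq_square sum_product J_def[symmetric]
    by (intro sum.cong refl) (simp add: indicator_inter_arith mult_ac)
  have "integrable (lebesgue_on {0..1}) (\<lambda>t. (grid_step N x t)\<^sup>2)"
    unfolding sq by (intro Bochner_Integration.integrable_sum integrable_mult_right Jint)
  moreover have "grid_step N x \<in> borel_measurable (lebesgue_on {0..1})"
    by (intro measurable_restrict_space1 measurable_completion) simp
  ultimately show "grid_step N x \<in> L2_space" by (simp add: L2_space_def)
  have "(LINT t|lebesgue_on {0..1}. (grid_step N x t)\<^sup>2) =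
      (\<Sum>i=1..N. \<Sum>j=1..N. x i * x j * measure (lebesgue_on {0..1}) (J i \<inter> J j))"
  proof -
    have "(LINT t|lebesgue_on {0..1}. indicator (J i \<inter> J j) t) = measure (lebesgue_on {0..1}) (J i \<inter> J j)"
      if "i \<in> {1..N}" "j \<in> {1..N}" for i j
    proof -
      have "J i \<subseteq> {0..1}" using that N by (auto simp: J_def field_simps)
      then have "J i \<inter> J j \<inter> {0..1} = J i \<inter> J j" by blast
      then show ?thesis by simp
    qed
    then show ?thesis unfolding sq
      by (subst Bochner_Integration.integral_sum
          | intro sum.cong refl Bochner_Integration.integrable_sum integrable_mult_right Jint
          | simp)+
  qed
  also have "\<dots> = (\<Sum>i=1..N. \<Sum>j=1..N. if j = i then (x i)\<^sup>2 / N else 0)"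
    by (intro sum.cong refl) (simp add: J_meas power2_eq_square)
  also have "\<dots> = (\<Sum>i=1..N. (x i)\<^sup>2) / N"
    by (simp add: sum_divide_distrib)
  finally show "(LINT t|lebesgue_on {0..1}. (grid_step N x t)\<^sup>2) = (\<Sum>i=1..N. (x i)\<^sup>2) / N" .
qed

text \<open>
  On step functions the quadratic form of the graphon operator is the quadratic form of the matrix of
  cell integrals.
\<close>
lemma grid_step_graphon_form:
  assumes W: "graphon W"
  shows "(LINT p|lebesgue_on unit_square. W (fst p) (snd p) * grid_step N x (fst p) * grid_step N x (snd p)) =
     (\<Sum>i=1..N. \<Sum>j=1..N. integral (grid_cell N i j) (case_prod W) * x i * x j)"
proof -
  let ?L = "lebesgue_on unit_square"
  have usq: "unit_square \<in> sets lebesgue" unfolding unit_square_eq_cbox by simp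
  have cell_meas: "grid_cell N i j \<in> sets lebesgue" for i j unfolding grid_cell_def by simp
  have eq: "W (fst p) (snd p) * grid_step N x (fst p) * grid_step N x (snd p) =
      (\<Sum>i=1..N. \<Sum>j=1..N. x i * x j * (indicator (grid_cell N i j) p * case_prod W p))" for p
  proof -
    have "grid_step N x (fst p) * grid_step N x (snd p) =
        (\<Sum>i=1..N. \<Sum>j=1..N. x i * x j * indicator (grid_cell N i j) p)"
      unfolding grid_step_def sum_product grid_cell_Times
      by (intro sum.cong refl) (auto simp: indicator_def mem_Times_iff)
    then have "W (fst p) (snd p) * grid_step N x (fst p) * grid_step N x (snd p) =
        (\<Sum>i=1..N. \<Sum>j=1..N. x i * x j * indicator (grid_cell N i j) p) * case_prod W p"
      by (simp add: case_prod_unfold mult.assoc)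
    then show ?thesis unfolding sum_distrib_right by (simp add: mult.assoc)
  qed
  have int: "integrable ?L (\<lambda>p. indicator (grid_cell N i j) p * case_prod W p)" for i j
  proof -
    have "grid_cell N i j \<inter> unit_square \<in> sets ?L"
      using cell_meas usq by (auto simp: sets_restrict_space)
    from integrable_mult_indicator[OF _ graphon_integrable[OF W], of "grid_cell N i j \<inter> unit_square"] this
    have "integrable ?L (\<lambda>p. indicator (grid_cell N i j \<inter> unit_square) p *\<^sub>R case_prod W p)" by blast
    then show ?thesis
      by (rule Bochner_Integration.integrable_cong[THEN iffD1, rotated -1]) (auto simp: indicator_def)
  qed
  have val: "(LINT p|?L. indicator (grid_cell N i j) p * case_prod W p) = integral (grid_cell N i j) (case_prod W)"
    if ij: "i \<in> {1..N}" "j \<in> {1..N}" for i j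
  proof -
    have sub: "grid_cell N i j \<subseteq> unit_square"
      unfolding unit_square_eq_cbox by (rule grid_cell_subset[OF ij])
    have eq': "indicator unit_square p *\<^sub>R (indicator (grid_cell N i j) p * case_prod W p) =
        indicator (grid_cell N i j) p *\<^sub>R case_prod W p" for p
      using sub by (auto simp: indicator_def)
    have "(LINT p|?L. indicator (grid_cell N i j) p * case_prod W p) =
        (LINT p|lebesgue. indicator unit_square p *\<^sub>R (indicator (grid_cell N i j) p * case_prod W p))"
      by (rule integral_restrict_space) (use usq in simp)
    also have "\<dots> = (LINT p|lebesgue. indicator (grid_cell N i j) p *\<^sub>R case_prod W p)"
      unfolding eq' ..
    also have "\<dots> = (LINT p|lebesgue_on (grid_cell N i j). case_prod W p)"
      by (rule integral_restrict_space[symmetric]) (use cell_meas in simp)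
    also have "\<dots> = integral (grid_cell N i j) (case_prod W)"
    proof (rule lebesgue_integral_eq_integral[OF _ cell_meas])
      have "integrable lebesgue (\<lambda>p. indicator unit_square p *\<^sub>R (indicator (grid_cell N i j) p * case_prod W p))"
        using int usq by (subst (asm) integrable_restrict_space) auto
      then show "integrable (lebesgue_on (grid_cell N i j)) (case_prod W)"
        unfolding eq' using cell_meas by (subst integrable_restrict_space) auto
    qed
    finally show ?thesis .
  qed
  show ?thesis
    unfolding eq
    by (subst Bochner_Integration.integral_sum
        | intro sum.cong refl Bochner_Integration.integrable_sum integrable_mult_right int
        | simp add: val)+
qed

lemma graphon_cell_integrals_sum:
  assumes W: "graphon W" and N: "N \<ge> 1"
  shows "(\<Sum>i=1..N. \<Sum>j=1..N. integral (grid_cell N i j) (case_prod W)) = graphon_integral W"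
proof -
  have int: "integrable (lebesgue_on (cbox (0, 0) (1, 1))) (case_prod W)"
    using graphon_integrable[OF W] unfolding unit_square_eq_cbox .
  have "graphon_integral W = integral (cbox (0, 0) (1, 1)) (case_prod W)"
    unfolding graphon_integral_def unit_square_eq_cbox
    using lebesgue_integral_eq_integral[OF int] by (simp add: case_prod_unfold)
  also have "\<dots> = (\<Sum>(x, K)\<in>grid_division N. integral K (case_prod W))"
    using int by (intro integral_combine_tagged_division_topdown grid_division_tagged[OF N])
      (auto intro: integrable_on_lebesgue_on)
  finally show ?thesis by (simp add: sum_grid_division[OF N])
qed

text \<open>
  Up to scaling the step function \<open>f\<close> with values \<open>x\<close> has norm 1. Then
  \<open>f T f \<le> (c f\<^sup>2 + (T f)\<^sup>2 / c) / 2\<close> with the operator norm \<open>c\<close>, and the integral of the right-hand side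
  is at most \<open>(c + c) / 2\<close>.
\<close>
lemma graphon_cell_form_le_op_norm:
  assumes W: "graphon W" and N: "N \<ge> 1" and pos: "graphon_op_norm W > 0"
  shows "(\<Sum>i=1..N. \<Sum>j=1..N. integral (grid_cell N i j) (case_prod W) * x i * x j) \<le>
    graphon_op_norm W * (\<Sum>i=1..N. (x i)\<^sup>2) / N"
proof -
  define c where "c = graphon_op_norm W"
  define q where "q x = (\<Sum>i=1..N. \<Sum>j=1..N. integral (grid_cell N i j) (case_prod W) * x i * x j)" for x
  have unit: "q x \<le> c" if x: "(\<Sum>i=1..N. (x i)\<^sup>2) = real N" for x
  proof -
    define f where "f = grid_step N x"
    define T where "T = graphon_operator W f"
    have f1: "(LINT t|lebesgue_on {0..1}. (f t)\<^sup>2) = 1" and fL2: "f \<in> L2_space"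
      using grid_step_square_integral[OF N, of x] x N by (auto simp: f_def)
    have "L2_norm T \<le> c"
      unfolding T_def c_def by (rule L2_norm_le_graphon_op_norm[OF W fL2]) (simp add: L2_norm_def f1)
    then have T2: "(LINT t|lebesgue_on {0..1}. (T t)\<^sup>2) \<le> c\<^sup>2"
      unfolding L2_norm_def by (rule sqrt_le_D)
    interpret finite_measure "lebesgue_on {0..1 :: real}"
      by (rule finite_measure_lebesgue_on) simp
    define B where "B = (\<Sum>i=1..N. \<bar>x i\<bar>)"
    have fB: "\<bar>f t\<bar> \<le> B" for t unfolding f_def B_def by (rule grid_step_bounded)
    have f_borel: "f \<in> borel_measurable borel" unfolding f_def by (rule grid_step_measurable)
    note fub = graphon_fubini[OF W f_borel fB f_borel fB]
    have T_meas: "T \<in> borel_measurable (lebesgue_on {0..1})"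
      unfolding T_def by (rule fub(1))
    have form: "q x = (LINT t|lebesgue_on {0..1}. f t * T t)"
      unfolding T_def fub(2) unfolding q_def f_def grid_step_graphon_form[OF W] ..
    have f_int: "integrable (lebesgue_on {0..1}) (\<lambda>t. (f t)\<^sup>2)" using fL2 by (simp add: L2_space_def)
    have f_meas: "f \<in> borel_measurable (lebesgue_on {0..1})" using fL2 by (simp add: L2_space_def)
    have TB: "\<bar>T t\<bar> \<le> B" if "t \<in> {0..1}" for t
    proof (cases "integrable (lebesgue_on {0..1}) (\<lambda>y. W t y * f y)")
      case True
      have "\<bar>T t\<bar> \<le> (LINT y|lebesgue_on {0..1}. \<bar>W t y * f y\<bar>)"
        unfolding T_def graphon_operator_def by (rule integral_abs_bound)
      also have "\<dots> \<le> (LINT y|lebesgue_on {0..1 :: real}. B)"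
      proof (rule integral_mono)
        fix y assume "y \<in> space (lebesgue_on {0..1 :: real})"
        then have "\<bar>W t y\<bar> \<le> 1" using W that by (auto simp: graphon_def)
        then show "\<bar>W t y * f y\<bar> \<le> B" using fB[of y]
          by (simp add: abs_mult) (metis abs_ge_zero mult_left_le_one_le order_trans)
      qed (use True in auto)
      finally show ?thesis by (simp add: measure_restrict_space)
    qed (simp add: T_def graphon_operator_def not_integrable_integral_eq B_def sum_nonneg)
    have T_int: "integrable (lebesgue_on {0..1}) (\<lambda>t. (T t)\<^sup>2)"
    proof (rule integrable_const_bound[where B = "B\<^sup>2"])
      show "AE t in lebesgue_on {0..1}. norm ((T t)\<^sup>2) \<le> B\<^sup>2"
        using TB order_trans[OF abs_ge_zero fB[of 0]] by (intro AE_I2) (auto simp: abs_le_square_iff[symmetric])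
    qed (use T_meas in simp)
    have amgm: "f t * T t \<le> (c * (f t)\<^sup>2 + (T t)\<^sup>2 / c) / 2" for t
    proof -
      have "0 \<le> (c * f t - T t)\<^sup>2 / c" using pos by (simp add: c_def)
      also have "\<dots> = c * (f t)\<^sup>2 + (T t)\<^sup>2 / c - 2 * (f t * T t)"
        using pos by (simp add: c_def power2_diff field_simps power2_eq_square)
      finally show ?thesis by simp
    qed
    have "q x \<le> (LINT t|lebesgue_on {0..1}. (c * (f t)\<^sup>2 + (T t)\<^sup>2 / c) / 2)"
      unfolding form
    proof (rule integral_mono)
      show "integrable (lebesgue_on {0..1}) (\<lambda>t. f t * T t)"
      proof (rule integrable_const_bound[where B = "B * B"])
        show "AE t in lebesgue_on {0..1}. norm (f t * T t) \<le> B * B"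
          using TB fB by (intro AE_I2) (auto simp: abs_mult intro!: mult_mono intro: order_trans[OF abs_ge_zero])
      qed (use T_meas f_meas in measurable)
      show "integrable (lebesgue_on {0..1}) (\<lambda>t. (c * (f t)\<^sup>2 + (T t)\<^sup>2 / c) / 2)"
        using f_int T_int by auto
    qed (rule amgm)
    also have "\<dots> = (c * 1 + (LINT t|lebesgue_on {0..1}. (T t)\<^sup>2) / c) / 2"
      using f_int T_int by (simp add: f1)
    also have "\<dots> \<le> (c * 1 + c\<^sup>2 / c) / 2"
      using T2 pos by (intro divide_right_mono add_left_mono) (auto simp: c_def)
    also have "\<dots> = c" using pos by (simp add: c_def power2_eq_square)
    finally show ?thesis .
  qed
  show ?thesis
  proof (cases "(\<Sum>i=1..N. (x i)\<^sup>2) = 0")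
    case True
    then have "x i = 0" if "i \<in> {1..N}" for i using that by (simp add: sum_nonneg_eq_0_iff)
    then show ?thesis by simp
  next
    case False
    define s where "s = (\<Sum>i=1..N. (x i)\<^sup>2) / N"
    have s: "s > 0" using False N by (simp add: s_def sum_nonneg order.not_eq_order_implies_strict)
    have "q (\<lambda>i. x i / sqrt s) \<le> c"
    proof (rule unit)
      have "(\<Sum>i=1..N. (x i)\<^sup>2) = s * N" using N by (simp add: s_def)
      then show "(\<Sum>i=1..N. (x i / sqrt s)\<^sup>2) = real N"
        using s by (simp add: power_divide flip: sum_divide_distrib)
    qed
    moreover have "q (\<lambda>i. x i / sqrt s) = q x / s"
      unfolding q_def sum_divide_distrib using s by (intro sum.cong refl) (simp add: field_simps)
    ultimately have "q x \<le> c * s" using s by (simp add: pos_divide_le_eq)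
    then show ?thesis by (simp add: q_def c_def s_def)
  qed
qed

lemma graphon_cell_integral_bounds:
  assumes W: "graphon W" and ij: "i \<in> {1..N}" "j \<in> {1..N}"
  shows "integral (grid_cell N i j) (case_prod W) \<in> {0..1 / (real N)\<^sup>2}"
proof -
  have N: "N \<ge> 1" using ij by simp
  have sub: "grid_cell N i j \<subseteq> cbox (0, 0) (1, 1)" by (rule grid_cell_subset[OF ij])
  have "case_prod W integrable_on cbox (0, 0) (1, 1)"
    using graphon_integrable[OF W] unfolding unit_square_eq_cbox by (rule integrable_on_lebesgue_on) simp
  then have int: "case_prod W integrable_on grid_cell N i j"
    using sub unfolding grid_cell_def by (rule integrable_on_subcbox)
  have range: "0 \<le> case_prod W p" "case_prod W p \<le> 1" if "p \<in> grid_cell N i j" for p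
    using W sub that unfolding graphon_def cbox_Pair_eq by (auto simp: case_prod_unfold)
  have "integral (grid_cell N i j) (case_prod W) \<le> integral (grid_cell N i j) (\<lambda>_. 1)"
    using range int by (intro integral_le) (auto simp: grid_cell_def)
  also have "\<dots> = 1 / (real N)\<^sup>2"
    using content_grid_cell[OF N] by (simp add: grid_cell_def)
  finally show ?thesis using range int by (auto intro!: integral_nonneg)
qed

lemma graphon_grid_mean:
  assumes W: "graphon W" and R: "case_prod W riemann_integrable_on cbox (0, 0) (1, 1)"
  shows "(\<lambda>N. (\<Sum>i=1..N. \<Sum>j=1..N. W (real i / N) (real j / N)) / (real N)\<^sup>2) \<longlonglongrightarrow> graphon_integral W"
proof (rule Lim_transform2)
  show "(\<lambda>_. graphon_integral W) \<longlonglongrightarrow> graphon_integral W" by simp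
  have bound: "\<bar>graphon_integral W - (\<Sum>i=1..N. \<Sum>j=1..N. W (real i / N) (real j / N)) / (real N)\<^sup>2\<bar> \<le>
      (\<Sum>i=1..N. \<Sum>j=1..N.
            \<bar>case_prod W (real i / N, real j / N) / (real N)\<^sup>2 - integral (grid_cell N i j) (case_prod W)\<bar>)"
    if "N \<ge> 1" for N
  proof -
    have eq: "(\<Sum>i=1..N. \<Sum>j=1..N. W (real i / N) (real j / N)) / (real N)\<^sup>2 - graphon_integral W =
       (\<Sum>i=1..N. \<Sum>j=1..N. W (real i / N) (real j / N) / (real N)\<^sup>2 - integral (grid_cell N i j) (case_prod W))"
      by (simp add: graphon_cell_integrals_sum[OF W that, symmetric] sum_divide_distrib sum_subtractf)
    show ?thesis
      unfolding abs_minus_commute[of "graphon_integral W"] eq prod.case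
      by (rule order_trans[OF sum_abs sum_mono[OF sum_abs]])
  qed
  show "(\<lambda>N. graphon_integral W - (\<Sum>i=1..N. \<Sum>j=1..N. W (real i / N) (real j / N)) / (real N)\<^sup>2) \<longlonglongrightarrow> 0"
    by (rule Lim_null_comparison[OF _ riemann_integrable_cell_averages[OF R]])
       (use bound in \<open>auto intro!: eventually_sequentiallyI[of 1]\<close>)
qed

lemma abs_quadratic_form_le_frobenius:
  fixes D :: "'a \<Rightarrow> 'a \<Rightarrow> real"
  shows "\<bar>\<Sum>i\<in>A. \<Sum>j\<in>A. D i j * x i * x j\<bar> \<le> sqrt (\<Sum>i\<in>A. \<Sum>j\<in>A. (D i j)\<^sup>2) * (\<Sum>i\<in>A. (x i)\<^sup>2)"
proof -
  have "(\<Sum>i\<in>A. \<Sum>j\<in>A. D i j * x i * x j)\<^sup>2 = (\<Sum>(i, j)\<in>A \<times> A. D i j * (x i * x j))\<^sup>2"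
    by (simp add: sum.cartesian_product mult.assoc)
  also have "\<dots> \<le> (\<Sum>(i, j)\<in>A \<times> A. (D i j)\<^sup>2) * (\<Sum>(i, j)\<in>A \<times> A. (x i * x j)\<^sup>2)"
    unfolding case_prod_unfold by (rule Cauchy_Schwarz_ineq_sum)
  also have "(\<Sum>(i, j)\<in>A \<times> A. (x i * x j)\<^sup>2) = (\<Sum>i\<in>A. (x i)\<^sup>2)\<^sup>2"
    by (simp add: power2_eq_square[of "sum _ _"] sum_product sum.cartesian_product power_mult_distrib)
  finally have "\<bar>\<Sum>i\<in>A. \<Sum>j\<in>A. D i j * x i * x j\<bar> \<le>
      sqrt ((\<Sum>(i, j)\<in>A \<times> A. (D i j)\<^sup>2) * (\<Sum>i\<in>A. (x i)\<^sup>2)\<^sup>2)"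
    by (rule real_le_rsqrt[of "\<bar>_\<bar>", unfolded power2_abs])
  then show ?thesis
    by (simp add: real_sqrt_mult sum.cartesian_product sum_nonneg)
qed

text \<open>
  The matrix \<open>\<gamma> W(i/N, j/N) / N\<close> differs from \<open>\<gamma> N\<close> times the matrix of cell integrals by a matrix of
  small Frobenius norm: its entries are at most \<open>\<gamma> / N\<close>, and the sum of their absolute values is
  \<open>o(N)\<close> by \<open>riemann_integrable_cell_averages\<close>. The form of the cell integrals is bounded by the
  operator norm.
\<close>
lemma graphon_grid_form_bound:
  assumes W: "graphon W" and R: "case_prod W riemann_integrable_on cbox (0, 0) (1, 1)"
    and pos: "graphon_op_norm W > 0" and g: "\<gamma> > 0" "\<gamma> * graphon_op_norm W < 1"
  obtains \<rho> where "0 \<le> \<rho>" "\<rho> < 1"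
    "\<forall>\<^sub>F N in sequentially. \<forall>x. (\<Sum>i=1..N. \<Sum>j=1..N. \<gamma> * W (real i / N) (real j / N) / N * x i * x j) \<le>
        \<rho> * (\<Sum>i=1..N. (x i)\<^sup>2)"
proof
  define c where "c = graphon_op_norm W"
  define \<rho> where "\<rho> = (1 + \<gamma> * c) / 2"
  show "0 \<le> \<rho>" "\<rho> < 1" using pos g by (auto simp: \<rho>_def c_def)
  define w where "w N i j = integral (grid_cell N i j) (case_prod W)" for N i j
  define D where "D N i j = W (real i / N) (real j / N) / (real N)\<^sup>2 - w N i j" for N i j
  define \<delta> where "\<delta> N = (\<Sum>i=1..N. \<Sum>j=1..N. \<bar>D N i j\<bar>)" for N
  have "\<delta> \<longlonglongrightarrow> 0"
    using riemann_integrable_cell_averages[OF R] by (simp add: \<delta>_def[abs_def] D_def w_def)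
  then have "(\<lambda>N. \<gamma> * (c + sqrt (\<delta> N))) \<longlonglongrightarrow> \<gamma> * (c + sqrt 0)" by (intro tendsto_intros)
  moreover have "\<gamma> * (c + sqrt 0) < \<rho>" using g by (simp add: \<rho>_def c_def)
  ultimately have "\<forall>\<^sub>F N in sequentially. \<gamma> * (c + sqrt (\<delta> N)) < \<rho>" by (rule order_tendstoD)
  then show "\<forall>\<^sub>F N in sequentially. \<forall>x. (\<Sum>i=1..N. \<Sum>j=1..N. \<gamma> * W (real i / N) (real j / N) / N * x i * x j) \<le>
        \<rho> * (\<Sum>i=1..N. (x i)\<^sup>2)"
    using eventually_ge_at_top[of 1]
  proof eventually_elim
    case (elim N)
    show ?case
    proof
      fix x :: "nat \<Rightarrow> real"
      define s where "s = (\<Sum>i=1..N. (x i)\<^sup>2)"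
      have s: "s \<ge> 0" by (simp add: s_def sum_nonneg)
      have "(\<Sum>i=1..N. \<Sum>j=1..N. (D N i j)\<^sup>2) \<le> (\<Sum>i=1..N. \<Sum>j=1..N. \<bar>D N i j\<bar> / (real N)\<^sup>2)"
      proof (intro sum_mono)
        fix i j assume ij: "i \<in> {1..N}" "j \<in> {1..N}"
        have "W (real i / N) (real j / N) \<in> {0..1}"
          using W ij by (auto simp: graphon_def)
        then have "W (real i / N) (real j / N) / (real N)\<^sup>2 \<in> {0..1 / (real N)\<^sup>2}"
          by (auto intro: divide_right_mono)
        with graphon_cell_integral_bounds[OF W ij] have "\<bar>D N i j\<bar> \<le> 1 / (real N)\<^sup>2"
          by (auto simp: D_def w_def)
        then have "\<bar>D N i j\<bar> * \<bar>D N i j\<bar> \<le> \<bar>D N i j\<bar> * (1 / (real N)\<^sup>2)"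
          by (intro mult_left_mono) auto
        then show "(D N i j)\<^sup>2 \<le> \<bar>D N i j\<bar> / (real N)\<^sup>2" by (simp add: power2_eq_square)
      qed
      also have "\<dots> = \<delta> N / (real N)\<^sup>2" by (simp add: \<delta>_def sum_divide_distrib)
      finally have "sqrt (\<Sum>i=1..N. \<Sum>j=1..N. (D N i j)\<^sup>2) \<le> sqrt (\<delta> N / (real N)\<^sup>2)" by simp
      also have "\<dots> = sqrt (\<delta> N) / N" by (simp add: real_sqrt_divide)
      finally have "sqrt (\<Sum>i=1..N. \<Sum>j=1..N. (D N i j)\<^sup>2) * s \<le> sqrt (\<delta> N) / N * s"
        using s by (rule mult_right_mono)
      then have D: "(\<Sum>i=1..N. \<Sum>j=1..N. D N i j * x i * x j) \<le> sqrt (\<delta> N) / N * s"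
        using abs_quadratic_form_le_frobenius[of "D N" x "{1..N}"] by (simp add: s_def)
      have w: "(\<Sum>i=1..N. \<Sum>j=1..N. w N i j * x i * x j) \<le> c * s / N"
        unfolding w_def c_def s_def by (rule graphon_cell_form_le_op_norm[OF W elim(2) pos])
      have "(\<Sum>i=1..N. \<Sum>j=1..N. \<gamma> * W (real i / N) (real j / N) / N * x i * x j) =
          (\<Sum>i=1..N. \<Sum>j=1..N. \<gamma> * N * (w N i j * x i * x j + D N i j * x i * x j))"
        using elim(2) by (intro sum.cong refl) (simp add: D_def field_simps power2_eq_square)
      also have "\<dots> = \<gamma> * N * ((\<Sum>i=1..N. \<Sum>j=1..N. w N i j * x i * x j) + (\<Sum>i=1..N. \<Sum>j=1..N. D N i j * x i * x j))"
        by (simp only: sum.distrib sum_distrib_left[symmetric])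
      also have "\<dots> \<le> \<gamma> * N * (c * s / N + sqrt (\<delta> N) / N * s)"
        using g D w by (intro mult_left_mono add_mono) auto
      also have "\<dots> = \<gamma> * (c + sqrt (\<delta> N)) * s" using elim(2) by (simp add: field_simps)
      also have "\<dots> \<le> \<rho> * s" using elim(1) s by (intro mult_right_mono) auto
      finally show "(\<Sum>i=1..N. \<Sum>j=1..N. \<gamma> * W (real i / N) (real j / N) / N * x i * x j) \<le>
        \<rho> * (\<Sum>i=1..N. (x i)\<^sup>2)" by (simp add: s_def)
    qed
  qed
qed

section \<open>The even subgraph expansion of the Ising model\<close>

text \<open>
  Unordered pairs of distinct vertices; loops are counted separately because \<open>\<sigma>\<^sub>i \<sigma>\<^sub>i = 1\<close> makes their
  energy constant.
\<close>
definition vertex_pairs :: "nat \<Rightarrow> (nat \<times> nat) set" where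
  "vertex_pairs N = {(i, j). 1 \<le> i \<and> i < j \<and> j \<le> N}"

lemma finite_vertex_pairs [simp]: "finite (vertex_pairs N)"
  by (rule finite_subset[of _ "{1..N} \<times> {1..N}"]) (auto simp: vertex_pairs_def)

lemma sum_symmetric_split:
  fixes f :: "nat \<Rightarrow> nat \<Rightarrow> 'a::comm_ring_1"
  assumes "\<And>i j. f i j = f j i"
  shows "(\<Sum>i=1..N. \<Sum>j=1..N. f i j) = (\<Sum>i=1..N. f i i) + 2 * (\<Sum>(i, j)\<in>vertex_pairs N. f i j)"
proof (induction N)
  case 0
  have "vertex_pairs 0 = {}" by (auto simp: vertex_pairs_def)
  then show ?case by simp
next
  case (Suc N)
  have "vertex_pairs (Suc N) = vertex_pairs N \<union> (\<lambda>i. (i, Suc N)) ` {1..N}"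
    by (auto simp: vertex_pairs_def le_Suc_eq)
  moreover have "vertex_pairs N \<inter> (\<lambda>i. (i, Suc N)) ` {1..N} = {}"
    by (auto simp: vertex_pairs_def)
  ultimately have pairs: "(\<Sum>(i, j)\<in>vertex_pairs (Suc N). f i j) =
      (\<Sum>(i, j)\<in>vertex_pairs N. f i j) + (\<Sum>i=1..N. f i (Suc N))"
    by (simp add: sum.union_disjoint sum.reindex inj_on_def)
  have "(\<Sum>j=1..N. f (Suc N) j) = (\<Sum>i=1..N. f i (Suc N))"
    by (intro sum.cong refl assms)
  then show ?case
    using Suc.IH by (simp add: pairs sum.distrib algebra_simps)
qed

lemma spins_eq_sign:
  assumes "\<sigma> \<in> spins N" "i \<in> {1..N}"
  shows "\<sigma> i = 1 \<or> \<sigma> i = -1"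
  using assms by (auto simp: spins_def PiE_iff)

lemma card_spins: "card (spins N) = 2 ^ N"
  by (simp add: spins_def card_PiE numeral_2_eq_2)

text \<open>
  The product over \<open>F\<close> is \<open>\<Prod> \<sigma>\<^sub>v\<^bsup>d v\<^esup>\<close> with the degrees \<open>d v\<close> of \<open>F\<close>. The sum over all spins factorises
  over the vertices, and each factor is 2 or 0 according to the parity of the degree.
\<close>
lemma sum_spins_edge_product_nonneg:
  assumes F: "F \<subseteq> vertex_pairs N"
  shows "0 \<le> (\<Sum>\<sigma>\<in>spins N. \<Prod>(i, j)\<in>F. \<sigma> i * \<sigma> j)"
proof -
  have fin: "finite F" using F finite_subset finite_vertex_pairs by blast
  define d :: "nat \<Rightarrow> nat" where "d v = (\<Sum>e\<in>F. of_bool (v = fst e) + of_bool (v = snd e))" for v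
  have "(\<Prod>(i, j)\<in>F. \<sigma> i * \<sigma> j) = (\<Prod>v=1..N. \<sigma> v ^ d v)" for \<sigma> :: "nat \<Rightarrow> real"
  proof -
    have "\<sigma> (fst e) * \<sigma> (snd e) = (\<Prod>v=1..N. \<sigma> v ^ (of_bool (v = fst e) + of_bool (v = snd e)))"
      if "e \<in> F" for e
    proof -
      have e: "fst e \<in> {1..N}" "snd e \<in> {1..N}" using that F by (auto simp: vertex_pairs_def)
      have delta: "(\<Prod>v=1..N. \<sigma> v ^ of_bool (v = w)) = \<sigma> w" if "w \<in> {1..N}" for w
      proof -
        have "(\<Prod>v=1..N. \<sigma> v ^ of_bool (v = w)) = (\<Prod>v=1..N. if v = w then \<sigma> v else 1)"
          by (intro prod.cong) auto
        then show ?thesis using that by simp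
      qed
      show ?thesis unfolding power_add prod.distrib using delta[OF e(1)] delta[OF e(2)] by simp
    qed
    then have "(\<Prod>(i, j)\<in>F. \<sigma> i * \<sigma> j) =
        (\<Prod>e\<in>F. \<Prod>v=1..N. \<sigma> v ^ (of_bool (v = fst e) + of_bool (v = snd e)))"
      by (simp add: case_prod_unfold)
    also have "\<dots> = (\<Prod>v=1..N. \<sigma> v ^ d v)"
      unfolding d_def by (subst prod.swap) (simp add: power_sum)
    finally show ?thesis .
  qed
  then have "(\<Sum>\<sigma>\<in>spins N. \<Prod>(i, j)\<in>F. \<sigma> i * \<sigma> j) = (\<Prod>v=1..N. \<Sum>s\<in>{-1, 1}. s ^ d v)"
    unfolding spins_def by (subst prod_sum_PiE) auto
  also have "\<dots> \<ge> 0"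
  proof (rule prod_nonneg)
    fix v
    have "(- 1 :: real) ^ d v \<ge> - 1" by (cases "even (d v)") auto
    then show "0 \<le> (\<Sum>s\<in>{-1, 1 :: real}. s ^ d v)" by simp
  qed
  finally show ?thesis .
qed

text \<open>
  The mean over uniform spins leaves only the subgraphs of \<open>G\<close> in which all degrees are even, so this is
  their generating polynomial by number of edges. It is needed at real and at complex arguments.
\<close>
definition subgraph_sum :: "nat \<Rightarrow> edge_indicators \<Rightarrow> 'a::real_normed_field \<Rightarrow> 'a" where
  "subgraph_sum N G t =
     (\<Sum>\<sigma>\<in>spins N. \<Prod>(i, j)\<in>vertex_pairs N. 1 + t * of_real (adj G i j * \<sigma> i * \<sigma> j)) / 2 ^ N"

definition subgraph_coeff :: "nat \<Rightarrow> edge_indicators \<Rightarrow> (nat \<times> nat) set \<Rightarrow> real" where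
  "subgraph_coeff N G F = (\<Sum>\<sigma>\<in>spins N. \<Prod>(i, j)\<in>F. adj G i j * \<sigma> i * \<sigma> j) / 2 ^ N"

lemma subgraph_coeff_nonneg:
  assumes "F \<subseteq> vertex_pairs N"
  shows "0 \<le> subgraph_coeff N G F"
proof -
  have "(\<Sum>\<sigma>\<in>spins N. \<Prod>(i, j)\<in>F. adj G i j * \<sigma> i * \<sigma> j) =
      (\<Prod>(i, j)\<in>F. adj G i j) * (\<Sum>\<sigma>\<in>spins N. \<Prod>(i, j)\<in>F. \<sigma> i * \<sigma> j)"
    by (simp add: sum_distrib_left case_prod_unfold mult.assoc prod.distrib)
  moreover have "0 \<le> (\<Prod>(i, j)\<in>F. adj G i j)"
    by (rule prod_nonneg) (auto simp: adj_def)
  ultimately show ?thesis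
    using sum_spins_edge_product_nonneg[OF assms] by (simp add: subgraph_coeff_def)
qed

lemma subgraph_coeff_empty: "subgraph_coeff N G {} = 1"
  by (simp add: subgraph_coeff_def card_spins)

lemma subgraph_sum_expansion:
  "subgraph_sum N G t = (\<Sum>F\<in>Pow (vertex_pairs N). of_real (subgraph_coeff N G F) * t ^ card F)"
proof -
  have "(\<Prod>(i, j)\<in>vertex_pairs N. 1 + t * of_real (adj G i j * \<sigma> i * \<sigma> j)) =
      (\<Sum>F\<in>Pow (vertex_pairs N). t ^ card F * of_real (\<Prod>(i, j)\<in>F. adj G i j * \<sigma> i * \<sigma> j))" for \<sigma>
  proof -
    have "(\<Prod>(i, j)\<in>vertex_pairs N. 1 + t * of_real (adj G i j * \<sigma> i * \<sigma> j)) =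
        (\<Prod>e\<in>vertex_pairs N. t * of_real (adj G (fst e) (snd e) * \<sigma> (fst e) * \<sigma> (snd e)) + 1)"
      by (simp add: case_prod_unfold add.commute)
    also have "\<dots> = (\<Sum>F\<in>Pow (vertex_pairs N).
        \<Prod>e\<in>F. t * of_real (adj G (fst e) (snd e) * \<sigma> (fst e) * \<sigma> (snd e)))"
      by (subst prod_add) simp_all
    also have "\<dots> = (\<Sum>F\<in>Pow (vertex_pairs N). t ^ card F * of_real (\<Prod>(i, j)\<in>F. adj G i j * \<sigma> i * \<sigma> j))"
      by (intro sum.cong refl) (simp add: prod.distrib case_prod_unfold)
    finally show ?thesis .
  qed
  then have "subgraph_sum N G t =
      (\<Sum>F\<in>Pow (vertex_pairs N). \<Sum>\<sigma>\<in>spins N. t ^ card F * of_real (\<Prod>(i, j)\<in>F. adj G i j * \<sigma> i * \<sigma> j)) / 2 ^ N"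
    unfolding subgraph_sum_def by (subst sum.swap) simp
  then show ?thesis
    by (simp add: subgraph_coeff_def sum_divide_distrib sum_distrib_left sum_distrib_right mult.commute
        flip: sum_divide_distrib sum_distrib_left)
qed

lemma subgraph_sum_of_real: "subgraph_sum N G (of_real t) = of_real (subgraph_sum N G t)"
  unfolding subgraph_sum_expansion by simp

lemma subgraph_sum_ge_1:
  assumes "0 \<le> (t :: real)"
  shows "1 \<le> subgraph_sum N G t"
proof -
  have "1 = (\<Sum>F\<in>{{}}. of_real (subgraph_coeff N G F) * t ^ card F)" by (simp add: subgraph_coeff_empty)
  also have "\<dots> \<le> subgraph_sum N G t"
    unfolding subgraph_sum_expansion using assms
    by (intro sum_mono2) (auto intro!: mult_nonneg_nonneg subgraph_coeff_nonneg)
  finally show ?thesis .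
qed

text \<open>
  The mean value bound \<open>k x\<^bsup>k-1\<^esup>\<close> for the slope of \<open>z\<^bsup>k\<^esup>\<close> on the disc of radius \<open>x\<close> is at most the slope
  \<open>(R\<^sup>k - x\<^sup>k) / (R - x)\<close> of the chord from \<open>x\<close> to \<open>R\<close>.
\<close>
lemma norm_power_diff_le:
  fixes z w :: "'a::real_normed_field"
  assumes "norm z \<le> x" "norm w \<le> x" "x < R"
  shows "norm (z ^ k - w ^ k) \<le> norm (z - w) / (R - x) * R ^ k"
proof (cases k)
  case (Suc n)
  have x0: "0 \<le> x" using assms(1) norm_ge_zero order_trans by blast
  have R0: "0 \<le> R" using x0 assms(3) by simp
  have "norm (z ^ k - w ^ k) = norm (z - w) * norm (\<Sum>i<Suc n. z ^ i * w ^ (n - i))"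
    unfolding Suc power_diff_sumr2 norm_mult by (simp add: mult.commute[of "w ^ _"])
  also have "norm (\<Sum>i<Suc n. z ^ i * w ^ (n - i)) \<le> (\<Sum>i<Suc n. R ^ i * x ^ (n - i))"
    using assms x0 R0
    by (intro order_trans[OF norm_sum] sum_mono) (auto simp: norm_mult norm_power intro!: mult_mono power_mono)
  also have "(\<Sum>i<Suc n. R ^ i * x ^ (n - i)) = (R ^ k - x ^ k) / (R - x)"
    using assms(3) unfolding Suc power_diff_sumr2 by (simp add: mult.commute[of "x ^ _"] del: sum.lessThan_Suc)
  also have "\<dots> \<le> R ^ k / (R - x)"
    using x0 assms(3) by (intro divide_right_mono) auto
  finally show ?thesis by (simp add: mult_left_mono)
qed (use assms in auto)

text \<open>
  As the coefficients are nonnegative, the bound for monomials sums up to a bound by the value of the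
  same polynomial at a slightly larger radius. This reduces the comparison of partition functions to a
  first moment estimate.
\<close>
lemma subgraph_sum_diff_bound:
  assumes "norm (z :: complex) \<le> x" "norm w \<le> x" "x < R"
  shows "norm (subgraph_sum N G z - subgraph_sum N G w) \<le> norm (z - w) / (R - x) * subgraph_sum N G R"
proof -
  have "subgraph_sum N G z - subgraph_sum N G w =
      (\<Sum>F\<in>Pow (vertex_pairs N). of_real (subgraph_coeff N G F) * (z ^ card F - w ^ card F))"
    unfolding subgraph_sum_expansion by (simp add: sum_subtractf algebra_simps)
  also have "norm \<dots> \<le> (\<Sum>F\<in>Pow (vertex_pairs N). subgraph_coeff N G F * (norm (z - w) / (R - x) * R ^ card F))"
  proof (intro order_trans[OF norm_sum] sum_mono)
    fix F assume "F \<in> Pow (vertex_pairs N)"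
    then have "0 \<le> subgraph_coeff N G F" by (auto intro: subgraph_coeff_nonneg)
    then show "norm (of_real (subgraph_coeff N G F) * (z ^ card F - w ^ card F)) \<le>
        subgraph_coeff N G F * (norm (z - w) / (R - x) * R ^ card F)"
      unfolding norm_mult norm_of_real abs_of_nonneg[OF \<open>0 \<le> subgraph_coeff N G F\<close>]
      by (intro mult_left_mono norm_power_diff_le[OF assms])
  qed
  also have "\<dots> = norm (z - w) / (R - x) * subgraph_sum N G R"
    unfolding subgraph_sum_expansion sum_distrib_left by (intro sum.cong) auto
  finally show ?thesis .
qed

text \<open>
  The denominator of the estimator: an edge between distinct vertices counts twice, a loop once.
\<close>
definition edge_sum :: "nat \<Rightarrow> edge_indicators \<Rightarrow> real" where
  "edge_sum N G = (\<Sum>i=1..N. \<Sum>j=1..N. adj G i j)"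

definition loop_count :: "nat \<Rightarrow> edge_indicators \<Rightarrow> real" where
  "loop_count N G = (\<Sum>i=1..N. adj G i i)"

definition edge_count :: "nat \<Rightarrow> edge_indicators \<Rightarrow> nat" where
  "edge_count N G = card {e \<in> vertex_pairs N. G e}"

definition spin_form :: "nat \<Rightarrow> edge_indicators \<Rightarrow> (nat \<Rightarrow> real) \<Rightarrow> real" where
  "spin_form N G \<sigma> = (\<Sum>i=1..N. \<Sum>j=1..N. adj G i j * \<sigma> i * \<sigma> j)"

lemma adj_sym: "adj G i j = adj G j i"
  by (simp add: adj_def min.commute max.commute)

lemma edge_sum_eq: "edge_sum N G = loop_count N G + 2 * edge_count N G"
proof -
  have "(\<Sum>(i, j)\<in>vertex_pairs N. adj G i j) = (\<Sum>e\<in>vertex_pairs N. of_bool (G e))"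
    by (intro sum.cong) (auto simp: adj_def vertex_pairs_def min_def max_def)
  also have "\<dots> = real (edge_count N G)"
    by (simp add: edge_count_def of_bool_def sum.If_cases Int_def)
  finally show ?thesis
    unfolding edge_sum_def loop_count_def by (subst sum_symmetric_split[OF adj_sym]) simp
qed

text \<open>
  For a sign \<open>\<epsilon>\<close> one has \<open>exp (u \<epsilon>) = cosh u (1 + \<epsilon> tanh u)\<close>, and an absent edge contributes the
  factor 1. Both sides are stated for complex \<open>u\<close> since the characteristic function of the energy is a
  partition function at a complex inverse temperature.
\<close>
lemma sum_spins_exp_form:
  fixes u :: complex
  assumes u: "cosh u \<noteq> 0"
  shows "(\<Sum>\<sigma>\<in>spins N. exp (u * of_real (spin_form N G \<sigma>) / 2)) =
    2 ^ N * exp (u * of_real (loop_count N G) / 2) * cosh u ^ edge_count N G * subgraph_sum N G (tanh u)"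
proof -
  have "exp (u * of_real (spin_form N G \<sigma>) / 2) =
      exp (u * of_real (loop_count N G) / 2) * cosh u ^ edge_count N G *
      (\<Prod>(i, j)\<in>vertex_pairs N. 1 + tanh u * of_real (adj G i j * \<sigma> i * \<sigma> j))" if \<sigma>: "\<sigma> \<in> spins N" for \<sigma>
  proof -
    have diag: "(\<Sum>i=1..N. adj G i i * \<sigma> i * \<sigma> i) = loop_count N G"
      unfolding loop_count_def using spins_eq_sign[OF \<sigma>] by (intro sum.cong) fastforce+
    have form: "spin_form N G \<sigma> = loop_count N G + 2 * (\<Sum>(i, j)\<in>vertex_pairs N. adj G i j * \<sigma> i * \<sigma> j)"
      unfolding spin_form_def diag[symmetric]
      by (rule sum_symmetric_split) (simp add: adj_sym[of G] mult_ac)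
    have "exp (u * of_real (spin_form N G \<sigma>) / 2) =
        exp (u * of_real (loop_count N G) / 2) *
        exp (\<Sum>(i, j)\<in>vertex_pairs N. u * of_real (adj G i j * \<sigma> i * \<sigma> j))"
    proof -
      have half: "u * of_real (a + 2 * b) / 2 = u * of_real a / 2 + u * of_real b" for a b :: real
        by (simp add: algebra_simps)
      have "(\<Sum>(i, j)\<in>vertex_pairs N. u * of_real (adj G i j * \<sigma> i * \<sigma> j)) =
          u * of_real (\<Sum>(i, j)\<in>vertex_pairs N. adj G i j * \<sigma> i * \<sigma> j)"
        by (simp add: case_prod_unfold sum_distrib_left)
      then show ?thesis
        unfolding form exp_add[symmetric] half by simp
    qed
    also have "exp (\<Sum>(i, j)\<in>vertex_pairs N. u * of_real (adj G i j * \<sigma> i * \<sigma> j)) =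
        (\<Prod>(i, j)\<in>vertex_pairs N. (if G (i, j) then cosh u else 1) * (1 + tanh u * of_real (adj G i j * \<sigma> i * \<sigma> j)))"
      unfolding exp_sum[OF finite_vertex_pairs]
    proof (intro prod.cong refl)
      fix e assume "e \<in> vertex_pairs N"
      then obtain i j where e: "e = (i, j)" "i \<in> {1..N}" "j \<in> {1..N}" "i < j"
        by (auto simp: vertex_pairs_def)
      have sgn: "\<sigma> i * \<sigma> j = 1 \<or> \<sigma> i * \<sigma> j = -1"
        using spins_eq_sign[OF \<sigma> e(2)] spins_eq_sign[OF \<sigma> e(3)] by auto
      have "exp u = cosh u * (1 + tanh u)" "exp (- u) = cosh u * (1 - tanh u)"
        using u by (simp_all add: tanh_def cosh_plus_sinh[symmetric] cosh_minus_sinh[symmetric] field_simps)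
      from this show "exp (case e of (i, j) \<Rightarrow> u * of_real (adj G i j * \<sigma> i * \<sigma> j)) =
          (case e of (i, j) \<Rightarrow> (if G (i, j) then cosh u else 1) * (1 + tanh u * of_real (adj G i j * \<sigma> i * \<sigma> j)))"
      proof -
        have "adj G i j * \<sigma> i * \<sigma> j = of_bool (G (i, j)) * (\<sigma> i * \<sigma> j)"
          using e by (simp add: adj_def min_def max_def)
        then show ?thesis
          using sgn \<open>exp u = _\<close> \<open>exp (- u) = _\<close> unfolding e(1) prod.case by (elim disjE) simp_all
      qed
    qed
    also have "\<dots> = (\<Prod>e\<in>vertex_pairs N. if G e then cosh u else 1) *
        (\<Prod>(i, j)\<in>vertex_pairs N. 1 + tanh u * of_real (adj G i j * \<sigma> i * \<sigma> j))"
      by (simp add: case_prod_unfold prod.distrib)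
    also have "(\<Prod>e\<in>vertex_pairs N. if G e then cosh u else 1) = cosh u ^ edge_count N G"
      by (simp add: edge_count_def prod.If_cases Int_def)
    finally show ?thesis by simp
  qed
  then show ?thesis
    by (simp add: subgraph_sum_def sum_distrib_left[symmetric])
qed

lemma expectation_ising:
  fixes h :: "(nat \<Rightarrow> real) \<Rightarrow> complex"
  shows "measure_pmf.expectation (ising N \<theta> \<beta> G) h =
    (\<Sum>\<sigma>\<in>spins N. exp (of_real (- \<beta> * hamiltonian N \<theta> G \<sigma>)) * h \<sigma>) /
    (\<Sum>\<sigma>\<in>spins N. exp (of_real (- \<beta> * hamiltonian N \<theta> G \<sigma>)))"
proof -
  define Z where "Z = (\<Sum>\<sigma>\<in>spins N. exp (- \<beta> * hamiltonian N \<theta> G \<sigma>))"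
  have Z: "2 ^ N * partition_function N \<theta> \<beta> G = Z" by (simp add: Z_def partition_function_def)
  have "measure_pmf.expectation (ising N \<theta> \<beta> G) h = (\<Sum>\<sigma>\<in>spins N. pmf (ising N \<theta> \<beta> G) \<sigma> *\<^sub>R h \<sigma>)"
    by (rule integral_measure_pmf) (auto simp: set_pmf_iff pmf_ising ising_weight_def split: if_splits)
  also have "\<dots> = (\<Sum>\<sigma>\<in>spins N. exp (of_real (- \<beta> * hamiltonian N \<theta> G \<sigma>)) * h \<sigma> / of_real Z)"
    by (intro sum.cong refl)
       (simp add: pmf_ising ising_weight_def Z scaleR_conv_of_real exp_of_real[symmetric] del: exp_of_real)
  also have "\<dots> = (\<Sum>\<sigma>\<in>spins N. exp (of_real (- \<beta> * hamiltonian N \<theta> G \<sigma>)) * h \<sigma>) / of_real Z"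
    by (simp add: sum_divide_distrib)
  finally show ?thesis by (simp add: Z_def exp_of_real[symmetric] del: exp_of_real)
qed

text \<open>
  Given the graph, the estimator is a multiple of the spin form, so multiplying the Gibbs weight by the
  exponential shifts \<open>u\<close> along the imaginary axis. With the convention \<open>x / 0 = 0\<close> this remains true on
  the edgeless graph.
\<close>
lemma ising_char_beta_estimator:
  fixes s :: real
  assumes N: "N \<ge> 1" and \<theta>: "\<theta> > 0"
    and u: "u = of_real (\<beta> / (N * \<theta>))"
    and u': "u' = u + \<i> * of_real (2 * N * sqrt \<theta> * s / edge_sum N G)"
    and nz: "cosh u \<noteq> 0" "cosh u' \<noteq> 0"
  shows "measure_pmf.expectation (ising N \<theta> \<beta> G)
       (\<lambda>\<sigma>. iexp (s * (1 / sqrt \<theta> * (beta_estimator N \<theta> G \<sigma> - \<beta>)))) =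
     exp (- (\<i> * of_real (s * \<beta> / sqrt \<theta>))) * exp ((u' - u) * of_real (loop_count N G) / 2) *
     (cosh u' / cosh u) ^ edge_count N G * (subgraph_sum N G (tanh u') / subgraph_sum N G (tanh u))"
proof -
  have H: "- \<beta> * hamiltonian N \<theta> G \<sigma> = \<beta> / (N * \<theta>) * spin_form N G \<sigma> / 2" for \<sigma>
    by (simp add: hamiltonian_def spin_form_def)
  have X: "s * (1 / sqrt \<theta> * (beta_estimator N \<theta> G \<sigma> - \<beta>)) =
      2 * N * sqrt \<theta> * s / edge_sum N G * spin_form N G \<sigma> / 2 - s * \<beta> / sqrt \<theta>" for \<sigma>
  proof -
    have "beta_estimator N \<theta> G \<sigma> = N * \<theta> * spin_form N G \<sigma> / edge_sum N G"
      using N \<theta> by (simp add: beta_estimator_def hamiltonian_def spin_form_def edge_sum_def power2_eq_square)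
    moreover have "s * (1 / r * (n * r\<^sup>2 * S / E - \<beta>)) = 2 * n * r * s / E * S / 2 - s * \<beta> / r"
      if "r \<noteq> 0" for n r S E :: real
      using that by (cases "E = 0") (simp_all add: field_simps power2_eq_square)
    from this[of "sqrt \<theta>" N "spin_form N G \<sigma>" "edge_sum N G"]
    have "s * (1 / sqrt \<theta> * (N * \<theta> * spin_form N G \<sigma> / edge_sum N G - \<beta>)) =
        2 * N * sqrt \<theta> * s / edge_sum N G * spin_form N G \<sigma> / 2 - s * \<beta> / sqrt \<theta>"
      using \<theta> by simp
    ultimately show ?thesis by simp
  qed
  have numerator: "exp (of_real (- \<beta> * hamiltonian N \<theta> G \<sigma>)) * iexp (s * (1 / sqrt \<theta> * (beta_estimator N \<theta> G \<sigma> - \<beta>))) =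
      exp (- (\<i> * of_real (s * \<beta> / sqrt \<theta>))) * exp (u' * of_real (spin_form N G \<sigma>) / 2)" for \<sigma>
    unfolding H X u' u exp_add[symmetric]
    by (simp add: algebra_simps add_divide_distrib)
  have den: "exp (of_real (- \<beta> * hamiltonian N \<theta> G \<sigma>)) = exp (u * of_real (spin_form N G \<sigma>) / 2)" for \<sigma>
    unfolding H u by (simp only: of_real_mult of_real_divide of_real_numeral)
  have "exp ((u' - u) * of_real (loop_count N G) / 2) =
      exp (u' * of_real (loop_count N G) / 2) / exp (u * of_real (loop_count N G) / 2)"
    by (simp add: exp_diff[symmetric] left_diff_distrib diff_divide_distrib)
  then show ?thesis
    unfolding expectation_ising
    unfolding numerator
    unfolding sum_distrib_left[symmetric] den
    unfolding sum_spins_exp_form[OF nz(1)] sum_spins_exp_form[OF nz(2)]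
    by (simp add: power_divide mult.assoc)
qed

section \<open>Moments over the random graph\<close>

definition edge_slots :: "nat \<Rightarrow> (nat \<times> nat) set" where
  "edge_slots N = {(i, j). 1 \<le> i \<and> i \<le> j \<and> j \<le> N}"

definition edge_prob :: "nat \<Rightarrow> real \<Rightarrow> (real \<Rightarrow> real \<Rightarrow> real) \<Rightarrow> nat \<times> nat \<Rightarrow> real" where
  "edge_prob N \<theta> W e = \<theta> * W (real (fst e) / real N) (real (snd e) / real N)"

lemma finite_edge_slots [simp]: "finite (edge_slots N)"
  by (rule finite_subset[of _ "{1..N} \<times> {1..N}"]) (auto simp: edge_slots_def)

lemma random_graph_eq:
  "random_graph N \<theta> W = Pi_pmf (edge_slots N) False (\<lambda>e. bernoulli_pmf (edge_prob N \<theta> W e))"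
  by (simp add: random_graph_def edge_slots_def edge_prob_def[abs_def] case_prod_unfold)

lemma graphon_grid_value:
  assumes "graphon W" "i \<in> {1..N}" "j \<in> {1..N}"
  shows "W (real i / real N) (real j / real N) \<in> {0..1}"
  using assms by (auto simp: graphon_def)

lemma edge_prob_range:
  assumes "graphon W" "0 < \<theta>" "\<theta> < 1" "e \<in> edge_slots N"
  shows "0 \<le> edge_prob N \<theta> W e" "edge_prob N \<theta> W e \<le> \<theta>" "edge_prob N \<theta> W e \<le> 1"
proof -
  have "W (real (fst e) / real N) (real (snd e) / real N) \<in> {0..1}"
    using assms(4) by (intro graphon_grid_value[OF assms(1)]) (auto simp: edge_slots_def)
  then show "0 \<le> edge_prob N \<theta> W e" and le: "edge_prob N \<theta> W e \<le> \<theta>"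
    using assms(2) by (auto simp: edge_prob_def mult_left_le)
  with assms(3) show "edge_prob N \<theta> W e \<le> 1" by simp
qed

lemma finite_set_random_graph [simp]: "finite (set_pmf (random_graph N \<theta> W))"
  unfolding random_graph_eq by (subst set_Pi_pmf) (auto intro!: finite_PiE_dflt)

lemma integrable_random_graph [simp]:
  "integrable (measure_pmf (random_graph N \<theta> W)) (f :: _ \<Rightarrow> 'b::{banach, second_countable_topology})"
  by (rule integrable_measure_pmf_finite) simp

lemma random_graph_expectation_prod:
  assumes W: "graphon W" and \<theta>: "0 < \<theta>" "\<theta> < 1"
    and S: "S \<subseteq> edge_slots N" and f: "\<And>e b. e \<in> S \<Longrightarrow> 0 \<le> f e b"
  shows "measure_pmf.expectation (random_graph N \<theta> W) (\<lambda>G. \<Prod>e\<in>S. f e (G e)) =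
    (\<Prod>e\<in>S. edge_prob N \<theta> W e * f e True + (1 - edge_prob N \<theta> W e) * f e False)"
proof -
  define g where "g e b = (if e \<in> S then f e b else 1)" for e b
  have restrict: "(\<Prod>e\<in>edge_slots N. if e \<in> S then h e else 1) = (\<Prod>e\<in>S. h e)" for h :: "nat \<times> nat \<Rightarrow> real"
    using S by (simp add: prod.If_cases Int_absorb1)
  have "measure_pmf.expectation (random_graph N \<theta> W) (\<lambda>G. \<Prod>e\<in>S. f e (G e)) =
      measure_pmf.expectation (random_graph N \<theta> W) (\<lambda>G. \<Prod>e\<in>edge_slots N. g e (G e))"
    by (simp add: g_def restrict)
  also have "\<dots> = (\<Prod>e\<in>edge_slots N. measure_pmf.expectation (bernoulli_pmf (edge_prob N \<theta> W e)) (g e))"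
    unfolding random_graph_eq
    by (rule expectation_prod_Pi_pmf) (auto simp: g_def f intro!: integrable_measure_pmf_finite)
  also have "\<dots> = (\<Prod>e\<in>edge_slots N. if e \<in> S then
      edge_prob N \<theta> W e * f e True + (1 - edge_prob N \<theta> W e) * f e False else 1)"
    using edge_prob_range[OF W \<theta>] by (intro prod.cong refl) (auto simp: g_def)
  finally show ?thesis by (simp add: restrict)
qed

lemma random_graph_edge_mean:
  assumes "graphon W" "0 < \<theta>" "\<theta> < 1" "e \<in> edge_slots N"
  shows "measure_pmf.expectation (random_graph N \<theta> W) (\<lambda>G. of_bool (G e)) = edge_prob N \<theta> W e"
  using random_graph_expectation_prod[OF assms(1-3), of "{e}" N "\<lambda>_ b. of_bool b"] assms(4) by simp

lemma random_graph_edge_pair_mean: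
  assumes "graphon W" "0 < \<theta>" "\<theta> < 1" "e \<in> edge_slots N" "e' \<in> edge_slots N"
  shows "measure_pmf.expectation (random_graph N \<theta> W) (\<lambda>G. of_bool (G e) * of_bool (G e')) =
    (if e = e' then edge_prob N \<theta> W e else edge_prob N \<theta> W e * edge_prob N \<theta> W e')"
proof (cases "e = e'")
  case True
  then show ?thesis using random_graph_edge_mean[OF assms(1-4)] by (simp flip: of_bool_conj)
next
  case False
  then show ?thesis
    using random_graph_expectation_prod[OF assms(1-3), of "{e, e'}" N "\<lambda>_ b. of_bool b"] assms(4,5) by simp
qed

text \<open>
  The indicators of different edges are uncorrelated, and each has variance at most its mean, hence at
  most \<open>\<theta>\<close>.
\<close>
lemma random_graph_weighted_variance:
  fixes c :: "nat \<times> nat \<Rightarrow> real" and N :: nat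
  assumes W: "graphon W" and \<theta>: "0 < \<theta>" "\<theta> < 1"
  defines "\<mu> \<equiv> (\<Sum>e\<in>edge_slots N. c e * edge_prob N \<theta> W e)"
  shows "measure_pmf.expectation (random_graph N \<theta> W) (\<lambda>G. ((\<Sum>e\<in>edge_slots N. c e * of_bool (G e)) - \<mu>)\<^sup>2) \<le>
    \<theta> * (\<Sum>e\<in>edge_slots N. (c e)\<^sup>2)"
proof -
  let ?E = "measure_pmf.expectation (random_graph N \<theta> W)"
  let ?p = "edge_prob N \<theta> W"
  define X where "X G = (\<Sum>e\<in>edge_slots N. c e * of_bool (G e))" for G
  have X1: "?E X = \<mu>"
    unfolding X_def[abs_def] \<mu>_def
    by (subst Bochner_Integration.integral_sum) (simp_all add: random_graph_edge_mean[OF W \<theta>])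
  have "?E (\<lambda>G. (X G)\<^sup>2) = ?E (\<lambda>G. \<Sum>e\<in>edge_slots N. \<Sum>e'\<in>edge_slots N. c e * c e' * (of_bool (G e) * of_bool (G e')))"
    unfolding X_def power2_eq_square sum_product by (simp add: mult_ac)
  also have "\<dots> = (\<Sum>e\<in>edge_slots N. \<Sum>e'\<in>edge_slots N. c e * c e' * ?E (\<lambda>G. of_bool (G e) * of_bool (G e')))"
    by (simp add: Bochner_Integration.integral_sum)
  also have "\<dots> = (\<Sum>e\<in>edge_slots N. \<Sum>e'\<in>edge_slots N. c e * ?p e * (c e' * ?p e') +
      (if e' = e then (c e)\<^sup>2 * (?p e - (?p e)\<^sup>2) else 0))"
    by (intro sum.cong refl) (simp add: random_graph_edge_pair_mean[OF W \<theta>] power2_eq_square algebra_simps)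
  also have "\<dots> = \<mu>\<^sup>2 + (\<Sum>e\<in>edge_slots N. (c e)\<^sup>2 * (?p e - (?p e)\<^sup>2))"
    by (simp add: sum.distrib \<mu>_def power2_eq_square[of "sum _ _"] sum_product)
  finally have X2: "?E (\<lambda>G. (X G)\<^sup>2) = \<mu>\<^sup>2 + (\<Sum>e\<in>edge_slots N. (c e)\<^sup>2 * (?p e - (?p e)\<^sup>2))" .
  have "?E (\<lambda>G. (X G - \<mu>)\<^sup>2) = ?E (\<lambda>G. (X G)\<^sup>2 - 2 * \<mu> * X G + \<mu>\<^sup>2)"
    by (simp add: power2_diff algebra_simps)
  also have "\<dots> = ?E (\<lambda>G. (X G)\<^sup>2) - 2 * \<mu> * ?E X + \<mu>\<^sup>2"
    by (simp add: Bochner_Integration.integral_add Bochner_Integration.integral_diff)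
  also have "\<dots> = (\<Sum>e\<in>edge_slots N. (c e)\<^sup>2 * (?p e - (?p e)\<^sup>2))"
    unfolding X1 X2 by (simp add: power2_eq_square)
  also have "\<dots> \<le> (\<Sum>e\<in>edge_slots N. (c e)\<^sup>2 * \<theta>)"
    using edge_prob_range(2)[OF W \<theta>] by (intro sum_mono mult_left_mono) (auto simp: diff_le_eq add_increasing2)
  finally show ?thesis by (simp add: X_def sum_distrib_left mult.commute)
qed

lemma sum_grid_eq_edge_slots:
  fixes f :: "nat \<Rightarrow> nat \<Rightarrow> real"
  assumes "\<And>i j. i \<in> {1..N} \<Longrightarrow> j \<in> {1..N} \<Longrightarrow> f i j = f j i"
  shows "(\<Sum>i=1..N. \<Sum>j=1..N. f i j) = (\<Sum>e\<in>edge_slots N. (if fst e = snd e then 1 else 2) * f (fst e) (snd e))"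
proof -
  define g where "g i j = (if i \<in> {1..N} \<and> j \<in> {1..N} then f i j else 0)" for i j
  have "(\<Sum>i=1..N. \<Sum>j=1..N. f i j) = (\<Sum>i=1..N. \<Sum>j=1..N. g i j)"
    by (intro sum.cong) (auto simp: g_def)
  also have "\<dots> = (\<Sum>i=1..N. g i i) + 2 * (\<Sum>(i, j)\<in>vertex_pairs N. g i j)"
    by (rule sum_symmetric_split) (auto simp: g_def assms)
  also have "(\<Sum>i=1..N. g i i) = (\<Sum>e\<in>(\<lambda>i. (i, i)) ` {1..N}. (if fst e = snd e then 1 else 2) * f (fst e) (snd e))"
    by (subst sum.reindex) (auto simp: inj_on_def g_def)
  also have "2 * (\<Sum>(i, j)\<in>vertex_pairs N. g i j) =
      (\<Sum>e\<in>vertex_pairs N. (if fst e = snd e then 1 else 2) * f (fst e) (snd e))"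
    unfolding sum_distrib_left by (intro sum.cong) (auto simp: g_def vertex_pairs_def)
  also have "(\<Sum>e\<in>(\<lambda>i. (i, i)) ` {1..N}. (if fst e = snd e then 1 else 2) * f (fst e) (snd e)) + \<dots> =
      (\<Sum>e\<in>(\<lambda>i. (i, i)) ` {1..N} \<union> vertex_pairs N. (if fst e = snd e then 1 else 2) * f (fst e) (snd e))"
    by (rule sum.union_disjoint[symmetric]) (simp, simp, auto simp: vertex_pairs_def)
  also have "(\<lambda>i. (i, i)) ` {1..N} \<union> vertex_pairs N = edge_slots N"
    by (auto simp: vertex_pairs_def edge_slots_def image_iff)
  finally show ?thesis .
qed

lemma random_graph_edge_sum_variance:
  fixes N :: nat
  assumes W: "graphon W" and \<theta>: "0 < \<theta>" "\<theta> < 1"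
  defines "\<mu> \<equiv> \<theta> * (\<Sum>i=1..N. \<Sum>j=1..N. W (real i / real N) (real j / real N))"
  shows "measure_pmf.expectation (random_graph N \<theta> W) (\<lambda>G. (edge_sum N G - \<mu>)\<^sup>2) \<le> 4 * (real N)\<^sup>2 * \<theta>"
proof -
  define c :: "nat \<times> nat \<Rightarrow> real" where "c e = (if fst e = snd e then 1 else 2)" for e
  have "W (real i / real N) (real j / real N) = W (real j / real N) (real i / real N)"
    if "i \<in> {1..N}" "j \<in> {1..N}" for i j
    using W that by (auto simp: graphon_def)
  then have \<mu>: "\<mu> = (\<Sum>e\<in>edge_slots N. c e * edge_prob N \<theta> W e)"
    unfolding \<mu>_def by (subst sum_grid_eq_edge_slots) (auto simp: c_def edge_prob_def sum_distrib_left mult_ac)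
  have edge: "edge_sum N G = (\<Sum>e\<in>edge_slots N. c e * of_bool (G e))" for G
    unfolding edge_sum_def
    by (subst sum_grid_eq_edge_slots[OF adj_sym])
       (auto simp: c_def adj_def edge_slots_def min_def max_def intro!: sum.cong)
  have "measure_pmf.expectation (random_graph N \<theta> W) (\<lambda>G. (edge_sum N G - \<mu>)\<^sup>2) \<le> \<theta> * (\<Sum>e\<in>edge_slots N. (c e)\<^sup>2)"
    unfolding edge \<mu> by (rule random_graph_weighted_variance[OF W \<theta>])
  also have "(\<Sum>e\<in>edge_slots N. (c e)\<^sup>2) \<le> (\<Sum>e\<in>edge_slots N. 4)"
    by (intro sum_mono) (auto simp: c_def)
  also have "\<dots> \<le> 4 * (real N)\<^sup>2"
  proof -
    have "card (edge_slots N) \<le> card ({1..N} \<times> {1..N})"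
      by (intro card_mono) (auto simp: edge_slots_def)
    then have "real (card (edge_slots N)) \<le> real (N * N)" by (subst of_nat_le_iff) simp
    then show ?thesis by (simp add: power2_eq_square)
  qed
  finally show ?thesis using \<theta>(1) by (simp add: mult_left_mono mult.commute)
qed

lemma random_graph_loop_mean:
  assumes W: "graphon W" and \<theta>: "0 < \<theta>" "\<theta> < 1"
  shows "measure_pmf.expectation (random_graph N \<theta> W) (loop_count N) \<le> N * \<theta>"
proof -
  have "measure_pmf.expectation (random_graph N \<theta> W) (loop_count N) =
      (\<Sum>i=1..N. measure_pmf.expectation (random_graph N \<theta> W) (\<lambda>G. of_bool (G (i, i))))"
    unfolding loop_count_def[abs_def] adj_def by (subst Bochner_Integration.integral_sum) simp_all
  also have "\<dots> \<le> (\<Sum>i=1..N. \<theta>)"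
    by (intro sum_mono) (auto simp: random_graph_edge_mean[OF W \<theta>] edge_slots_def intro!: edge_prob_range(2)[OF W \<theta>])
  finally show ?thesis by simp
qed

text \<open>
  For fixed spins the expectation over the graph replaces \<open>A\<^sub>i\<^sub>j\<close> by \<open>\<theta> W(i/N, j/N)\<close>, so that \<open>\<theta>\<close> cancels
  against the argument \<open>\<gamma> / (N \<theta>)\<close>. The inequality \<open>1 + x \<le> exp x\<close> then leads to the exponential moment
  of \<open>rademacher_quadratic_exp_bound\<close>. The trace term of that bound is compensated by the diagonal that
  is missing from the product.
\<close>
lemma random_graph_subgraph_sum_mean:
  assumes W: "graphon W" and \<theta>: "0 < \<theta>" "\<theta> < 1" and N: "N \<ge> 1"
    and g: "0 < \<gamma>" "\<gamma> / (N * \<theta>) \<le> 1" and \<rho>: "0 \<le> \<rho>" "\<rho> < 1"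
    and form: "\<And>x. (\<Sum>i=1..N. \<Sum>j=1..N. \<gamma> * W (real i / N) (real j / N) / N * x i * x j) \<le> \<rho> * (\<Sum>i=1..N. (x i)\<^sup>2)"
  shows "measure_pmf.expectation (random_graph N \<theta> W) (\<lambda>G. subgraph_sum N G (\<gamma> / (N * \<theta>))) \<le> exp (\<gamma>\<^sup>2 / (4 * (1 - \<rho>)))"
proof -
  let ?E = "measure_pmf.expectation (random_graph N \<theta> W)"
  define R where "R = \<gamma> / (N * \<theta>)"
  have R: "0 \<le> R" "R \<le> 1" using g \<theta> by (auto simp: R_def)
  \<comment> \<open>the values of \<open>W\<close> outside the unit square are arbitrary, so \<open>M\<close> is cut off there\<close>
  define M where "M i j = (if i \<in> {1..N} \<and> j \<in> {1..N} then \<gamma> * W (real i / N) (real j / N) / N else 0)" for i j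
  have M_sym: "M i j = M j i" for i j using W by (auto simp: M_def graphon_def)
  have M_range: "0 \<le> M i j" "M i j \<le> \<gamma> / N" for i j
    using graphon_grid_value[OF W] g(1) by (auto simp: M_def intro!: divide_right_mono mult_left_le)
  define T where "T = (\<Sum>i=1..N. M i i)"
  define Q where "Q \<sigma> = (\<Sum>i=1..N. \<Sum>j=1..N. M i j * \<sigma> i * \<sigma> j)" for \<sigma>
  have edge: "?E (\<lambda>G. \<Prod>(i, j)\<in>vertex_pairs N. 1 + R * (adj G i j * \<sigma> i * \<sigma> j)) \<le> exp ((Q \<sigma> - T) / 2)"
    if \<sigma>: "\<sigma> \<in> spins N" for \<sigma>
  proof -
    have sgn: "\<sigma> (fst e) * \<sigma> (snd e) = 1 \<or> \<sigma> (fst e) * \<sigma> (snd e) = -1" if "e \<in> vertex_pairs N" for e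
      using spins_eq_sign[OF \<sigma>, of "fst e"] spins_eq_sign[OF \<sigma>, of "snd e"] that by (auto simp: vertex_pairs_def)
    have sub: "vertex_pairs N \<subseteq> edge_slots N" by (auto simp: vertex_pairs_def edge_slots_def)
    define f where "f e b = 1 + R * (of_bool b * (\<sigma> (fst e) * \<sigma> (snd e)))" for e b
    have f0: "0 \<le> f e b" if "e \<in> vertex_pairs N" for e b
      using sgn[OF that] R by (auto simp: f_def of_bool_def)
    have "?E (\<lambda>G. \<Prod>(i, j)\<in>vertex_pairs N. 1 + R * (adj G i j * \<sigma> i * \<sigma> j)) = ?E (\<lambda>G. \<Prod>e\<in>vertex_pairs N. f e (G e))"
      by (intro arg_cong[of _ _ ?E] ext prod.cong refl)
         (auto simp: f_def adj_def vertex_pairs_def min_def max_def)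
    also have "\<dots> = (\<Prod>e\<in>vertex_pairs N. edge_prob N \<theta> W e * f e True + (1 - edge_prob N \<theta> W e) * f e False)"
      by (rule random_graph_expectation_prod[OF W \<theta> sub f0])
    also have "\<dots> = (\<Prod>e\<in>vertex_pairs N. 1 + M (fst e) (snd e) * \<sigma> (fst e) * \<sigma> (snd e))"
    proof (intro prod.cong refl)
      fix e assume "e \<in> vertex_pairs N"
      then have "R * edge_prob N \<theta> W e = M (fst e) (snd e)"
        using \<theta> by (auto simp: R_def edge_prob_def M_def vertex_pairs_def)
      then show "edge_prob N \<theta> W e * f e True + (1 - edge_prob N \<theta> W e) * f e False =
          1 + M (fst e) (snd e) * \<sigma> (fst e) * \<sigma> (snd e)"
        by (simp add: f_def algebra_simps)
    qed
    also have "\<dots> \<le> (\<Prod>e\<in>vertex_pairs N. exp (M (fst e) (snd e) * \<sigma> (fst e) * \<sigma> (snd e)))"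
    proof (intro prod_mono conjI exp_ge_add_one_self)
      fix e assume e: "e \<in> vertex_pairs N"
      have "M (fst e) (snd e) \<le> \<gamma> / N" by (rule M_range)
      also have "\<dots> \<le> \<gamma> / (N * \<theta>)" using g(1) \<theta> N by (intro divide_left_mono) auto
      also have "\<dots> \<le> 1" by (rule g(2))
      finally show "0 \<le> 1 + M (fst e) (snd e) * \<sigma> (fst e) * \<sigma> (snd e)"
        using sgn[OF e] M_range(1)[of "fst e" "snd e"] by (auto simp: mult.assoc)
    qed
    also have "\<dots> = exp (\<Sum>(i, j)\<in>vertex_pairs N. M i j * \<sigma> i * \<sigma> j)"
      by (simp add: exp_sum case_prod_unfold)
    also have "(\<Sum>(i, j)\<in>vertex_pairs N. M i j * \<sigma> i * \<sigma> j) = (Q \<sigma> - T) / 2"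
    proof -
      have "(\<Sum>i=1..N. M i i * \<sigma> i * \<sigma> i) = T"
        unfolding T_def using spins_eq_sign[OF \<sigma>] by (intro sum.cong) fastforce+
      moreover have "Q \<sigma> = (\<Sum>i=1..N. M i i * \<sigma> i * \<sigma> i) + 2 * (\<Sum>(i, j)\<in>vertex_pairs N. M i j * \<sigma> i * \<sigma> j)"
        unfolding Q_def by (rule sum_symmetric_split) (simp add: M_sym mult_ac)
      ultimately show ?thesis by simp
    qed
    finally show ?thesis .
  qed
  have Frob: "(\<Sum>i=1..N. \<Sum>j=1..N. (M i j)\<^sup>2) \<le> \<gamma>\<^sup>2"
  proof -
    have "(\<Sum>i=1..N. \<Sum>j=1..N. (M i j)\<^sup>2) \<le> (\<Sum>i=1..N. \<Sum>j=1..N. (\<gamma> / N)\<^sup>2)"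
      using M_range by (intro sum_mono power_mono) auto
    also have "\<dots> = \<gamma>\<^sup>2" using N by (simp add: power2_eq_square)
    finally show ?thesis .
  qed
  have "(\<Sum>\<sigma>\<in>spins N. exp (Q \<sigma> / 2)) \<le>
      2 ^ card {1..N} * exp (T / 2 + (\<Sum>i=1..N. \<Sum>j=1..N. (M i j)\<^sup>2) / (4 * (1 - \<rho>)))"
    unfolding spins_def Q_def T_def
  proof (rule rademacher_quadratic_exp_bound)
    fix x
    have "(\<Sum>i=1..N. \<Sum>j=1..N. M i j * x i * x j) =
        (\<Sum>i=1..N. \<Sum>j=1..N. \<gamma> * W (real i / N) (real j / N) / N * x i * x j)"
      by (intro sum.cong refl) (simp add: M_def)
    with form[of x] show "(\<Sum>i=1..N. \<Sum>j=1..N. M i j * x i * x j) \<le> \<rho> * (\<Sum>i=1..N. (x i)\<^sup>2)" by simp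
  qed (use \<rho> M_sym M_range in auto)
  also have "\<dots> \<le> 2 ^ N * exp (T / 2 + \<gamma>\<^sup>2 / (4 * (1 - \<rho>)))"
    using Frob \<rho> by (simp add: divide_right_mono)
  finally have quad: "(\<Sum>\<sigma>\<in>spins N. exp (Q \<sigma> / 2)) \<le> 2 ^ N * exp (T / 2 + \<gamma>\<^sup>2 / (4 * (1 - \<rho>)))" .
  have "?E (\<lambda>G. subgraph_sum N G R) =
      (\<Sum>\<sigma>\<in>spins N. ?E (\<lambda>G. \<Prod>(i, j)\<in>vertex_pairs N. 1 + R * (adj G i j * \<sigma> i * \<sigma> j))) / 2 ^ N"
    unfolding subgraph_sum_def by (simp add: Bochner_Integration.integral_sum)
  also have "\<dots> \<le> (\<Sum>\<sigma>\<in>spins N. exp ((Q \<sigma> - T) / 2)) / 2 ^ N"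
    by (intro divide_right_mono sum_mono edge) auto
  also have "(\<Sum>\<sigma>\<in>spins N. exp ((Q \<sigma> - T) / 2)) = (\<Sum>\<sigma>\<in>spins N. exp (Q \<sigma> / 2)) * exp (- T / 2)"
    unfolding sum_distrib_right exp_add[symmetric] by (simp add: diff_divide_distrib)
  also have "\<dots> / 2 ^ N \<le> 2 ^ N * exp (T / 2 + \<gamma>\<^sup>2 / (4 * (1 - \<rho>))) * exp (- T / 2) / 2 ^ N"
    by (intro divide_right_mono mult_right_mono quad) auto
  also have "\<dots> = exp (\<gamma>\<^sup>2 / (4 * (1 - \<rho>)))"
    by (simp add: mult.assoc flip: exp_add)
  finally show ?thesis by (simp add: R_def)
qed

section \<open>Hyperbolic functions near the origin\<close>

lemma norm_cosh_le:
  assumes "norm (z :: complex) \<le> 1"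
  shows "norm (cosh z) \<le> 3"
proof -
  have e: "norm (exp w) \<le> 3" if "norm w \<le> 1" for w :: complex
    using norm_exp[of w] exp_le that by (meson exp_le_cancel_iff order_trans)
  have "norm (cosh z) = norm (exp z + exp (- z)) / 2"
    by (simp add: cosh_def)
  also have "\<dots> \<le> (norm (exp z) + norm (exp (- z))) / 2"
    by (intro divide_right_mono norm_triangle_ineq) simp
  also have "\<dots> \<le> 3" using e[of z] e[of "- z"] assms by simp
  finally show ?thesis .
qed

lemma norm_sinh_le:
  assumes "norm (z :: complex) \<le> 1"
  shows "norm (sinh z) \<le> 3 * norm z"
proof -
  have "norm (sinh z - sinh 0) \<le> 3 * norm (z - 0)"
    by (rule field_differentiable_bound[of "cball 0 1" sinh cosh 3 z 0])
       (use assms norm_cosh_le in \<open>auto intro!: derivative_eq_intros\<close>)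
  then show ?thesis by simp
qed

text \<open>
  The function \<open>sinh z - z cosh z\<close> has derivative \<open>- z sinh z\<close>, which is of second order at 0.
\<close>
lemma norm_sinh_minus_cosh_le:
  assumes "norm (z :: complex) \<le> 1"
  shows "norm (sinh z - z * cosh z) \<le> 3 * norm z ^ 3"
proof -
  have "norm ((sinh z - z * cosh z) - (sinh 0 - 0 * cosh 0)) \<le> 3 * (norm z)\<^sup>2 * norm (z - 0)"
  proof (rule field_differentiable_bound[of "cball 0 (norm z)" "\<lambda>z. sinh z - z * cosh z" "\<lambda>w. - (w * sinh w)" "3 * (norm z)\<^sup>2" z 0])
    fix w :: complex assume "w \<in> cball 0 (norm z)"
    then have w: "norm w \<le> norm z" by simp
    have "norm (- (w * sinh w)) \<le> norm w * (3 * norm w)"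
      using norm_sinh_le[of w] w assms by (simp add: norm_mult mult_left_mono)
    also have "\<dots> \<le> norm z * (3 * norm z)" using w by (intro mult_mono) auto
    finally show "norm (- (w * sinh w)) \<le> 3 * (norm z)\<^sup>2" by (simp add: power2_eq_square)
  qed (auto intro!: derivative_eq_intros)
  then show ?thesis by (simp add: power2_eq_square power3_eq_cube mult.assoc)
qed

text \<open>
  Dividing \<open>cosh\<close> by \<open>exp (z\<^sup>2 / 2)\<close> removes the quadratic term of its logarithm, so that this function agrees
  with 1 to third order at 0.
\<close>
definition flat_cosh :: "complex \<Rightarrow> complex" where
  "flat_cosh z = cosh z * exp (- (z\<^sup>2 / 2))"

lemma flat_cosh_lipschitz:
  assumes "norm z \<le> B" "norm w \<le> B" "B \<le> 1"
  shows "norm (flat_cosh z - flat_cosh w) \<le> 6 * B ^ 3 * norm (z - w)"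
proof (rule field_differentiable_bound[of "cball 0 B" flat_cosh "\<lambda>z. (sinh z - z * cosh z) * exp (- (z\<^sup>2 / 2))" "6 * B ^ 3" z w])
  fix v :: complex assume "v \<in> cball 0 B"
  then have v: "norm v \<le> B" by simp
  have "norm (exp (- (v\<^sup>2 / 2))) \<le> exp (norm (- (v\<^sup>2 / 2)))" by (rule norm_exp)
  also have "\<dots> \<le> exp (1 / 2)"
    using v assms(3) by (simp add: norm_divide norm_power power_le_one)
  also have "\<dots> \<le> 2" using exp_bound_half[of "1 / 2 :: real"] by simp
  finally have e: "norm (exp (- (v\<^sup>2 / 2))) \<le> 2" .
  have "norm ((sinh v - v * cosh v) * exp (- (v\<^sup>2 / 2))) \<le> 3 * norm v ^ 3 * 2"
    unfolding norm_mult using v assms(3) by (intro mult_mono norm_sinh_minus_cosh_le e) auto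
  also have "\<dots> \<le> 3 * B ^ 3 * 2" using power_mono[OF v norm_ge_zero, of 3] by simp
  finally show "norm ((sinh v - v * cosh v) * exp (- (v\<^sup>2 / 2))) \<le> 6 * B ^ 3" by simp
  show "(flat_cosh has_field_derivative (sinh v - v * cosh v) * exp (- (v\<^sup>2 / 2))) (at v within cball 0 B)"
    unfolding flat_cosh_def[abs_def]
    by (auto intro!: derivative_eq_intros simp: algebra_simps)
qed (use assms in auto)

lemma flat_cosh_ratio:
  assumes x: "\<bar>x\<bar> \<le> B" and z: "norm z \<le> B" and B: "B \<le> 1"
  shows "norm (flat_cosh z / flat_cosh (of_real x) - 1) \<le> 12 * B ^ 3 * norm (z - of_real x)"
proof -
  have "x\<^sup>2 \<le> 1" using x B by (simp add: abs_square_le_1)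
  then have "exp (- (1 / 2)) \<le> exp (- (x\<^sup>2 / 2))" by simp
  also have "\<dots> \<le> cosh x * exp (- (x\<^sup>2 / 2))" using cosh_real_ge_1[of x] by (simp add: mult_le_cancel_right1)
  also have "\<dots> = norm (flat_cosh (of_real x))"
  proof -
    have "flat_cosh (of_real x) = of_real (cosh x * exp (- (x\<^sup>2 / 2)))"
      by (simp add: flat_cosh_def cosh_def scaleR_conv_of_real exp_of_real[symmetric] del: exp_of_real)
    then show ?thesis by (simp add: norm_mult)
  qed
  finally have low: "exp (- (1 / 2)) \<le> norm (flat_cosh (of_real x))" .
  have half: "1 / 2 \<le> exp (- (1 / 2) :: real)" using exp_ge_add_one_self[of "- (1 / 2) :: real"] by simp
  then have pos: "1 / 2 \<le> norm (flat_cosh (of_real x))" using low by simp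
  then have nz: "flat_cosh (of_real x) \<noteq> 0" by auto
  have "norm (flat_cosh z / flat_cosh (of_real x) - 1) = norm (flat_cosh z - flat_cosh (of_real x)) / norm (flat_cosh (of_real x))"
    using nz by (simp add: norm_divide[symmetric] diff_divide_distrib)
  also have "\<dots> \<le> (6 * B ^ 3 * norm (z - of_real x)) / (1 / 2)"
    using x z B pos by (intro frac_le flat_cosh_lipschitz) (auto intro: order_trans[OF abs_ge_zero[of x]])
  finally show ?thesis by simp
qed

lemma norm_cosh_ge:
  assumes "norm (z :: complex) \<le> 1 / 2"
  shows "1 / 4 \<le> norm (cosh z)"
proof -
  have "norm (cosh z - cosh 0) \<le> 3 / 2 * norm (z - 0)"
  proof (rule field_differentiable_bound[of "cball 0 (1 / 2)" cosh sinh "3 / 2" z 0])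
    fix w :: complex assume "w \<in> cball 0 (1 / 2)"
    then show "norm (sinh w) \<le> 3 / 2" using norm_sinh_le[of w] by simp
  qed (use assms in \<open>auto intro!: derivative_eq_intros\<close>)
  then have "norm (1 - cosh z) \<le> 3 / 4" using assms by (simp add: norm_minus_commute)
  then show ?thesis using norm_triangle_ineq2[of 1 "cosh z"] by simp
qed

lemma tanh_lipschitz:
  assumes "norm (z :: complex) \<le> 1 / 2" "norm w \<le> 1 / 2"
  shows "norm (tanh z - tanh w) \<le> 16 * norm (z - w)"
proof (rule field_differentiable_bound[of "cball 0 (1 / 2)" tanh "\<lambda>z. 1 / (cosh z)\<^sup>2" 16 z w])
  fix v :: complex assume "v \<in> cball 0 (1 / 2)"
  then have v: "1 / 4 \<le> norm (cosh v)" using norm_cosh_ge[of v] by simp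
  then have nz: "cosh v \<noteq> 0" by auto
  have "(1 / 4)\<^sup>2 \<le> (norm (cosh v))\<^sup>2" using v by (intro power_mono) auto
  then have sq: "1 / 16 \<le> (norm (cosh v))\<^sup>2" by (simp add: power2_eq_square)
  then have "1 / (norm (cosh v))\<^sup>2 \<le> 1 / (1 / 16)" by (intro divide_left_mono) (auto intro: mult_pos_pos nz)
  then show "norm (1 / (cosh v)\<^sup>2) \<le> 16" by (simp add: norm_divide norm_power)
  have "1 - (tanh v)\<^sup>2 = 1 / (cosh v)\<^sup>2"
    using nz by (simp add: tanh_def power_divide diff_divide_eq_iff sinh_square_eq)
  then show "(tanh has_field_derivative 1 / (cosh v)\<^sup>2) (at v within cball 0 (1 / 2))"
    using nz by (auto intro!: derivative_eq_intros)
qed (use assms in auto)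

lemma norm_power_minus_one_le:
  "norm ((z :: complex) ^ m - 1) \<le> exp (m * norm (z - 1)) - 1"
proof (induction m)
  case (Suc m)
  define d where "d = norm (z - 1)"
  have zd: "norm z \<le> 1 + d" using norm_triangle_ineq[of 1 "z - 1"] by (simp add: d_def)
  have step: "z ^ Suc m - 1 = z * (z ^ m - 1) + (z - 1)" by (simp add: algebra_simps)
  have "norm (z ^ Suc m - 1) \<le> norm z * norm (z ^ m - 1) + d"
    unfolding step d_def norm_mult[symmetric] by (rule norm_triangle_ineq)
  also have "\<dots> \<le> (1 + d) * (exp (m * d) - 1) + d"
    using Suc.IH zd by (intro add_right_mono mult_mono) (auto simp: d_def)
  also have "\<dots> = (1 + d) * exp (m * d) - 1" by (simp add: algebra_simps)
  also have "\<dots> \<le> exp d * exp (m * d) - 1" by simp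
  also have "\<dots> = exp (Suc m * d) - 1" by (simp add: exp_add[symmetric] algebra_simps)
  finally show ?case by (simp add: d_def)
qed simp

section \<open>Convergence in probability\<close>

text \<open>
  The filter of the events whose complements have vanishing probability. A limit along it is a limit in
  probability, so that the rules for limits of sums, quotients and continuous functions apply to random
  quantities.
\<close>
definition in_probability :: "(nat \<Rightarrow> 'a pmf) \<Rightarrow> (nat \<times> 'a) filter" where
  "in_probability p = Abs_filter (\<lambda>P. (\<lambda>N. measure_pmf.prob (p N) {x. \<not> P (N, x)}) \<longlonglongrightarrow> 0)"

lemma eventually_in_probability:
  "eventually P (in_probability p) \<longleftrightarrow> (\<lambda>N. measure_pmf.prob (p N) {x. \<not> P (N, x)}) \<longlonglongrightarrow> 0"
  unfolding in_probability_def
proof (rule eventually_Abs_filter, rule is_filter.intro)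
  show "(\<lambda>N. measure_pmf.prob (p N) {x. \<not> True}) \<longlonglongrightarrow> 0" by simp
next
  fix P Q :: "nat \<times> 'a \<Rightarrow> bool"
  assume P: "(\<lambda>N. measure_pmf.prob (p N) {x. \<not> P (N, x)}) \<longlonglongrightarrow> 0"
    and Q: "(\<lambda>N. measure_pmf.prob (p N) {x. \<not> Q (N, x)}) \<longlonglongrightarrow> 0"
  have "measure_pmf.prob (p N) {x. \<not> (P (N, x) \<and> Q (N, x))} \<le>
      measure_pmf.prob (p N) {x. \<not> P (N, x)} + measure_pmf.prob (p N) {x. \<not> Q (N, x)}" for N
  proof -
    have "{x. \<not> (P (N, x) \<and> Q (N, x))} = {x. \<not> P (N, x)} \<union> {x. \<not> Q (N, x)}" by auto
    then show ?thesis by (simp add: measure_Un_le)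
  qed
  then show "(\<lambda>N. measure_pmf.prob (p N) {x. \<not> (P (N, x) \<and> Q (N, x))}) \<longlonglongrightarrow> 0"
    by (intro tendsto_sandwich[OF _ _ tendsto_const tendsto_add_zero[OF P Q]]) auto
next
  fix P Q :: "nat \<times> 'a \<Rightarrow> bool"
  assume PQ: "\<forall>z. P z \<longrightarrow> Q z" and P: "(\<lambda>N. measure_pmf.prob (p N) {x. \<not> P (N, x)}) \<longlonglongrightarrow> 0"
  have "measure_pmf.prob (p N) {x. \<not> Q (N, x)} \<le> measure_pmf.prob (p N) {x. \<not> P (N, x)}" for N
    using PQ by (intro measure_pmf.finite_measure_mono) auto
  then show "(\<lambda>N. measure_pmf.prob (p N) {x. \<not> Q (N, x)}) \<longlonglongrightarrow> 0"
    by (intro tendsto_sandwich[OF _ _ tendsto_const P]) auto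
qed

lemma filterlim_fst_in_probability: "filterlim fst sequentially (in_probability p)"
  unfolding filterlim_iff
proof (intro allI impI)
  fix P :: "nat \<Rightarrow> bool" assume "eventually P sequentially"
  then have "\<forall>\<^sub>F N in sequentially. measure_pmf.prob (p N) {x. \<not> P (fst (N, x))} = 0"
    by eventually_elim simp
  then show "\<forall>\<^sub>F z in in_probability p. P (fst z)"
    unfolding eventually_in_probability by (rule tendsto_eventually)
qed

lemma in_probability_tendsto_0_Markov:
  fixes X :: "nat \<Rightarrow> 'a \<Rightarrow> real"
  assumes int: "\<And>N. integrable (measure_pmf (p N)) (X N)"
    and nonneg: "\<forall>\<^sub>F N in sequentially. \<forall>x. 0 \<le> X N x"
    and bound: "\<forall>\<^sub>F N in sequentially. measure_pmf.expectation (p N) (X N) \<le> b N" and b: "b \<longlonglongrightarrow> 0"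
  shows "((\<lambda>z. X (fst z) (snd z)) \<longlongrightarrow> 0) (in_probability p)"
proof (rule tendstoI)
  fix e :: real assume "e > 0"
  have "\<forall>\<^sub>F N in sequentially. measure_pmf.prob (p N) {x. \<not> dist (X N x) 0 < e} \<le> b N / e"
    using nonneg bound
  proof eventually_elim
    case (elim N)
    have "measure_pmf.prob (p N) {x. \<not> dist (X N x) 0 < e} = measure_pmf.prob (p N) {x \<in> space (measure_pmf (p N)). X N x \<ge> e}"
      using elim(1) by (intro arg_cong[of _ _ "measure_pmf.prob (p N)"]) (auto simp: not_less)
    also have "\<dots> \<le> measure_pmf.expectation (p N) (X N) / e"
      using elim(1) \<open>e > 0\<close> by (intro integral_Markov_inequality_measure[OF int, of UNIV]) auto
    also have "\<dots> \<le> b N / e" using elim(2) \<open>e > 0\<close> by (simp add: divide_right_mono)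
    finally show ?case .
  qed
  then have "(\<lambda>N. measure_pmf.prob (p N) {x. \<not> dist (X N x) 0 < e}) \<longlonglongrightarrow> 0"
    by (intro tendsto_sandwich[where f = "\<lambda>_. 0", OF _ _ tendsto_const tendsto_divide_zero[OF b]]) auto
  then show "\<forall>\<^sub>F z in in_probability p. dist (X (fst z) (snd z)) 0 < e"
    by (simp add: eventually_in_probability)
qed

text \<open>
  The deviation from the limit is at most \<open>e / 2\<close> off an event of vanishing probability, and bounded by a
  constant on that event.
\<close>
lemma in_probability_bounded_expectation:
  fixes \<phi> :: "nat \<Rightarrow> 'a \<Rightarrow> complex"
  assumes int: "\<And>N. integrable (measure_pmf (p N)) (\<phi> N)" and bound: "\<And>N x. norm (\<phi> N x) \<le> B"
    and lim: "((\<lambda>z. \<phi> (fst z) (snd z)) \<longlongrightarrow> l) (in_probability p)"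
  shows "(\<lambda>N. measure_pmf.expectation (p N) (\<phi> N)) \<longlonglongrightarrow> l"
proof (rule tendstoI)
  fix e :: real assume "e > 0"
  define C where "C = B + norm l + 1"
  have B0: "B \<ge> 0" using bound[of 0 undefined] norm_ge_zero order_trans by blast
  have C: "C > 0" using B0 norm_ge_zero[of l] unfolding C_def by linarith
  define bad where "bad N = {x. \<not> dist (\<phi> N x) l < e / 2}" for N
  have "(\<lambda>N. measure_pmf.prob (p N) (bad N)) \<longlonglongrightarrow> 0"
    using tendstoD[OF lim, of "e / 2"] \<open>e > 0\<close> by (simp add: eventually_in_probability bad_def)
  then have "\<forall>\<^sub>F N in sequentially. measure_pmf.prob (p N) (bad N) < e / (2 * C)"
    using \<open>e > 0\<close> C by (intro order_tendstoD(2)) auto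
  then show "\<forall>\<^sub>F N in sequentially. dist (measure_pmf.expectation (p N) (\<phi> N)) l < e"
  proof eventually_elim
    case (elim N)
    have ind: "integrable (measure_pmf (p N)) (indicat_real (bad N))"
      by (rule measure_pmf.integrable_const_bound[where B = 1]) auto
    have shift: "measure_pmf.expectation (p N) (\<phi> N) - l = measure_pmf.expectation (p N) (\<lambda>x. \<phi> N x - l)"
      using int by (simp add: Bochner_Integration.integral_diff)
    have "norm (measure_pmf.expectation (p N) (\<phi> N) - l) \<le> measure_pmf.expectation (p N) (\<lambda>x. norm (\<phi> N x - l))"
      unfolding shift by (rule integral_norm_bound)
    also have "\<dots> \<le> measure_pmf.expectation (p N) (\<lambda>x. e / 2 + C * indicator (bad N) x)"
    proof (rule integral_mono)
      fix x
      have "norm (\<phi> N x - l) \<le> B + norm l" using norm_triangle_ineq4[of "\<phi> N x" l] bound[of N x] by simp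
      then show "norm (\<phi> N x - l) \<le> e / 2 + C * indicator (bad N) x"
        using \<open>e > 0\<close> by (auto simp: bad_def C_def indicator_def dist_norm)
    qed (use int ind in auto)
    also have "\<dots> = e / 2 + C * measure_pmf.prob (p N) (bad N)"
      using ind by (simp add: Bochner_Integration.integral_add)
    also have "\<dots> < e / 2 + C * (e / (2 * C))"
      using elim C by (intro add_strict_left_mono mult_strict_left_mono)
    also have "\<dots> = e" using C by simp
    finally show ?case by (simp add: dist_norm)
  qed
qed

section \<open>The characteristic function given the graph\<close>

lemma tanh_complex_of_real: "tanh (complex_of_real x) = of_real (tanh x)"
  by (simp add: tanh_def sinh_def cosh_def scaleR_conv_of_real exp_of_real[symmetric] del: exp_of_real)

text \<open>
  Here \<open>q = \<surd>\<theta>\<close>, \<open>k = 1 / (N \<theta>)\<close>, \<open>a = E / (N\<^sup>2 \<theta>)\<close> and \<open>l = \<surd>\<theta> D / (N \<theta>)\<close>; the hypothesis on \<open>m\<close> is the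
  relation \<open>E = D + 2 m\<close>. The cross term \<open>2 \<beta> i \<eta>\<close> of \<open>(\<beta> + i \<eta>)\<^sup>2\<close> cancels the centring phase exactly, up
  to loops, and the square \<open>- \<eta>\<^sup>2\<close> leaves \<open>- s\<^sup>2 / a\<close>.
\<close>
lemma interaction_exponent_cancellation:
  fixes a k q l \<beta> s :: real and m :: nat
  assumes nz: "a \<noteq> 0" "k \<noteq> 0" "q \<noteq> 0"
    and m: "real m = (a / (k\<^sup>2 * q\<^sup>2) - l / (k * q)) / 2"
    and \<eta>: "\<eta> = 2 * s / a * q"
    and u: "u = complex_of_real (\<beta> * k)" and u': "u' = u + \<i> * of_real (\<eta> * k)"
  shows "of_nat m * ((u'\<^sup>2 - u\<^sup>2) / 2) - \<i> * of_real (s * \<beta> / q) =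
    of_real (- s\<^sup>2 / a + l * k * (s\<^sup>2 * q / a\<^sup>2)) - \<i> * of_real (l * k * (\<beta> * s / a))"
proof -
  have mk: "real m * k\<^sup>2 = (a / q\<^sup>2 - l * k / q) / 2"
    unfolding m using nz by (simp add: field_simps power2_eq_square)
  have sq: "(u'\<^sup>2 - u\<^sup>2) / 2 = of_real (- (\<eta>\<^sup>2 / 2) * k\<^sup>2) + \<i> * of_real (\<beta> * \<eta> * k\<^sup>2)"
    unfolding u u' by (simp add: complex_eq_iff power2_eq_square algebra_simps)
  have re: "real m * (- (\<eta>\<^sup>2 / 2) * k\<^sup>2) = - s\<^sup>2 / a + l * k * (s\<^sup>2 * q / a\<^sup>2)"
  proof -
    have "real m * (- (\<eta>\<^sup>2 / 2) * k\<^sup>2) = (real m * k\<^sup>2) * (- (\<eta>\<^sup>2 / 2))" by simp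
    also have "\<dots> = - s\<^sup>2 / a + l * k * (s\<^sup>2 * q / a\<^sup>2)"
      unfolding mk \<eta> using nz by (simp add: field_simps power2_eq_square)
    finally show ?thesis .
  qed
  have im: "real m * (\<beta> * \<eta> * k\<^sup>2) - s * \<beta> / q = - (l * k * (\<beta> * s / a))"
  proof -
    have "real m * (\<beta> * \<eta> * k\<^sup>2) = (real m * k\<^sup>2) * (\<beta> * \<eta>)" by simp
    also have "\<dots> - s * \<beta> / q = - (l * k * (\<beta> * s / a))"
      unfolding mk \<eta> using nz by (simp add: field_simps power2_eq_square)
    finally show ?thesis .
  qed
  show ?thesis
    unfolding sq using re im by (simp add: complex_eq_iff)
qed

text \<open>
  The statement is about an arbitrary filter, in order to be used with convergence in probability. The
  quotients that are assumed to converge are the edge density (to \<open>w\<close>), the contribution of the loops, the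
  even subgraph polynomial at the enlarged argument \<open>\<gamma> / (N \<theta>)\<close> times the step size \<open>\<surd>\<theta>\<close>, the scale
  \<open>1 / (N \<theta>)\<close> of the couplings, and the size of the change in the quartic term of
  \<open>log cosh\<close>. The four functions \<open>f1\<close> to \<open>f4\<close> are the contributions of the loops, of the quadratic part of \<open>log cosh\<close>, of its remainder, and of the even subgraphs.
\<close>
lemma ising_char_limit:
  fixes F :: "'z filter" and N :: "'z \<Rightarrow> nat" and \<theta> :: "'z \<Rightarrow> real" and G :: "'z \<Rightarrow> edge_indicators"
  assumes \<beta>: "0 < \<beta>" "\<beta> < \<gamma>" and w: "0 < w"
    and pos: "\<forall>\<^sub>F z in F. N z \<ge> 1 \<and> \<theta> z > 0"
    and \<theta>: "(\<theta> \<longlongrightarrow> 0) F"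
    and k: "((\<lambda>z. 1 / (N z * \<theta> z)) \<longlongrightarrow> 0) F"
    and r: "((\<lambda>z. (1 / (N z * \<theta> z))\<^sup>2 / sqrt (\<theta> z)) \<longlongrightarrow> 0) F"
    and a: "((\<lambda>z. edge_sum (N z) (G z) / ((N z)\<^sup>2 * \<theta> z)) \<longlongrightarrow> w) F"
    and l: "((\<lambda>z. sqrt (\<theta> z) * (loop_count (N z) (G z) / (N z * \<theta> z))) \<longlongrightarrow> 0) F"
    and y: "((\<lambda>z. sqrt (\<theta> z) * subgraph_sum (N z) (G z) (\<gamma> / (N z * \<theta> z))) \<longlongrightarrow> 0) F"
  shows "((\<lambda>z. measure_pmf.expectation (ising (N z) (\<theta> z) \<beta> (G z))
       (\<lambda>\<sigma>. iexp (s * (1 / sqrt (\<theta> z) * (beta_estimator (N z) (\<theta> z) (G z) \<sigma> - \<beta>)))))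
     \<longlongrightarrow> of_real (exp (- s\<^sup>2 / w))) F"
proof -
  define kz where "kz z = 1 / (N z * \<theta> z)" for z
  define az where "az z = edge_sum (N z) (G z) / ((N z)\<^sup>2 * \<theta> z)" for z
  define lz where "lz z = sqrt (\<theta> z) * (loop_count (N z) (G z) / (N z * \<theta> z))" for z
  define yz where "yz z = sqrt (\<theta> z) * subgraph_sum (N z) (G z) (\<gamma> / (N z * \<theta> z))" for z
  define \<eta> where "\<eta> z = 2 * s / az z * sqrt (\<theta> z)" for z
  define u where "u z = complex_of_real (\<beta> * kz z)" for z
  define u' where "u' z = u z + \<i> * of_real (\<eta> z * kz z)" for z
  note lims = k[folded kz_def] a[folded az_def] l[folded lz_def] y[folded yz_def] r[folded kz_def] \<theta>
  have \<eta>_lim: "(\<eta> \<longlongrightarrow> 0) F"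
    unfolding \<eta>_def[abs_def] by (rule tendsto_eq_intros lims | use w in simp)+
  define f1 where "f1 z = exp (\<i> * of_real (s / az z * lz z))" for z
  define f2 where "f2 z = exp (complex_of_real (- s\<^sup>2 / az z + lz z * kz z * (s\<^sup>2 * sqrt (\<theta> z) / (az z)\<^sup>2)) -
      \<i> * of_real (lz z * kz z * (\<beta> * s / az z)))" for z
  define f3 where "f3 z = (flat_cosh (u' z) / flat_cosh (u z)) ^ edge_count (N z) (G z)" for z
  define f4 where "f4 z = subgraph_sum (N z) (G z) (tanh (u' z)) / subgraph_sum (N z) (G z) (tanh (u z))" for z
  have f1_lim: "(f1 \<longlongrightarrow> 1) F"
    unfolding f1_def[abs_def] by (rule tendsto_eq_intros lims | use w in simp)+
  have f2_lim: "(f2 \<longlongrightarrow> of_real (exp (- s\<^sup>2 / w))) F"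
    unfolding f2_def[abs_def]
    by (rule tendsto_eq_intros lims | use w in \<open>simp add: exp_of_real[symmetric] del: exp_of_real\<close>)+
  \<comment> \<open>the bounds on \<open>\<eta>\<close> and \<open>kz\<close> keep both arguments of \<open>tanh\<close> in the disc of radius 1/2
      and leave half of the gap between \<open>\<beta>\<close> and \<open>\<gamma>\<close>\<close>
  have good: "\<forall>\<^sub>F z in F. N z \<ge> 1 \<and> \<theta> z > 0 \<and> az z > 0 \<and> \<bar>\<eta> z\<bar> < min \<beta> ((\<gamma> - \<beta>) / 32) \<and> kz z < 1 / (4 * \<beta>)"
  proof -
    have "\<forall>\<^sub>F z in F. az z > 0" using lims(2) w by (rule order_tendstoD(1))
    moreover have "\<forall>\<^sub>F z in F. \<bar>\<eta> z\<bar> < min \<beta> ((\<gamma> - \<beta>) / 32)"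
      using tendsto_rabs_zero[OF \<eta>_lim] \<beta> by (intro order_tendstoD(2)) auto
    moreover have "\<forall>\<^sub>F z in F. kz z < 1 / (4 * \<beta>)"
      using lims(1) \<beta> by (intro order_tendstoD(2)) auto
    ultimately show ?thesis using pos by eventually_elim auto
  qed
  have small: "kz z > 0" "norm (u z) \<le> 2 * \<beta> * kz z" "norm (u' z) \<le> 2 * \<beta> * kz z" "2 * \<beta> * kz z \<le> 1 / 2"
      "norm (u' z - u z) = \<bar>\<eta> z\<bar> * kz z" "norm (u z) = \<beta> * kz z"
    if z: "N z \<ge> 1 \<and> \<theta> z > 0 \<and> az z > 0 \<and> \<bar>\<eta> z\<bar> < min \<beta> ((\<gamma> - \<beta>) / 32) \<and> kz z < 1 / (4 * \<beta>)" for z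
  proof -
    show k0: "kz z > 0" using z by (simp add: kz_def)
    show nu: "norm (u z) = \<beta> * kz z" using k0 \<beta> by (simp add: u_def norm_mult)
    then show "norm (u z) \<le> 2 * \<beta> * kz z" using k0 \<beta> by simp
    show diff: "norm (u' z - u z) = \<bar>\<eta> z\<bar> * kz z" using k0 by (simp add: u'_def norm_mult)
    have "norm (u' z) \<le> norm (u z) + norm (u' z - u z)" using norm_triangle_ineq[of "u z" "u' z - u z"] by simp
    also have "\<dots> \<le> \<beta> * kz z + \<beta> * kz z"
      unfolding nu diff using z k0 by (intro add_left_mono mult_right_mono) auto
    finally show "norm (u' z) \<le> 2 * \<beta> * kz z" by simp
    have "kz z \<le> 1 / (4 * \<beta>)" using z by simp
    then show "2 * \<beta> * kz z \<le> 1 / 2" using \<beta> by (simp add: field_simps)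
  qed
  have f3_lim: "(f3 \<longlongrightarrow> 1) F"
  proof (rule Lim_transform2)
    show "((\<lambda>_. 1 :: complex) \<longlongrightarrow> 1) F" by simp
    have "((\<lambda>z. exp (96 * \<beta> ^ 3 * \<bar>s\<bar> * ((kz z)\<^sup>2 / sqrt (\<theta> z))) - 1) \<longlongrightarrow> exp (96 * \<beta> ^ 3 * \<bar>s\<bar> * 0) - 1) F"
      by (intro tendsto_intros lims)
    then have lim0: "((\<lambda>z. exp (96 * \<beta> ^ 3 * \<bar>s\<bar> * ((kz z)\<^sup>2 / sqrt (\<theta> z))) - 1) \<longlongrightarrow> 0) F" by simp
    show "((\<lambda>z. 1 - f3 z) \<longlongrightarrow> 0) F"
    proof (rule Lim_null_comparison[OF _ lim0])
      show "\<forall>\<^sub>F z in F. norm (1 - f3 z) \<le> exp (96 * \<beta> ^ 3 * \<bar>s\<bar> * ((kz z)\<^sup>2 / sqrt (\<theta> z))) - 1"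
        using good
      proof eventually_elim
        case (elim z)
        note sm = small[OF elim]
        define m where "m = edge_count (N z) (G z)"
        define \<rho> where "\<rho> = flat_cosh (u' z) / flat_cosh (u z)"
        have "norm (\<rho> - 1) \<le> 12 * (2 * \<beta> * kz z) ^ 3 * (\<bar>\<eta> z\<bar> * kz z)"
          unfolding \<rho>_def sm(5)[symmetric] unfolding u_def
          using sm \<beta> by (intro flat_cosh_ratio) (auto simp: u_def)
        moreover have "real m \<le> az z / (2 * (kz z)\<^sup>2 * \<theta> z)"
        proof -
          have "0 \<le> loop_count (N z) (G z)" by (auto simp: loop_count_def adj_def intro!: sum_nonneg)
          then have "real m \<le> edge_sum (N z) (G z) / 2" by (simp add: edge_sum_eq m_def)
          also have "\<dots> = az z / (2 * (kz z)\<^sup>2 * \<theta> z)"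
            using elim by (simp add: az_def kz_def power2_eq_square field_simps)
          finally show ?thesis .
        qed
        \<comment> \<open>\<open>flat_cosh_ratio\<close> is used on the disc of radius \<open>2 \<beta> kz\<close>, whence \<open>96 = 12 * 2\<^sup>3\<close>\<close>
        ultimately have "m * norm (\<rho> - 1) \<le>
            az z / (2 * (kz z)\<^sup>2 * \<theta> z) * (12 * (2 * \<beta> * kz z) ^ 3 * (\<bar>\<eta> z\<bar> * kz z))"
          using elim by (intro mult_mono) auto
        also have "\<dots> = 96 * \<beta> ^ 3 * \<bar>s\<bar> * ((kz z)\<^sup>2 / sqrt (\<theta> z))"
        proof -
          define q where "q = sqrt (\<theta> z)"
          have q: "q > 0" "\<theta> z = q\<^sup>2" using elim by (auto simp: q_def)
          have "\<bar>\<eta> z\<bar> = 2 * \<bar>s\<bar> / az z * q" using elim q(1) by (simp add: \<eta>_def q_def abs_mult)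
          then show ?thesis
            unfolding q_def[symmetric] q(2) using elim sm(1) q(1)
            by (simp add: field_simps power2_eq_square power3_eq_cube)
        qed
        finally have le: "m * norm (\<rho> - 1) \<le> 96 * \<beta> ^ 3 * \<bar>s\<bar> * ((kz z)\<^sup>2 / sqrt (\<theta> z))" .
        have "norm (1 - f3 z) = norm (\<rho> ^ m - 1)"
          by (simp add: f3_def \<rho>_def m_def norm_minus_commute)
        also have "\<dots> \<le> exp (m * norm (\<rho> - 1)) - 1" by (rule norm_power_minus_one_le)
        also have "\<dots> \<le> exp (96 * \<beta> ^ 3 * \<bar>s\<bar> * ((kz z)\<^sup>2 / sqrt (\<theta> z))) - 1"
          using le by (simp only: exp_le_cancel_iff diff_right_mono)
        finally show ?case .
      qed
    qed
  qed
  have f4_lim: "(f4 \<longlongrightarrow> 1) F"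
  proof (rule Lim_transform2)
    show "((\<lambda>_. 1 :: complex) \<longlongrightarrow> 1) F" by simp
    have "((\<lambda>z. 64 * \<bar>s\<bar> / ((\<gamma> - \<beta>) * az z) * yz z) \<longlongrightarrow> 64 * \<bar>s\<bar> / ((\<gamma> - \<beta>) * w) * 0) F"
      using \<beta> w by (intro tendsto_intros lims) auto
    then have lim0: "((\<lambda>z. 64 * \<bar>s\<bar> / ((\<gamma> - \<beta>) * az z) * yz z) \<longlongrightarrow> 0) F" by simp
    show "((\<lambda>z. 1 - f4 z) \<longlongrightarrow> 0) F"
    proof (rule Lim_null_comparison[OF _ lim0])
      show "\<forall>\<^sub>F z in F. norm (1 - f4 z) \<le> 64 * \<bar>s\<bar> / ((\<gamma> - \<beta>) * az z) * yz z"
        using good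
      proof eventually_elim
        case (elim z)
        note sm = small[OF elim]
        define Y where "Y t = subgraph_sum (N z) (G z) t" for t :: complex
        \<comment> \<open>the perturbation moves \<open>tanh\<close> by at most \<open>16 |\<eta>| kz\<close>, so both points stay in the disc
            of radius \<open>x\<close>, midway between \<open>\<beta> kz\<close> and \<open>R\<close>\<close>
        define R where "R = \<gamma> * kz z"
        define x where "x = (\<beta> + \<gamma>) / 2 * kz z"
        have xR: "x < R" "R - x = (\<gamma> - \<beta>) / 2 * kz z"
          using \<beta> sm(1) by (auto simp: x_def R_def field_simps)
        have t0: "0 \<le> \<beta> * kz z" using \<beta> sm(1) by simp
        then have tanh0: "0 \<le> tanh (\<beta> * kz z)" by simp
        have tu: "tanh (u z) = of_real (tanh (\<beta> * kz z))" unfolding u_def by (rule tanh_complex_of_real)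
        then have tu_norm: "norm (tanh (u z)) \<le> \<beta> * kz z"
          using tanh_real_le_self[OF t0] tanh0 by simp
        have diff: "norm (tanh (u' z) - tanh (u z)) \<le> 16 * (\<bar>\<eta> z\<bar> * kz z)"
          unfolding sm(5)[symmetric] using sm by (intro tanh_lipschitz) auto
        have step: "\<beta> * kz z + 16 * (\<bar>\<eta> z\<bar> * kz z) \<le> x"
        proof -
          have "(\<beta> + 16 * \<bar>\<eta> z\<bar>) * kz z \<le> (\<beta> + \<gamma>) / 2 * kz z"
            using elim sm(1) by (intro mult_right_mono) auto
          then show ?thesis by (simp add: x_def algebra_simps)
        qed
        have tu'_norm: "norm (tanh (u' z)) \<le> x"
          using norm_triangle_ineq[of "tanh (u z)" "tanh (u' z) - tanh (u z)"] tu_norm diff step by simp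
        have tu_x: "norm (tanh (u z)) \<le> x"
          using tu_norm step mult_nonneg_nonneg[OF abs_ge_zero[of "\<eta> z"] less_imp_le[OF sm(1)]] by linarith
        have Y1: "1 \<le> norm (Y (tanh (u z)))"
          using subgraph_sum_ge_1[OF tanh0, of "N z" "G z"] unfolding Y_def tu subgraph_sum_of_real by simp
        have YR0: "0 \<le> subgraph_sum (N z) (G z) R"
          using subgraph_sum_ge_1[of R "N z" "G z"] \<beta> sm(1) by (simp add: R_def)
        have "norm (1 - f4 z) = norm (Y (tanh (u' z)) - Y (tanh (u z))) / norm (Y (tanh (u z)))"
        proof -
          have "1 - f4 z = (Y (tanh (u z)) - Y (tanh (u' z))) / Y (tanh (u z))"
            using Y1 by (auto simp: f4_def Y_def diff_divide_distrib)
          then show ?thesis by (simp add: norm_divide norm_minus_commute)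
        qed
        also have "\<dots> \<le> norm (Y (tanh (u' z)) - Y (tanh (u z)))"
        proof -
          have "d / e \<le> d" if "0 \<le> d" "1 \<le> e" for d e :: real
            using that divide_left_mono[of 1 e d] by simp
          then show ?thesis using Y1 by simp
        qed
        also have "\<dots> \<le> norm (tanh (u' z) - tanh (u z)) / (R - x) * subgraph_sum (N z) (G z) R"
          unfolding Y_def by (rule subgraph_sum_diff_bound[OF tu'_norm tu_x xR(1)])
        also have "\<dots> \<le> 16 * (\<bar>\<eta> z\<bar> * kz z) / (R - x) * subgraph_sum (N z) (G z) R"
          using diff xR YR0 by (intro mult_right_mono divide_right_mono) auto
        also have "16 * (\<bar>\<eta> z\<bar> * kz z) / (R - x) = 32 * \<bar>\<eta> z\<bar> / (\<gamma> - \<beta>)"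
        proof -
          have "16 * (e * h) / (d / 2 * h) = 32 * e / d" if "h > 0" "d > 0" for e h d :: real
            using that by (simp add: field_simps)
          then show ?thesis unfolding xR(2) using sm(1) \<beta> by simp
        qed
        also have "\<dots> * subgraph_sum (N z) (G z) R = 64 * \<bar>s\<bar> / ((\<gamma> - \<beta>) * az z) * yz z"
          using elim by (simp add: \<eta>_def yz_def R_def kz_def abs_mult mult_ac)
        finally show ?case .
      qed
    qed
  qed
  have "((\<lambda>z. f1 z * f2 z * f3 z * f4 z) \<longlongrightarrow> 1 * of_real (exp (- s\<^sup>2 / w)) * 1 * 1) F"
    by (intro tendsto_intros f1_lim f2_lim f3_lim f4_lim)
  moreover have "\<forall>\<^sub>F z in F. f1 z * f2 z * f3 z * f4 z =
      measure_pmf.expectation (ising (N z) (\<theta> z) \<beta> (G z))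
       (\<lambda>\<sigma>. iexp (s * (1 / sqrt (\<theta> z) * (beta_estimator (N z) (\<theta> z) (G z) \<sigma> - \<beta>))))"
    using good
  proof eventually_elim
    case (elim z)
    note sm = small[OF elim]
    define m where "m = edge_count (N z) (G z)"
    define q where "q = sqrt (\<theta> z)"
    have q: "q > 0" "\<theta> z = q\<^sup>2" using elim by (auto simp: q_def)
    have N0: "real (N z) > 0" using elim by simp
    have E: "edge_sum (N z) (G z) = az z / ((kz z)\<^sup>2 * q\<^sup>2)"
      unfolding az_def kz_def q(2) using N0 q(1) by (simp add: field_simps power2_eq_square)
    have D: "loop_count (N z) (G z) = lz z / (kz z * q)"
      unfolding lz_def kz_def q_def[symmetric] q(2) using N0 q(1) by (simp add: field_simps)
    have nz: "cosh (u z) \<noteq> 0" "cosh (u' z) \<noteq> 0"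
      using norm_cosh_ge[of "u z"] norm_cosh_ge[of "u' z"] sm by fastforce+
    have slope: "\<eta> z * kz z = 2 * real (N z) * sqrt (\<theta> z) * s / edge_sum (N z) (G z)"
      unfolding E \<eta>_def kz_def q_def[symmetric] q(2) using N0 q(1) elim
      by (simp add: field_simps power2_eq_square)
    have u'_eq: "u' z = u z + \<i> * of_real (2 * real (N z) * sqrt (\<theta> z) * s / edge_sum (N z) (G z))"
      unfolding u'_def slope ..
    have u_eq: "u z = of_real (\<beta> / (N z * \<theta> z))" by (simp add: u_def kz_def)
    have "real m = (az z / ((kz z)\<^sup>2 * q\<^sup>2) - lz z / (kz z * q)) / 2"
      using edge_sum_eq[of "N z" "G z"] unfolding E D by (simp add: m_def)
    from interaction_exponent_cancellation[OF _ _ _ this, of "\<eta> z" s "u z" \<beta> "u' z"]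
    have cancel: "of_nat m * (((u' z)\<^sup>2 - (u z)\<^sup>2) / 2) - \<i> * of_real (s * \<beta> / q) =
       of_real (- s\<^sup>2 / az z + lz z * kz z * (s\<^sup>2 * q / (az z)\<^sup>2)) - \<i> * of_real (lz z * kz z * (\<beta> * s / az z))"
      using elim sm(1) q(1) by (simp add: \<eta>_def q_def u_def u'_def)
    have ratio: "cosh (u' z) / cosh (u z) = flat_cosh (u' z) / flat_cosh (u z) * exp (((u' z)\<^sup>2 - (u z)\<^sup>2) / 2)"
    proof -
      have "flat_cosh v = cosh v / exp (v\<^sup>2 / 2)" for v
        unfolding flat_cosh_def exp_minus by (rule divide_inverse[symmetric])
      moreover have "exp (((u' z)\<^sup>2 - (u z)\<^sup>2) / 2) = exp ((u' z)\<^sup>2 / 2) / exp ((u z)\<^sup>2 / 2)"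
        by (simp add: diff_divide_distrib exp_diff)
      ultimately show ?thesis by simp
    qed
    have power: "(cosh (u' z) / cosh (u z)) ^ m = f3 z * exp (of_nat m * (((u' z)\<^sup>2 - (u z)\<^sup>2) / 2))"
      unfolding ratio power_mult_distrib f3_def m_def exp_of_nat_mult ..
    have f2_eq: "f2 z = exp (of_nat m * (((u' z)\<^sup>2 - (u z)\<^sup>2) / 2)) * exp (- (\<i> * of_real (s * \<beta> / q)))"
      unfolding f2_def q_def[symmetric] cancel[symmetric] by (simp only: diff_conv_add_uminus exp_add)
    have cosh_part: "exp (- (\<i> * of_real (s * \<beta> / q))) * (cosh (u' z) / cosh (u z)) ^ m = f2 z * f3 z"
      unfolding power f2_eq by (simp only: mult_ac)
    have "(u' z - u z) * of_real (loop_count (N z) (G z)) / 2 = \<i> * of_real (s / az z * lz z)"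
      unfolding D u'_def \<eta>_def q_def[symmetric] using sm(1) q(1) elim
      by (simp add: field_simps)
    then have loop_part: "exp ((u' z - u z) * of_real (loop_count (N z) (G z)) / 2) = f1 z"
      by (simp add: f1_def)
    have "measure_pmf.expectation (ising (N z) (\<theta> z) \<beta> (G z))
       (\<lambda>\<sigma>. iexp (s * (1 / sqrt (\<theta> z) * (beta_estimator (N z) (\<theta> z) (G z) \<sigma> - \<beta>)))) =
       exp (- (\<i> * of_real (s * \<beta> / q))) * f1 z * (cosh (u' z) / cosh (u z)) ^ m * f4 z"
      unfolding loop_part[symmetric] f4_def m_def q_def
      using elim by (intro ising_char_beta_estimator[OF _ _ u_eq u'_eq nz]) auto
    also have "\<dots> = f1 z * (exp (- (\<i> * of_real (s * \<beta> / q))) * (cosh (u' z) / cosh (u z)) ^ m) * f4 z"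
      by (simp only: mult_ac)
    also have "\<dots> = f1 z * f2 z * f3 z * f4 z" unfolding cosh_part by (simp only: mult.assoc)
    finally show ?case by simp
  qed
  ultimately show ?thesis by (simp add: tendsto_cong)
qed

section \<open>Asymptotic normality\<close>

lemma expectation_graph_ising:
  fixes h :: "edge_indicators \<times> (nat \<Rightarrow> real) \<Rightarrow> complex"
  shows "measure_pmf.expectation (graph_ising N \<theta> W \<beta>) h =
    measure_pmf.expectation (random_graph N \<theta> W)
      (\<lambda>G. measure_pmf.expectation (ising N \<theta> \<beta> G) (\<lambda>\<sigma>. h (G, \<sigma>)))"
proof -
  have "set_pmf (ising N \<theta> \<beta> G) \<subseteq> spins N" for G
    by (auto simp: set_pmf_iff pmf_ising ising_weight_def split: if_splits)
  then have fin: "finite (set_pmf (ising N \<theta> \<beta> G))" for G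
    using finite_spins finite_subset by blast
  have eq: "graph_ising N \<theta> W \<beta> = random_graph N \<theta> W \<bind> (\<lambda>G. map_pmf (Pair G) (ising N \<theta> \<beta> G))"
    by (simp add: graph_ising_def map_pmf_def)
  have "measure_pmf.expectation (graph_ising N \<theta> W \<beta>) h =
      (\<Sum>G\<in>set_pmf (random_graph N \<theta> W). pmf (random_graph N \<theta> W) G *\<^sub>R
         measure_pmf.expectation (map_pmf (Pair G) (ising N \<theta> \<beta> G)) h)"
    unfolding eq by (rule pmf_expectation_bind) (use fin in simp_all)
  also have "\<dots> = measure_pmf.expectation (random_graph N \<theta> W)
      (\<lambda>G. measure_pmf.expectation (map_pmf (Pair G) (ising N \<theta> \<beta> G)) h)"
    by (rule integral_measure_pmf[symmetric]) auto
  finally show ?thesis by simp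
qed

text \<open>
  Dividing by the standard deviation reduces the claim to the standard normal law.
\<close>
lemma char_normal_distribution:
  assumes v: "v > 0"
  shows "real_distribution (normal_distribution 0 v)"
    and "char (normal_distribution 0 v) t = of_real (exp (- v * t\<^sup>2 / 2))"
proof -
  define M where "M = normal_distribution 0 v"
  have sd: "sqrt v > 0" using v by simp
  have prob: "prob_space M"
    unfolding M_def normal_distribution_def by (rule prob_space_normal_density[OF sd])
  have sets_M: "sets M = sets borel" by (simp add: M_def normal_distribution_def)
  show "real_distribution (normal_distribution 0 v)"
    using prob sets_M by (auto simp: M_def real_distribution_def real_distribution_axioms_def)
  interpret prob_space M by (rule prob)
  have "distributed M lborel (\<lambda>x. x) (normal_density 0 (sqrt v))"
    unfolding distributed_def
    by (auto simp: M_def normal_distribution_def distr_id2 cong: distr_cong)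
  then have "distributed M lborel (\<lambda>x. (x - 0) / sqrt v) std_normal_density"
    by (subst (asm) normal_standard_normal_convert[OF sd]) 
  then have std: "distr M lborel (\<lambda>x. x / sqrt v) = std_normal_distribution"
    by (simp add: distributed_def)
  have [measurable_cong]: "sets M = sets borel" by (rule sets_M)
  have "char std_normal_distribution (t * sqrt v) = (CLINT x|M. iexp (t * sqrt v * (x / sqrt v)))"
    unfolding char_def std[symmetric] by (subst integral_distr) auto
  also have "\<dots> = char M t" using sd by (simp add: char_def)
  finally show "char (normal_distribution 0 v) t = of_real (exp (- v * t\<^sup>2 / 2))"
    using v by (simp add: char_std_normal_distribution M_def power_mult_distrib mult.commute)
qed

theorem theorem2p3:
  fixes W :: "real \<Rightarrow> real \<Rightarrow> real" and \<beta> :: real and \<theta> :: "nat \<Rightarrow> real"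
  assumes "graphon W"
    and "case_prod W riemann_integrable_on cbox (0, 0) (1, 1)"
    and "(\<lambda>x. W x x) riemann_integrable_on {0..1}"
    and "graphon_integral W > 0"
    and "\<beta> \<in> {0<..<1 / graphon_op_norm W}"
    and "\<And>N. N \<ge> 1 \<Longrightarrow> \<theta> N \<in> {0<..<1}"
    and "asymp_gtrsim (\<lambda>N. real N powr (2 / 3) * \<theta> N) (\<lambda>_. 1)"
    and "\<theta> \<longlonglongrightarrow> 0"
  shows "weak_conv_m
           (\<lambda>N. distr (measure_pmf (graph_ising N (\<theta> N) W \<beta>)) borel
                  (\<lambda>(G, \<sigma>). 1 / sqrt (\<theta> N) * (beta_estimator N (\<theta> N) G \<sigma> - \<beta>)))
           (normal_distribution 0 (2 / graphon_integral W))"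
proof -
  note W = assms(1) and R = assms(2) and \<theta>_lim = assms(8)
  define w where "w = graphon_integral W"
  have w: "w > 0" using assms(4) by (simp add: w_def)
  define c where "c = graphon_op_norm W"
  have \<beta>: "\<beta> > 0" "\<beta> < 1 / c" using assms(5) by (auto simp: c_def)
  then have "1 / c > 0" by linarith
  then have c: "c > 0" by simp
  \<comment> \<open>any \<open>\<gamma>\<close> strictly between \<open>\<beta>\<close> and the reciprocal of the operator norm would do\<close>
  define \<gamma> where "\<gamma> = (\<beta> + 1 / c) / 2"
  have "\<beta> < \<gamma>" "\<gamma> < 1 / c" using \<beta> by (simp_all add: \<gamma>_def)
  then have \<gamma>: "\<beta> < \<gamma>" "\<gamma> > 0" "\<gamma> * c < 1" using \<beta> c by (simp_all add: pos_less_divide_eq)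
  obtain \<rho> where \<rho>: "0 \<le> \<rho>" "\<rho> < 1" and form: "\<forall>\<^sub>F N in sequentially. \<forall>x.
      (\<Sum>i=1..N. \<Sum>j=1..N. \<gamma> * W (real i / N) (real j / N) / N * x i * x j) \<le> \<rho> * (\<Sum>i=1..N. (x i)\<^sup>2)"
    using graphon_grid_form_bound[OF W R _ \<gamma>(2)] c \<gamma>(3) unfolding c_def by blast
  have \<theta>: "0 < \<theta> N" "\<theta> N < 1" if "N \<ge> 1" for N using assms(6)[OF that] by auto
  define k where "k N = 1 / (real N * \<theta> N)" for N
  obtain C where C: "C > 0" and dens: "\<forall>\<^sub>F N in sequentially. C \<le> real N powr (2 / 3) * \<theta> N"
    using assms(7) by (auto simp: asymp_gtrsim_def)
  have k_lim: "k \<longlonglongrightarrow> 0"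
  proof (rule Lim_null_comparison)
    show "(\<lambda>N. real N powr (- (1 / 3)) / C) \<longlonglongrightarrow> 0"
      by (intro tendsto_divide_zero tendsto_neg_powr filterlim_real_sequentially) simp
    show "\<forall>\<^sub>F N in sequentially. norm (k N) \<le> real N powr (- (1 / 3)) / C"
      using dens eventually_ge_at_top[of 1]
    proof eventually_elim
      case (elim N)
      have "real N = real N powr (1 / 3) * real N powr (2 / 3)" using elim(2) by (simp flip: powr_add)
      then have "real N * \<theta> N = real N powr (1 / 3) * (real N powr (2 / 3) * \<theta> N)"
        by (metis mult.assoc)
      also have "\<dots> \<ge> real N powr (1 / 3) * C" by (intro mult_left_mono elim) auto
      finally have "1 / (real N * \<theta> N) \<le> 1 / (real N powr (1 / 3) * C)"
        using elim(2) C \<theta>[OF elim(2)] by (intro divide_left_mono) auto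
      also have "\<dots> = real N powr (- (1 / 3)) / C" by (simp add: powr_minus field_simps)
      finally show ?case using \<theta>[OF elim(2)] by (simp add: k_def)
    qed
  qed
  \<comment> \<open>this quantity is \<open>\<surd>\<theta> / (N\<^sup>2 \<theta>\<^sup>3)\<close>, and \<open>N\<^sup>2 \<theta>\<^sup>3\<close> is the cube of \<open>N\<^bsup>2/3\<^esup> \<theta>\<close>\<close>
  have r_lim: "(\<lambda>N. (k N)\<^sup>2 / sqrt (\<theta> N)) \<longlonglongrightarrow> 0"
  proof (rule Lim_null_comparison)
    have "(\<lambda>N. sqrt (\<theta> N) / C ^ 3) \<longlonglongrightarrow> sqrt 0 / C ^ 3" using C by (intro tendsto_intros \<theta>_lim) auto
    then show "(\<lambda>N. sqrt (\<theta> N) / C ^ 3) \<longlonglongrightarrow> 0" by simp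
    show "\<forall>\<^sub>F N in sequentially. norm ((k N)\<^sup>2 / sqrt (\<theta> N)) \<le> sqrt (\<theta> N) / C ^ 3"
      using dens eventually_ge_at_top[of 1]
    proof eventually_elim
      case (elim N)
      define q where "q = sqrt (\<theta> N)"
      have q: "q > 0" "\<theta> N = q\<^sup>2" using \<theta>[OF elim(2)] by (auto simp: q_def)
      have "C ^ 3 \<le> (real N powr (2 / 3) * \<theta> N) ^ 3" using C elim(1) by (intro power_mono) auto
      also have "\<dots> = (real N)\<^sup>2 * (\<theta> N) ^ 3"
        using elim(2) by (simp add: power_mult_distrib powr_power powr_numeral)
      finally have "1 / ((real N)\<^sup>2 * (\<theta> N) ^ 3) \<le> 1 / C ^ 3"
        using C elim(2) \<theta>[OF elim(2)] by (intro divide_left_mono) auto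
      then have "q * (1 / ((real N)\<^sup>2 * (\<theta> N) ^ 3)) \<le> q * (1 / C ^ 3)" using q(1) by (intro mult_left_mono) auto
      moreover have "(k N)\<^sup>2 / q = q * (1 / ((real N)\<^sup>2 * (\<theta> N) ^ 3))"
        unfolding k_def q(2) using q(1) elim(2) by (simp add: field_simps power2_eq_square power3_eq_cube)
      ultimately show ?case using q(1) by (simp add: q_def)
    qed
  qed
  define p where "p N = random_graph N (\<theta> N) W" for N
  have p_int: "integrable (measure_pmf (p N)) f" for N and f :: "edge_indicators \<Rightarrow> complex"
    by (simp add: p_def)
  define F where "F = in_probability p"
  have fst_lim: "filterlim fst sequentially F" unfolding F_def by (rule filterlim_fst_in_probability)
  have lift: "((\<lambda>z. f (fst z)) \<longlongrightarrow> L) F" if "f \<longlonglongrightarrow> L" for f :: "nat \<Rightarrow> real" and L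
    by (rule filterlim_compose[OF that fst_lim])
  have sqrt\<theta>_lim: "(\<lambda>N. sqrt (\<theta> N)) \<longlonglongrightarrow> 0" using tendsto_real_sqrt[OF \<theta>_lim] by simp
  have pos: "\<forall>\<^sub>F z in F. fst z \<ge> 1 \<and> \<theta> (fst z) > 0"
    using filterlim_fst_in_probability[of p] eventually_ge_at_top[of 1] \<theta>
    unfolding F_def filterlim_iff by (metis (mono_tags, lifting) eventually_mono)

  have a_lim: "((\<lambda>z. edge_sum (fst z) (snd z) / ((fst z)\<^sup>2 * \<theta> (fst z))) \<longlongrightarrow> w) F"
  proof -
    define mean where "mean N = (\<Sum>i=1..N. \<Sum>j=1..N. W (real i / N) (real j / N)) / (real N)\<^sup>2" for N
    define X where "X N G = (edge_sum N G / ((real N)\<^sup>2 * \<theta> N) - mean N)\<^sup>2" for N G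
    have "((\<lambda>z. X (fst z) (snd z)) \<longlongrightarrow> 0) F"
      unfolding F_def
    proof (rule in_probability_tendsto_0_Markov)
      show "(\<lambda>N. 4 * k N) \<longlonglongrightarrow> 0" using tendsto_mult_right_zero[OF k_lim] .
      show "\<forall>\<^sub>F N in sequentially. measure_pmf.expectation (p N) (X N) \<le> 4 * k N"
        using eventually_ge_at_top[of 1]
      proof eventually_elim
        case (elim N)
        define \<mu> where "\<mu> = \<theta> N * (\<Sum>i=1..N. \<Sum>j=1..N. W (real i / N) (real j / N))"
        have D: "(real N)\<^sup>2 * \<theta> N > 0" using elim \<theta>[OF elim] by simp
        have "mean N = \<mu> / ((real N)\<^sup>2 * \<theta> N)" using \<theta>[OF elim] by (simp add: mean_def \<mu>_def)
        then have "X N = (\<lambda>G. (edge_sum N G - \<mu>)\<^sup>2 / ((real N)\<^sup>2 * \<theta> N)\<^sup>2)"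
          by (simp add: X_def fun_eq_iff power_divide flip: diff_divide_distrib)
        then have "measure_pmf.expectation (p N) (X N) =
            measure_pmf.expectation (p N) (\<lambda>G. (edge_sum N G - \<mu>)\<^sup>2) / ((real N)\<^sup>2 * \<theta> N)\<^sup>2" by simp
        also have "\<dots> \<le> (4 * (real N)\<^sup>2 * \<theta> N) / ((real N)\<^sup>2 * \<theta> N)\<^sup>2"
          unfolding p_def \<mu>_def using \<theta>[OF elim]
          by (intro divide_right_mono random_graph_edge_sum_variance[OF W]) auto
        also have "\<dots> = 4 * k N / N" using elim \<theta>[OF elim] by (simp add: k_def field_simps power2_eq_square)
        also have "\<dots> \<le> 4 * k N"
          using elim \<theta>[OF elim] divide_left_mono[of 1 "real N" "4 * k N"] by (simp add: k_def)
        finally show ?case .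
      qed
    qed (auto simp: X_def p_def)
    from tendsto_real_sqrt[OF this]
    have "((\<lambda>z. \<bar>edge_sum (fst z) (snd z) / ((real (fst z))\<^sup>2 * \<theta> (fst z)) - mean (fst z)\<bar>) \<longlongrightarrow> 0) F"
      by (simp add: X_def)
    then have "((\<lambda>z. edge_sum (fst z) (snd z) / ((real (fst z))\<^sup>2 * \<theta> (fst z)) - mean (fst z)) \<longlongrightarrow> 0) F"
      by (rule tendsto_rabs_zero_cancel)
    moreover have "((\<lambda>z. mean (fst z)) \<longlongrightarrow> w) F"
      using graphon_grid_mean[OF W R] by (intro lift) (simp add: mean_def[abs_def] w_def)
    ultimately have "((\<lambda>z. edge_sum (fst z) (snd z) / ((real (fst z))\<^sup>2 * \<theta> (fst z)) - mean (fst z) + mean (fst z)) \<longlongrightarrow> 0 + w) F"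
      by (rule tendsto_add)
    then show ?thesis by simp
  qed
  have l_lim: "((\<lambda>z. sqrt (\<theta> (fst z)) * (loop_count (fst z) (snd z) / (fst z * \<theta> (fst z)))) \<longlongrightarrow> 0) F"
    unfolding F_def
  proof (rule in_probability_tendsto_0_Markov[where X = "\<lambda>N G. sqrt (\<theta> N) * (loop_count N G / (real N * \<theta> N))"])
    show "(\<lambda>N. sqrt (\<theta> N)) \<longlonglongrightarrow> 0" by (rule sqrt\<theta>_lim)
    have loop0: "0 \<le> loop_count N G" for N G by (auto simp: loop_count_def adj_def intro!: sum_nonneg)
    show "\<forall>\<^sub>F N in sequentially. \<forall>G. 0 \<le> sqrt (\<theta> N) * (loop_count N G / (real N * \<theta> N))"
      using eventually_ge_at_top[of 1]
    proof eventually_elim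
      case (elim N)
      then show ?case using \<theta>[OF elim] loop0 by simp
    qed
    show "\<forall>\<^sub>F N in sequentially. measure_pmf.expectation (p N) (\<lambda>G. sqrt (\<theta> N) * (loop_count N G / (real N * \<theta> N))) \<le> sqrt (\<theta> N)"
      using eventually_ge_at_top[of 1]
    proof eventually_elim
      case (elim N)
      have "measure_pmf.expectation (p N) (\<lambda>G. sqrt (\<theta> N) * (loop_count N G / (real N * \<theta> N))) =
          sqrt (\<theta> N) * (measure_pmf.expectation (p N) (loop_count N) / (real N * \<theta> N))" by simp
      also have "\<dots> \<le> sqrt (\<theta> N) * ((N * \<theta> N) / (real N * \<theta> N))"
        unfolding p_def using elim \<theta>[OF elim]
        by (intro mult_left_mono divide_right_mono random_graph_loop_mean[OF W]) auto
      also have "\<dots> = sqrt (\<theta> N)" using elim \<theta>[OF elim] by simp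
      finally show ?case .
    qed
  qed (simp add: p_def)
  have k_small: "\<forall>\<^sub>F N in sequentially. \<gamma> * k N < 1"
    using tendsto_mult_right_zero[OF k_lim, of \<gamma>] by (rule order_tendstoD) simp
  have y_lim: "((\<lambda>z. sqrt (\<theta> (fst z)) * subgraph_sum (fst z) (snd z) (\<gamma> / (fst z * \<theta> (fst z)))) \<longlongrightarrow> 0) F"
    unfolding F_def
  proof (rule in_probability_tendsto_0_Markov[where X = "\<lambda>N G. sqrt (\<theta> N) * subgraph_sum N G (\<gamma> / (real N * \<theta> N))"])
    show "(\<lambda>N. sqrt (\<theta> N) * exp (\<gamma>\<^sup>2 / (4 * (1 - \<rho>)))) \<longlonglongrightarrow> 0"
      by (rule tendsto_mult_left_zero[OF sqrt\<theta>_lim])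
    show "\<forall>\<^sub>F N in sequentially. \<forall>G. 0 \<le> sqrt (\<theta> N) * subgraph_sum N G (\<gamma> / (real N * \<theta> N))"
      using eventually_ge_at_top[of 1]
    proof eventually_elim
      case (elim N)
      have "1 \<le> subgraph_sum N G (\<gamma> / (real N * \<theta> N))" for G
        using \<gamma>(2) \<theta>[OF elim] by (intro subgraph_sum_ge_1) auto
      then show ?case using \<theta>[OF elim] by (auto intro!: mult_nonneg_nonneg intro: order_trans[of 0 1])
    qed
    show "\<forall>\<^sub>F N in sequentially. measure_pmf.expectation (p N)
        (\<lambda>G. sqrt (\<theta> N) * subgraph_sum N G (\<gamma> / (real N * \<theta> N))) \<le> sqrt (\<theta> N) * exp (\<gamma>\<^sup>2 / (4 * (1 - \<rho>)))"
      using eventually_ge_at_top[of 1] form k_small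
    proof eventually_elim
      case (elim N)
      have "\<gamma> / (real N * \<theta> N) \<le> 1" using elim(3) by (simp add: k_def)
      then have "measure_pmf.expectation (p N) (\<lambda>G. subgraph_sum N G (\<gamma> / (real N * \<theta> N))) \<le> exp (\<gamma>\<^sup>2 / (4 * (1 - \<rho>)))"
        unfolding p_def using elim \<theta>[OF elim(1)] \<gamma>(2) \<rho> by (intro random_graph_subgraph_sum_mean[OF W]) auto
      then show ?case using \<theta>[OF elim(1)] by (simp add: mult_left_mono)
    qed
  qed (simp add: p_def)

  show ?thesis
  proof (rule levy_continuity)
    show "real_distribution (distr (measure_pmf (graph_ising N (\<theta> N) W \<beta>)) borel
                  (\<lambda>(G, \<sigma>). 1 / sqrt (\<theta> N) * (beta_estimator N (\<theta> N) G \<sigma> - \<beta>)))" for N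
      by (rule prob_space.real_distribution_distr) (simp_all add: measure_pmf.prob_space_axioms)
    show "real_distribution (normal_distribution 0 (2 / graphon_integral W))"
      using assms(4) by (intro char_normal_distribution) simp
    fix t :: real
    define X where "X N G \<sigma> = 1 / sqrt (\<theta> N) * (beta_estimator N (\<theta> N) G \<sigma> - \<beta>)" for N G \<sigma>
    define \<phi> where "\<phi> N G = measure_pmf.expectation (ising N (\<theta> N) \<beta> G) (\<lambda>\<sigma>. iexp (t * X N G \<sigma>))" for N G
    have "((\<lambda>z. \<phi> (fst z) (snd z)) \<longlongrightarrow> of_real (exp (- t\<^sup>2 / w))) F"
      unfolding \<phi>_def X_def
      using \<beta>(1) \<gamma>(1) w pos lift[OF \<theta>_lim] lift[OF k_lim] lift[OF r_lim] a_lim l_lim y_lim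
      by (intro ising_char_limit[where \<gamma> = \<gamma>]) (simp_all add: k_def)
    moreover have "norm (\<phi> N G) \<le> 1" for N G
    proof -
      have "norm (\<phi> N G) \<le> measure_pmf.expectation (ising N (\<theta> N) \<beta> G) (\<lambda>\<sigma>. norm (iexp (t * X N G \<sigma>)))"
        unfolding \<phi>_def by (rule integral_norm_bound)
      then show ?thesis by simp
    qed
    ultimately have "(\<lambda>N. measure_pmf.expectation (p N) (\<phi> N)) \<longlonglongrightarrow> of_real (exp (- t\<^sup>2 / w))"
      unfolding F_def by (intro in_probability_bounded_expectation[where B = 1] p_int) auto
    moreover have "char (distr (measure_pmf (graph_ising N (\<theta> N) W \<beta>)) borel
                  (\<lambda>(G, \<sigma>). 1 / sqrt (\<theta> N) * (beta_estimator N (\<theta> N) G \<sigma> - \<beta>))) t =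
          measure_pmf.expectation (p N) (\<phi> N)" for N
      unfolding char_def by (subst integral_distr) (simp_all add: expectation_graph_ising p_def \<phi>_def[abs_def] X_def)
    moreover have "char (normal_distribution 0 (2 / graphon_integral W)) t = of_real (exp (- t\<^sup>2 / w))"
      using w by (subst char_normal_distribution) (auto simp: w_def)
    ultimately show "(\<lambda>N. char (distr (measure_pmf (graph_ising N (\<theta> N) W \<beta>)) borel
                  (\<lambda>(G, \<sigma>). 1 / sqrt (\<theta> N) * (beta_estimator N (\<theta> N) G \<sigma> - \<beta>))) t)
        \<longlonglongrightarrow> char (normal_distribution 0 (2 / graphon_integral W)) t" by simp
  qed
qed

end
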